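(* A field extension $L|K$ is absolutely co-Galois if and only if the following conditions are fulfilled: 1. The group $\operatorname{T}(L^\times|K^\times)$ generates $L$ as a $K$-algebra, the group extension $K^\times\hookrightarrow \operatorname{T}(L^\times|K^\times)$ is essential, and $(L^\times/K^\times)[\ell^\infty]=1$, i.e. $(L^\times)^\ell\cap K^\times=(K^\times)^\ell$, if $\operatorname{char}K=\ell>0$. 2. If $L^\times$ contains a root of unity $i$ of order $4$, then $i$ already belongs to $K^\times$.
   Context: For a multiplicatively written abelian group $G$ and a prime $p$, $G[p^\infty]$ is its $p$-primary component. An extension $H\subseteq G$ of abelian groups is essential if every subgroup $F\subseteq G$ with $F\cap H=1$ is trivial. For a field extension $L|K$ put $\operatorname{T}(L^\times|K^\times)=\{x\in L^\times: x^n\in K^\times\text{ for some }n\ge1\}$. For a field $K$ and an abelian group $U\supseteq K^\times$ with $D=U/K^\times$ (written additively) and representatives $x_d\in U$ of the classes $d\in D$, $K\langle U\rangle:=\bigoplus_{d\in D}Kx_d$ is the $K$-algebra with $K$-basis $(x_d)$ and multiplication $x_dx_e=a_{d,e}x_{d+e}$, $a_{d,e}\in K^\times$ determined by this equation in $U$ (equivalently, $K\otimes_{\mathbb Z[K^\times]}\mathbb Z[U]$). If $U$ is a subgroup of $B^\times$ for a $K$-algebra $B$ (compatibly with $K^\times$), the inclusion induces a canonical $K$-algebra homomorphism $K\langle U\rangle\to B$. $L|K$ is called absolutely co-Galois if the canonical $K$-algebra homomorphism $K\langle \operatorname{T}(L^\times|K^\times)\rangle\to L$ induced by the inclusion $\operatorname{T}(L^\times|K^\times)\hookrightarrow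 L^\times$ is an isomorphism. *)

theory Defs
  imports "HOL-Algebra.Algebra"
begin

text \<open>
  A field extension \<open>L|K\<close> is a field \<open>L\<close> with a subset \<open>K\<close> satisfying \<^term>\<open>subfield K L\<close>; the field
  \<open>K\<close> itself is \<^term>\<open>L\<lparr>carrier := K\<rparr>\<close>.  All groups are written multiplicatively, quotients included.
\<close>

definition ring_char :: "('a, 'm) ring_scheme \<Rightarrow> nat" where
  "ring_char R = (if \<exists>n::nat. n > 0 \<and> add_pow R n \<one>\<^bsub>R\<^esub> = \<zero>\<^bsub>R\<^esub>
                  then LEAST n. n > 0 \<and> add_pow R n \<one>\<^bsub>R\<^esub> = \<zero>\<^bsub>R\<^esub> else 0)"

definition primary_component :: "('a, 'm) monoid_scheme \<Rightarrow> nat \<Rightarrow> 'a set" where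
  "primary_component G p = {x \<in> carrier G. \<exists>n::nat. x [^]\<^bsub>G\<^esub> (p ^ n) = \<one>\<^bsub>G\<^esub>}"

definition essential_extension :: "'a set \<Rightarrow> ('a, 'm) monoid_scheme \<Rightarrow> bool" where
  "essential_extension H G \<longleftrightarrow>
     subgroup H G \<and> (\<forall>F. subgroup F G \<and> F \<inter> H = {\<one>\<^bsub>G\<^esub>} \<longrightarrow> F = {\<one>\<^bsub>G\<^esub>})"

definition torsion_set :: "('a, 'm) ring_scheme \<Rightarrow> 'a set \<Rightarrow> 'a set" where
  "torsion_set L K =
     {x \<in> Units L. \<exists>n::nat. n \<ge> 1 \<and> x [^]\<^bsub>L\<^esub> n \<in> Units (L\<lparr>carrier := K\<rparr>)}"

definition torsion_group :: "('a, 'm) ring_scheme \<Rightarrow> 'a set \<Rightarrow> 'a monoid" where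
  "torsion_group L K = (units_of L)\<lparr>carrier := torsion_set L K\<rparr>"

text \<open>
  The smallest subring containing \<open>K\<close> and \<open>S\<close>.  The locale \<^locale>\<open>subalgebra\<close> is not suitable here,
  since it does not demand closure under products.
\<close>
definition generates_algebra :: "('a, 'm) ring_scheme \<Rightarrow> 'a set \<Rightarrow> 'a set \<Rightarrow> bool" where
  "generates_algebra L K S \<longleftrightarrow> generate_ring L (K \<union> S) = carrier L"


section \<open>The algebra \<open>K\<langle>U\<rangle>\<close>\<close>

text \<open>
  Below, \<open>K\<close> is a field and \<open>U\<close> an abelian group having the group of units of \<open>K\<close> as a subgroup.
  \<open>D\<close> is the quotient \<open>U/K\<^sup>\<times>\<close>; its elements \<open>d\<close> are cosets.  The representatives \<open>x\<^sub>d\<close> are fixed by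
  the choice operator: another system of representatives gives an isomorphic algebra, compatibly
  with the canonical homomorphisms below.
\<close>

definition class_group :: "('a, 'm) ring_scheme \<Rightarrow> ('a, 'n) monoid_scheme \<Rightarrow> 'a set monoid" where
  "class_group K U = U Mod Units K"

definition class_rep :: "'a set \<Rightarrow> 'a" where
  "class_rep d = (SOME x. x \<in> d)"

text \<open>The unique \<open>a \<in> K\<^sup>\<times>\<close> with \<open>x\<^sub>d x\<^sub>e = a x\<^bsub>de\<^esub>\<close> in \<open>U\<close>.\<close>
definition structure_const ::
    "('a, 'm) ring_scheme \<Rightarrow> ('a, 'n) monoid_scheme \<Rightarrow> 'a set \<Rightarrow> 'a set \<Rightarrow> 'a" where
  "structure_const K U d e =
     (THE a. a \<in> Units K \<and>
        class_rep d \<otimes>\<^bsub>U\<^esub> class_rep e = a \<otimes>\<^bsub>U\<^esub> class_rep (d \<otimes>\<^bsub>class_group K U\<^esub> e))"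

text \<open>
  An element \<open>\<Sum>\<^sub>d f\<^sub>d x\<^sub>d\<close> is encoded as its coefficient function \<open>f\<close>, which is zero outside \<open>D\<close> and
  at all but finitely many points of \<open>D\<close>.  The representative of the trivial class need not
  be \<open>1\<close>; it lies in \<open>K\<^sup>\<times>\<close>, and the unit element is its inverse times the corresponding basis vector.
\<close>
definition coset_algebra ::
    "('a, 'm) ring_scheme \<Rightarrow> ('a, 'n) monoid_scheme \<Rightarrow> ('a, 'a set \<Rightarrow> 'a) module" where
  "coset_algebra K U =
     \<lparr>carrier = {f. (\<forall>d. f d \<in> carrier K) \<and> {d. f d \<noteq> \<zero>\<^bsub>K\<^esub>} \<subseteq> carrier (class_group K U) \<and>
                    finite {d. f d \<noteq> \<zero>\<^bsub>K\<^esub>}},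
      Group.monoid.mult = (\<lambda>f g c.
        finsum K (\<lambda>(d, e). f d \<otimes>\<^bsub>K\<^esub> g e \<otimes>\<^bsub>K\<^esub> structure_const K U d e)
          {(d, e). f d \<noteq> \<zero>\<^bsub>K\<^esub> \<and> g e \<noteq> \<zero>\<^bsub>K\<^esub> \<and> d \<otimes>\<^bsub>class_group K U\<^esub> e = c}),
      one = (\<lambda>c. if c = \<one>\<^bsub>class_group K U\<^esub> then inv\<^bsub>K\<^esub> (class_rep c) else \<zero>\<^bsub>K\<^esub>),
      ring.zero = (\<lambda>c. \<zero>\<^bsub>K\<^esub>),
      ring.add = (\<lambda>f g c. f c \<oplus>\<^bsub>K\<^esub> g c),
      smult = (\<lambda>a f c. a \<otimes>\<^bsub>K\<^esub> f c)\<rparr>"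

text \<open>
  For a \<open>K\<close>-algebra \<open>B\<close> with \<open>U\<close> a subgroup of its group of units: \<open>\<Sum>\<^sub>d f\<^sub>d x\<^sub>d\<close> evaluated in \<open>B\<close>.
\<close>
definition canonical_hom ::
    "('a, 'm) ring_scheme \<Rightarrow> ('a, 'n) monoid_scheme \<Rightarrow> ('a, 'a, 'k) module_scheme \<Rightarrow>
      ('a set \<Rightarrow> 'a) \<Rightarrow> 'a" where
  "canonical_hom K U B f = (\<Oplus>\<^bsub>B\<^esub>d \<in> {d. f d \<noteq> \<zero>\<^bsub>K\<^esub>}. f d \<odot>\<^bsub>B\<^esub> class_rep d)"

definition algebra_iso ::
    "('a, 'm) ring_scheme \<Rightarrow> ('a, 'b, 'k) module_scheme \<Rightarrow> ('a, 'c, 'l) module_scheme \<Rightarrow>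
      ('b \<Rightarrow> 'c) set" where
  "algebra_iso K A B =
     {h \<in> ring_iso A B. \<forall>a\<in>carrier K. \<forall>v\<in>carrier A. h (a \<odot>\<^bsub>A\<^esub> v) = a \<odot>\<^bsub>B\<^esub> h v}"

text \<open>A ring as an algebra over any of its subrings.\<close>
definition ring_as_algebra :: "('a, 'm) ring_scheme \<Rightarrow> ('a, 'a) module" where
  "ring_as_algebra L =
     \<lparr>carrier = carrier L, Group.monoid.mult = (\<otimes>\<^bsub>L\<^esub>), one = \<one>\<^bsub>L\<^esub>, ring.zero = \<zero>\<^bsub>L\<^esub>, ring.add = (\<oplus>\<^bsub>L\<^esub>),
      smult = (\<otimes>\<^bsub>L\<^esub>)\<rparr>"

definition absolutely_co_Galois :: "('a, 'm) ring_scheme \<Rightarrow> 'a set \<Rightarrow> bool" where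
  "absolutely_co_Galois L K \<longleftrightarrow>
     (let k = L\<lparr>carrier := K\<rparr>; U = torsion_group L K in
        canonical_hom k U (ring_as_algebra L)
          \<in> algebra_iso k (coset_algebra k U) (ring_as_algebra L))"

end

(*
The canonical homomorphism is an isomorphism iff the torsion of L^x modulo K^x generates L and
representatives of its classes are linearly independent over K, so everything is about this
independence.

Necessity: the sum over a nontrivial finite cyclic group meeting K^x trivially is zero, which is a
dependence between inequivalent elements; and 1, y, 1 + y are dependent, where for y^l in K
(l the characteristic) and for y of order 4 a power of 1 + y lies in K as well.

Sufficiency (Kneser): one adjoins radicals of prime degree p one at a time.  If b^p is in K and b is
not, the norm shows that K(b) has degree p.  The essential point is that every nonzero x in K(b) with
a power in K lies in K^x b^j for some j: the norm reduces this to x^p in K, and then the trace,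
computed in the bases of powers of b and of powers of x b^j, shows that otherwise all coordinates
of x vanish.
*)
theory Submission
  imports Defs "HOL-Combinatorics.Permutations"
begin

section \<open>Determinants over commutative rings\<close>

text \<open>The hypotheses on roots survive the passage from \<open>K\<close> to \<open>K(b)\<close>
  because they concern the whole field: once the prime order roots of unity and the square roots of
  -1 in \<open>R\<close> lie in \<open>K\<close>, they lie in every larger subfield. What can be
  lost is inequivalence: elements to be shown independent may become proportional over
  \<open>K(b)\<close>. Their quotient is then torsion over \<open>K\<close>, and its form
  \<open>k b^j\<close> turns each collapsed class into a relation between powers of
  \<open>b\<close>, settled by the degree \<open>p\<close>. Two points are delicate. The norm of
  \<open>b\<close> is known only up to sign, so \<open>p\<close>-th roots of -1 must lie in
  \<open>K\<close> too; for odd \<open>p\<close> these are negatives of roots of unity, for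
  \<open>p = 2\<close> they are the element i of the second condition. And the trace argument
  divides by \<open>p\<close>, so \<open>p\<close> must not be the characteristic; the condition on
  \<open>l\<close>-th roots removes the characteristic from the exponents. Norm and trace are those
  of multiplication maps, with Leibniz determinants; no conjugates or splitting fields
  occur.\<close>

lemma (in abelian_monoid) finsum_swap:
  assumes "finite A" "finite B" "\<And>x y. x \<in> A \<Longrightarrow> y \<in> B \<Longrightarrow> f x y \<in> carrier G"
  shows "(\<Oplus>x\<in>A. \<Oplus>y\<in>B. f x y) = (\<Oplus>y\<in>B. \<Oplus>x\<in>A. f x y)"
  using assms(1,3)
proof (induction A rule: finite_induct)
  case empty
  then show ?case by simp
next
  case (insert a A)
  have "(\<Oplus>x\<in>insert a A. \<Oplus>y\<in>B. f x y) = (\<Oplus>y\<in>B. f a y) \<oplus> (\<Oplus>x\<in>A. \<Oplus>y\<in>B. f x y)"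
    using insert by (intro finsum_insert) auto
  also have "\<dots> = (\<Oplus>y\<in>B. f a y) \<oplus> (\<Oplus>y\<in>B. \<Oplus>x\<in>A. f x y)"
    using insert by simp
  also have "\<dots> = (\<Oplus>y\<in>B. f a y \<oplus> (\<Oplus>x\<in>A. f x y))"
    using insert by (intro finsum_addf[symmetric]) auto
  also have "\<dots> = (\<Oplus>y\<in>B. \<Oplus>x\<in>insert a A. f x y)"
    using insert by (intro finsum_cong') (auto intro!: finsum_closed)
  finally show ?case .
qed

text \<open>Multiplying out chooses one summand in every factor. In \<open>det_mult\<close> the
  factors come from the rows of a matrix product, and the choice \<open>f\<close> becomes a
  selection of rows.\<close>

lemma (in cring) finprod_finsum_PiE:
  assumes "finite I" "finite S" "\<And>i k. i \<in> I \<Longrightarrow> k \<in> S \<Longrightarrow> F i k \<in> carrier R"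
  shows "(\<Otimes>i\<in>I. \<Oplus>k\<in>S. F i k) = (\<Oplus>f\<in>(I \<rightarrow>\<^sub>E S). \<Otimes>i\<in>I. F i (f i))"
  using assms(1,3)
proof (induction I rule: finite_induct)
  case empty
  then show ?case by simp
next
  case (insert a I)
  let ?P = "I \<rightarrow>\<^sub>E S"
  have Fc: "\<And>f i. f \<in> ?P \<Longrightarrow> i \<in> I \<Longrightarrow> F i (f i) \<in> carrier R" "\<And>k. k \<in> S \<Longrightarrow> F a k \<in> carrier R"
    using insert by (auto simp: PiE_def Pi_def)
  have finP: "finite ?P" using insert assms(2) by (intro finite_PiE) auto
  \<comment> \<open>Members of \<open>?P\<close> have the default value at \<open>a\<close>, so the
    update there can be undone.\<close>
  have inj: "inj_on (\<lambda>f. f(a := k)) ?P" for k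
    using insert(2) by (intro inj_onI) (metis PiE_arb fun_upd_triv fun_upd_upd)
  have img: "(insert a I \<rightarrow>\<^sub>E S) = (\<Union>k\<in>S. (\<lambda>f. f(a := k)) ` ?P)"
    by (auto simp: PiE_insert_eq)
  have upd: "\<And>f k. f \<in> ?P \<Longrightarrow> k \<in> S \<Longrightarrow> f(a := k) \<in> insert a I \<rightarrow>\<^sub>E S"
    unfolding img by blast
  have prodc: "\<And>g. g \<in> insert a I \<rightarrow>\<^sub>E S \<Longrightarrow> (\<Otimes>i\<in>insert a I. F i (g i)) \<in> carrier R"
    using insert(4) by (intro finprod_closed) (auto simp: PiE_iff)
  have "(\<Otimes>i\<in>insert a I. \<Oplus>k\<in>S. F i k) = (\<Oplus>k\<in>S. F a k) \<otimes> (\<Oplus>f\<in>?P. \<Otimes>i\<in>I. F i (f i))"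
    using insert Fc by (subst finprod_insert) auto
  also have "\<dots> = (\<Oplus>k\<in>S. F a k \<otimes> (\<Oplus>f\<in>?P. \<Otimes>i\<in>I. F i (f i)))"
    using Fc assms(2) by (intro finsum_ldistr) (auto intro!: finsum_closed finprod_closed)
  also have "\<dots> = (\<Oplus>k\<in>S. \<Oplus>f\<in>?P. F a k \<otimes> (\<Otimes>i\<in>I. F i (f i)))"
    using Fc finP by (intro finsum_cong' finsum_rdistr) (auto intro!: finsum_closed finprod_closed)
  also have "\<dots> = (\<Oplus>k\<in>S. \<Oplus>f\<in>?P. \<Otimes>i\<in>insert a I. F i ((f(a := k)) i))"
  proof (intro finsum_cong' refl)
    fix k f assume kf: "k \<in> S" "f \<in> ?P"
    have "(\<Otimes>i\<in>I. F i ((f(a := k)) i)) = (\<Otimes>i\<in>I. F i (f i))"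
      using kf insert Fc by (intro finprod_cong') auto
    then show "F a k \<otimes> (\<Otimes>i\<in>I. F i (f i)) = (\<Otimes>i\<in>insert a I. F i ((f(a := k)) i))"
      using kf insert Fc by (subst finprod_insert) auto
  qed (use Fc insert in \<open>auto intro!: finsum_closed finprod_closed\<close>)
  also have "\<dots> = (\<Oplus>k\<in>S. \<Oplus>g\<in>(\<lambda>f. f(a := k)) ` ?P. \<Otimes>i\<in>insert a I. F i (g i))"
    using upd by (intro finsum_cong' refl finsum_reindex[OF _ inj, symmetric])
      (auto simp del: fun_upd_apply finprod_insert intro!: finsum_closed prodc)
  also have "\<dots> = (\<Oplus>g\<in>(\<Union>k\<in>S. (\<lambda>f. f(a := k)) ` ?P). \<Otimes>i\<in>insert a I. F i (g i))"
  proof (rule add.finprod_UN_disjoint[symmetric])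
    show "pairwise (\<lambda>k l. disjnt ((\<lambda>f. f(a := k)) ` ?P) ((\<lambda>f. f(a := l)) ` ?P)) S"
      by (auto simp: pairwise_def disjnt_def dest: fun_cong[where x = a])
  qed (use assms(2) finP upd in \<open>auto simp del: fun_upd_apply finprod_insert intro!: prodc\<close>)
  finally show ?case using img by simp
qed

context cring
begin

text \<open>The sign lives in \<open>R\<close> itself, so no integer multiples are needed; in
  characteristic 2 both values agree.\<close>

definition perm_sign :: "(nat \<Rightarrow> nat) \<Rightarrow> 'a" where
  "perm_sign s = (if evenperm s then \<one> else \<ominus> \<one>)"

definition det :: "nat \<Rightarrow> (nat \<Rightarrow> nat \<Rightarrow> 'a) \<Rightarrow> 'a" where
  "det n A = (\<Oplus>s\<in>{s. s permutes {..<n}}. perm_sign s \<otimes> (\<Otimes>i\<in>{..<n}. A i (s i)))"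

lemma perm_sign_closed [simp]: "perm_sign s \<in> carrier R"
  by (simp add: perm_sign_def)

lemma perm_sign_comp:
  "permutation s \<Longrightarrow> permutation t \<Longrightarrow> perm_sign (s \<circ> t) = perm_sign s \<otimes> perm_sign t"
  by (auto simp: perm_sign_def evenperm_comp l_minus)

lemma perm_term_closed:
  assumes "s permutes {..<n}" "\<And>i j. i < n \<Longrightarrow> j < n \<Longrightarrow> A i j \<in> carrier R"
  shows "(\<Otimes>i\<in>{..<n}. A i (s i)) \<in> carrier R"
  using assms permutes_in_image[OF assms(1)] by (auto intro!: finprod_closed)

lemma det_closed:
  assumes "\<And>i j. i < n \<Longrightarrow> j < n \<Longrightarrow> A i j \<in> carrier R"
  shows "det n A \<in> carrier R"
  unfolding det_def using assms by (auto intro!: finsum_closed perm_term_closed)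

lemma det_cong:
  assumes "\<And>i j. i < n \<Longrightarrow> j < n \<Longrightarrow> A i j = B i j"
    and "\<And>i j. i < n \<Longrightarrow> j < n \<Longrightarrow> B i j \<in> carrier R"
  shows "det n A = det n B"
  unfolding det_def
proof (intro finsum_cong' refl)
  fix s assume "s \<in> {s. s permutes {..<n}}"
  then have s: "s permutes {..<n}" by simp
  have "(\<Otimes>i\<in>{..<n}. A i (s i)) = (\<Otimes>i\<in>{..<n}. B i (s i))"
    using assms permutes_in_image[OF s] by (intro finprod_cong') auto
  then show "perm_sign s \<otimes> (\<Otimes>i\<in>{..<n}. A i (s i)) = perm_sign s \<otimes> (\<Otimes>i\<in>{..<n}. B i (s i))"
    by simp
qed (use assms in \<open>auto intro!: perm_term_closed\<close>)

text \<open>Replacing \<open>s\<close> by \<open>s \<circ> f\<close> permutes the summands; the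
  factors are then reordered along \<open>f\<close>, and the sign is multiplicative.\<close>

lemma det_permute_rows:
  assumes A: "\<And>i j. i < n \<Longrightarrow> j < n \<Longrightarrow> A i j \<in> carrier R" and f: "f permutes {..<n}"
  shows "det n (\<lambda>i. A (f i)) = perm_sign f \<otimes> det n A"
proof -
  let ?P = "{s. s permutes {..<n}}"
  have pf: "permutation f" using f by (meson finite_lessThan permutation_permutes)
  have inj: "inj_on (\<lambda>s. s \<circ> f) ?P"
    using permutes_surj[OF f] by (intro inj_onI) (simp add: fun.inj_map_strong surj_fun_eq)
  have img: "(\<lambda>s. s \<circ> f) ` ?P = ?P"
    using image_compose_permutations_right[OF f] by (simp add: image_Collect)
  have "det n (\<lambda>i. A (f i)) =
      (\<Oplus>s\<in>?P. perm_sign (s \<circ> f) \<otimes> (\<Otimes>i\<in>{..<n}. A (f i) ((s \<circ> f) i)))"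
  proof -
    have "(\<lambda>s. perm_sign s \<otimes> (\<Otimes>i\<in>{..<n}. A (f i) (s i))) \<in> (\<lambda>s. s \<circ> f) ` ?P \<rightarrow> carrier R"
      unfolding img using A permutes_in_image[OF f] by (auto intro!: perm_term_closed)
    from finsum_reindex[OF this inj] show ?thesis unfolding det_def img .
  qed
  also have "\<dots> = (\<Oplus>s\<in>?P. perm_sign f \<otimes> (perm_sign s \<otimes> (\<Otimes>i\<in>{..<n}. A i (s i))))"
  proof (intro finsum_cong' refl)
    fix s assume "s \<in> ?P"
    then have s: "s permutes {..<n}" by simp
    then have ps: "permutation s" by (meson finite_lessThan permutation_permutes)
    have "(\<Otimes>i\<in>{..<n}. A (f i) ((s \<circ> f) i)) = (\<Otimes>i\<in>f ` {..<n}. A i (s i))"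
      using permutes_inj_on[OF f] A permutes_in_image[OF f] permutes_in_image[OF s]
      by (subst finprod_reindex) auto
    also have "\<dots> = (\<Otimes>i\<in>{..<n}. A i (s i))"
      by (simp add: permutes_image[OF f])
    finally show "perm_sign (s \<circ> f) \<otimes> (\<Otimes>i\<in>{..<n}. A (f i) ((s \<circ> f) i)) =
        perm_sign f \<otimes> (perm_sign s \<otimes> (\<Otimes>i\<in>{..<n}. A i (s i)))"
      using perm_term_closed[of s n A] s A by (simp add: perm_sign_comp[OF ps pf] m_ac)
  qed (use A in \<open>auto intro!: perm_term_closed m_closed\<close>)
  also have "\<dots> = perm_sign f \<otimes> det n A"
    unfolding det_def using A by (intro finsum_rdistr[symmetric]) (auto intro!: perm_term_closed finite_permutations)
  finally show ?thesis .
qed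

text \<open>Composition with the transposition of two equal rows pairs the even permutations with the odd ones.\<close>
lemma det_equal_rows:
  assumes A: "\<And>i j. i < n \<Longrightarrow> j < n \<Longrightarrow> A i j \<in> carrier R"
    and ab: "a < n" "b < n" "a \<noteq> b" "A a = A b"
  shows "det n A = \<zero>"
proof -
  let ?t = "transpose a b"
  let ?P = "{s. s permutes {..<n}}"
  let ?E = "{s. s permutes {..<n} \<and> evenperm s}"
  let ?O = "{s. s permutes {..<n} \<and> \<not> evenperm s}"
  let ?T = "\<lambda>s. (\<Otimes>i\<in>{..<n}. A i (s i))"
  have t: "?t permutes {..<n}" using ab by (intro permutes_swap_id) auto
  have pt: "permutation ?t" by (rule permutation_swap_id)
  have fin: "finite ?P" by (intro finite_permutations) simp
  then have finE: "finite ?E" and finO: "finite ?O" by (auto elim: rev_finite_subset)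
  have T: "\<And>s. s permutes {..<n} \<Longrightarrow> ?T s \<in> carrier R" using A by (auto intro!: perm_term_closed)
  have perm: "\<And>s. s permutes {..<n} \<Longrightarrow> permutation s" by (meson finite_lessThan permutation_permutes)
  have inj: "inj_on (\<lambda>s. s \<circ> ?t) ?E"
    by (intro inj_onI) (metis comp_assoc comp_id transpose_comp_involutory)
  have img: "(\<lambda>s. s \<circ> ?t) ` ?E = ?O"
  proof
    show "(\<lambda>s. s \<circ> ?t) ` ?E \<subseteq> ?O"
      using ab t perm pt by (auto simp: permutes_compose evenperm_comp evenperm_swap)
    show "?O \<subseteq> (\<lambda>s. s \<circ> ?t) ` ?E"
    proof
      fix s assume "s \<in> ?O"
      then have "s \<circ> ?t \<in> ?E" "s = (s \<circ> ?t) \<circ> ?t"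
        using ab t perm pt by (auto simp: permutes_compose evenperm_comp evenperm_swap comp_assoc)
      then show "s \<in> (\<lambda>s. s \<circ> ?t) ` ?E" by blast
    qed
  qed
  \<comment> \<open>The rows \<open>a\<close> and \<open>b\<close> agree, so \<open>A i\<close> may
    be read as \<open>A (?t i)\<close>; reindexing the product along the transposition then removes
    it from \<open>s\<close>.\<close>
  have Tt: "?T (s \<circ> ?t) = ?T s" if s: "s permutes {..<n}" for s
  proof -
    have "?T (s \<circ> ?t) = (\<Otimes>i\<in>{..<n}. A (?t i) (s (?t i)))"
      using A ab permutes_in_image[OF t] permutes_in_image[OF s]
      by (intro finprod_cong') (auto simp: transpose_def)
    also have "\<dots> = (\<Otimes>i\<in>?t ` {..<n}. A i (s i))"
      using permutes_inj_on[OF t] A permutes_in_image[OF t] permutes_in_image[OF s]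
      by (subst finprod_reindex) auto
    also have "\<dots> = ?T s" by (simp add: permutes_image[OF t])
    finally show ?thesis .
  qed
  have "det n A = (\<Oplus>s\<in>?E \<union> ?O. perm_sign s \<otimes> ?T s)"
    unfolding det_def by (rule arg_cong[where f = "finsum R _"]) auto
  also have "\<dots> = (\<Oplus>s\<in>?E. perm_sign s \<otimes> ?T s) \<oplus> (\<Oplus>s\<in>?O. perm_sign s \<otimes> ?T s)"
    using finE finO T by (intro finsum_Un_disjoint) auto
  also have "(\<Oplus>s\<in>?O. perm_sign s \<otimes> ?T s) = (\<Oplus>s\<in>?E. perm_sign (s \<circ> ?t) \<otimes> ?T (s \<circ> ?t))"
  proof -
    have "(\<lambda>s. perm_sign s \<otimes> ?T s) \<in> (\<lambda>s. s \<circ> ?t) ` ?E \<rightarrow> carrier R"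
      unfolding img using T by auto
    from finsum_reindex[OF this inj] show ?thesis unfolding img .
  qed
  also have "\<dots> = (\<Oplus>s\<in>?E. (\<ominus> \<one>) \<otimes> (perm_sign s \<otimes> ?T s))"
    using perm pt T Tt ab
    by (intro finsum_cong') (auto simp: perm_sign_comp, auto simp: perm_sign_def evenperm_swap l_minus)
  also have "\<dots> = (\<ominus> \<one>) \<otimes> (\<Oplus>s\<in>?E. perm_sign s \<otimes> ?T s)"
    using finE T by (intro finsum_rdistr[symmetric]) auto
  also have "(\<Oplus>s\<in>?E. perm_sign s \<otimes> ?T s) \<oplus> \<dots> = \<zero>"
    using T by (simp add: l_minus r_neg finsum_closed)
  finally show ?thesis .
qed

text \<open>Expanding every row of the product gives a sum over row selections \<open>f\<close> of
  entries of \<open>A\<close> times the determinant of the selected rows of \<open>B\<close>. A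
  selection with a repetition contributes zero; the others are permutations and contribute their
  sign times \<open>det n B\<close>.\<close>

lemma det_mult:
  assumes A: "\<And>i j. i < n \<Longrightarrow> j < n \<Longrightarrow> A i j \<in> carrier R"
    and B: "\<And>i j. i < n \<Longrightarrow> j < n \<Longrightarrow> B i j \<in> carrier R"
  shows "det n (\<lambda>i j. \<Oplus>k\<in>{..<n}. A i k \<otimes> B k j) = det n A \<otimes> det n B"
proof -
  let ?P = "{s. s permutes {..<n}}"
  let ?F = "{..<n} \<rightarrow>\<^sub>E {..<n}"
  let ?a = "\<lambda>f. \<Otimes>i\<in>{..<n}. A i (f i)"
  have finP: "finite ?P" by (intro finite_permutations) simp
  have finF: "finite ?F" by (intro finite_PiE) auto
  have F: "\<And>f i. f \<in> ?F \<Longrightarrow> i < n \<Longrightarrow> f i < n" by auto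
  have a: "\<And>f. f \<in> ?F \<Longrightarrow> ?a f \<in> carrier R" using A F by (auto intro!: finprod_closed)
  have b: "\<And>f s. f \<in> ?F \<Longrightarrow> s permutes {..<n} \<Longrightarrow> (\<Otimes>i\<in>{..<n}. B (f i) (s i)) \<in> carrier R"
  proof -
    fix f s assume f: "f \<in> ?F" and s: "s permutes {..<n}"
    show "(\<Otimes>i\<in>{..<n}. B (f i) (s i)) \<in> carrier R"
      using B F[OF f] permutes_in_image[OF s] by (intro finprod_closed) auto
  qed
  have "det n (\<lambda>i j. \<Oplus>k\<in>{..<n}. A i k \<otimes> B k j) =
      (\<Oplus>s\<in>?P. \<Oplus>f\<in>?F. ?a f \<otimes> (perm_sign s \<otimes> (\<Otimes>i\<in>{..<n}. B (f i) (s i))))"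
    unfolding det_def
  proof (intro finsum_cong' refl)
    fix s assume "s \<in> ?P"
    then have s: "s permutes {..<n}" by simp
    have si: "\<And>i. i < n \<Longrightarrow> s i < n" using permutes_in_image[OF s] by auto
    have "(\<Otimes>i\<in>{..<n}. \<Oplus>k\<in>{..<n}. A i k \<otimes> B k (s i)) =
        (\<Oplus>f\<in>?F. \<Otimes>i\<in>{..<n}. A i (f i) \<otimes> B (f i) (s i))"
      using A B si by (intro finprod_finsum_PiE) auto
    also have "\<dots> = (\<Oplus>f\<in>?F. ?a f \<otimes> (\<Otimes>i\<in>{..<n}. B (f i) (s i)))"
      using A B si F a b[OF _ s] by (intro finsum_cong' refl finprod_multf) auto
    finally have "perm_sign s \<otimes> (\<Otimes>i\<in>{..<n}. \<Oplus>k\<in>{..<n}. A i k \<otimes> B k (s i)) =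
        (\<Oplus>f\<in>?F. perm_sign s \<otimes> (?a f \<otimes> (\<Otimes>i\<in>{..<n}. B (f i) (s i))))"
      using finF a b[OF _ s] by (simp add: finsum_rdistr Pi_def)
    also have "\<dots> = (\<Oplus>f\<in>?F. ?a f \<otimes> (perm_sign s \<otimes> (\<Otimes>i\<in>{..<n}. B (f i) (s i))))"
      using a b[OF _ s] by (intro finsum_cong') (auto simp: m_ac)
    finally show "perm_sign s \<otimes> (\<Otimes>i\<in>{..<n}. \<Oplus>k\<in>{..<n}. A i k \<otimes> B k (s i)) =
        (\<Oplus>f\<in>?F. ?a f \<otimes> (perm_sign s \<otimes> (\<Otimes>i\<in>{..<n}. B (f i) (s i))))" .
  qed (use a b in \<open>auto intro!: finsum_closed\<close>)
  also have "\<dots> = (\<Oplus>f\<in>?F. \<Oplus>s\<in>?P. ?a f \<otimes> (perm_sign s \<otimes> (\<Otimes>i\<in>{..<n}. B (f i) (s i))))"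
    using finP finF a b by (intro finsum_swap) auto
  also have "\<dots> = (\<Oplus>f\<in>?F. ?a f \<otimes> det n (\<lambda>i. B (f i)))"
    unfolding det_def using finP a b
    by (intro finsum_cong' finsum_rdistr[symmetric]) (auto intro!: finsum_closed)
  also have "\<dots> = (\<Oplus>s\<in>?P. (perm_sign s \<otimes> (\<Otimes>i\<in>{..<n}. A i (s i))) \<otimes> det n B)"
  proof -
    \<comment> \<open>Permutations are the identity outside \<open>{..<n}\<close>, while selections
      in \<open>?F\<close> take the default value there; restriction translates.\<close>
    let ?r = "\<lambda>s. restrict s {..<n}"
    have inj: "inj_on ?r ?P"
      by (intro inj_onI ext) (metis (mono_tags) mem_Collect_eq permutes_not_in restrict_apply')
    have sub: "?r ` ?P \<subseteq> ?F" using permutes_in_image by fastforce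
    have dB: "\<And>f. f \<in> ?F \<Longrightarrow> det n (\<lambda>i. B (f i)) \<in> carrier R"
      using B F by (intro det_closed) auto
    have zero: "det n (\<lambda>i. B (f i)) = \<zero>" if f: "f \<in> ?F - ?r ` ?P" for f
    proof -
      have "\<not> inj_on f {..<n}"
      proof
        assume i: "inj_on f {..<n}"
        let ?s = "\<lambda>i. if i < n then f i else i"
        have "bij_betw f {..<n} {..<n}"
          using i F f endo_inj_surj[of "{..<n}" f] by (simp add: bij_betw_def image_subset_iff)
        moreover have "bij_betw ?s {..<n} {..<n} = bij_betw f {..<n} {..<n}"
          by (rule bij_betw_cong) simp
        ultimately have "bij_betw ?s {..<n} {..<n}" by simp
        then have "?s permutes {..<n}" by (rule bij_imp_permutes) simp
        moreover have "f = ?r ?s"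
        proof
          fix i show "f i = ?r ?s i" using f PiE_arb[of f "{..<n}" "\<lambda>_. {..<n}" i] by (cases "i < n") auto
        qed
        ultimately show False using f by blast
      qed
      then obtain x y where xy: "x < n" "y < n" "x \<noteq> y" "f x = f y" by (auto simp: inj_on_def)
      show ?thesis by (rule det_equal_rows[of n _ x y]) (use B F f xy in auto)
    qed
    have "(\<Oplus>f\<in>?F. ?a f \<otimes> det n (\<lambda>i. B (f i))) = (\<Oplus>f\<in>?r ` ?P. ?a f \<otimes> det n (\<lambda>i. B (f i)))"
      using finF sub a dB zero by (intro add.finprod_mono_neutral_cong_right) auto
    also have "\<dots> = (\<Oplus>s\<in>?P. ?a (?r s) \<otimes> det n (\<lambda>i. B (?r s i)))"
    proof (rule finsum_reindex[OF _ inj])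
      show "(\<lambda>f. ?a f \<otimes> det n (\<lambda>i. B (f i))) \<in> ?r ` ?P \<rightarrow> carrier R"
        using subsetD[OF sub] a dB by (intro funcsetI m_closed) blast+
    qed
    also have "\<dots> = (\<Oplus>s\<in>?P. (perm_sign s \<otimes> (\<Otimes>i\<in>{..<n}. A i (s i))) \<otimes> det n B)"
    proof (intro finsum_cong' refl)
      fix s assume "s \<in> ?P"
      then have s: "s permutes {..<n}" by simp
      have si: "\<And>i. i < n \<Longrightarrow> s i < n" using permutes_in_image[OF s] by auto
      have 1: "?a (?r s) = (\<Otimes>i\<in>{..<n}. A i (s i))" using A si by (intro finprod_cong') auto
      have "det n (\<lambda>i. B (?r s i)) = det n (\<lambda>i. B (s i))" using B si by (intro det_cong) auto
      also have "\<dots> = perm_sign s \<otimes> det n B" by (rule det_permute_rows[OF B s])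
      finally show "?a (?r s) \<otimes> det n (\<lambda>i. B (?r s i)) =
          (perm_sign s \<otimes> (\<Otimes>i\<in>{..<n}. A i (s i))) \<otimes> det n B"
        unfolding 1 using perm_term_closed[of s n A] det_closed[of n B] s A B by (simp add: m_ac)
    qed (use A B in \<open>auto intro!: perm_term_closed det_closed m_closed\<close>)
    finally show ?thesis .
  qed
  also have "\<dots> = det n A \<otimes> det n B"
    unfolding det_def[of n A] using finP A B
    by (intro finsum_ldistr[symmetric]) (auto intro!: perm_term_closed det_closed)
  finally show ?thesis .
qed

text \<open>Every permutation but the identity moves some index and so picks up an off-diagonal
  zero.\<close>

lemma det_scalar:
  assumes c: "c \<in> carrier R"
  shows "det n (\<lambda>i j. if i = j then c else \<zero>) = c [^] n"
proof -
  let ?A = "\<lambda>i j. if i = j then c else \<zero>"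
  have "det n ?A = (\<Oplus>s\<in>{id}. perm_sign s \<otimes> (\<Otimes>i\<in>{..<n}. ?A i (s i)))"
    unfolding det_def
  proof (rule add.finprod_mono_neutral_cong_right)
    show "\<And>s. s \<in> {s. s permutes {..<n}} - {id} \<Longrightarrow> perm_sign s \<otimes> (\<Otimes>i\<in>{..<n}. ?A i (s i)) = \<zero>"
    proof -
      fix s assume s: "s \<in> {s. s permutes {..<n}} - {id}"
      then obtain i where i: "s i \<noteq> i" by (auto simp: fun_eq_iff)
      then have "i < n" using s by (metis DiffD1 lessThan_iff mem_Collect_eq permutes_not_in)
      then have "(\<Otimes>i\<in>{..<n}. ?A i (s i)) = ?A i (s i) \<otimes> (\<Otimes>i\<in>{..<n} - {i}. ?A i (s i))"
        using c by (subst finprod_insert[symmetric]) (auto simp: insert_absorb)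
      then show "perm_sign s \<otimes> (\<Otimes>i\<in>{..<n}. ?A i (s i)) = \<zero>" using i c by (simp add: finprod_closed)
    qed
  qed (use c in \<open>auto intro!: finite_permutations permutes_id finprod_closed\<close>)
  also have "\<dots> = c [^] n"
    using c by (simp add: perm_sign_def finprod_const)
  finally show ?thesis .
qed

end

section \<open>Coordinates, norms and traces over a subfield\<close>

lemma (in ring) finsum_in_subring:
  assumes H: "subring H R" and f: "\<And>x. x \<in> A \<Longrightarrow> f x \<in> H"
  shows "(\<Oplus>x\<in>A. f x) \<in> H"
  using f
proof (induction A rule: infinite_finite_induct)
  case (insert x A)
  then show ?case using subringE(1,7)[OF H] by (subst finsum_insert) auto
qed (use subringE(2)[OF H] in auto)

lemma (in cring) finprod_in_subring:
  assumes H: "subring H R" and f: "\<And>x. x \<in> A \<Longrightarrow> f x \<in> H"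
  shows "(\<Otimes>x\<in>A. f x) \<in> H"
  using f
proof (induction A rule: infinite_finite_induct)
  case (insert x A)
  then show ?case using subringE(1,6)[OF H] by (subst finprod_insert) auto
qed (use subringE(3)[OF H] in auto)

lemma (in monoid) pow_in_submonoid:
  assumes "submonoid H G" "x \<in> H" shows "x [^] (n::nat) \<in> H"
  using assms submonoid.m_closed submonoid.one_closed by (induction n) fastforce+

lemma (in cring) det_in_subring:
  assumes H: "subring H R" and A: "\<And>i j. i < n \<Longrightarrow> j < n \<Longrightarrow> A i j \<in> H"
  shows "det n A \<in> H"
  unfolding det_def
proof (rule finsum_in_subring[OF H])
  fix s assume "s \<in> {s. s permutes {..<n}}"
  then have s: "\<And>i. i < n \<Longrightarrow> s i < n" using permutes_in_image by fastforce
  have "(\<Otimes>i\<in>{..<n}. A i (s i)) \<in> H" using A s by (intro finprod_in_subring[OF H]) auto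
  then show "perm_sign s \<otimes> (\<Otimes>i\<in>{..<n}. A i (s i)) \<in> H"
    using subringE(3,5,6)[OF H] by (simp add: perm_sign_def)
qed

lemma (in cring) nat_pow_commute_exponents:
  assumes "x \<in> carrier R" shows "(x [^] (m::nat)) [^] (n::nat) = (x [^] n) [^] m"
  using assms by (simp add: nat_pow_pow mult.commute)

lemma (in field) inv_closed_nonzero:
  assumes "x \<in> carrier R" "x \<noteq> \<zero>"
  shows "inv x \<in> carrier R" "x \<otimes> inv x = \<one>" "inv x \<otimes> x = \<one>" "inv x \<noteq> \<zero>"
  using subfield_m_inv[OF carrier_is_subfield, of x] assms by auto

lemma (in domain) pow_nonzero: "x \<in> carrier R \<Longrightarrow> x \<noteq> \<zero> \<Longrightarrow> x [^] (n::nat) \<noteq> \<zero>"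
  by (induction n) (auto simp: integral_iff)

text \<open>Bezout: with \<open>a * s = b * t + 1\<close> the element is the quotient of
  \<open>x [^] (a * s)\<close> by \<open>x [^] (b * t)\<close>.\<close>

lemma (in field) in_subfield_of_coprime_powers:
  assumes K: "subfield K R" and x: "x \<in> carrier R" "x \<noteq> \<zero>"
    and ab: "x [^] (a::nat) \<in> K" "x [^] (b::nat) \<in> K" "coprime a b"
  shows "x \<in> K"
proof -
  note K' = subfieldE(1)[OF K]
  have sub: "submonoid K R" using K' by (rule subring.axioms)
  have main: "x \<in> K" if "x [^] a \<in> K" "x [^] b \<in> K" "a * s = b * t + 1" for a b s t :: nat
  proof -
    have "(x [^] b) [^] t \<otimes> x = (x [^] a) [^] s"
      using x that(3) by (simp add: nat_pow_pow nat_pow_mult[symmetric] mult.commute)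
    moreover have "(x [^] a) [^] s \<in> K" "(x [^] b) [^] t \<in> K"
      using pow_in_submonoid[OF sub] that by auto
    moreover have "(x [^] b) [^] t \<noteq> \<zero>" using x by (simp add: pow_nonzero)
    ultimately show ?thesis using subfield_m_inv_simprule[OF K, of "(x [^] b) [^] t" x] x by simp
  qed
  show ?thesis
  \<comment> \<open>This form of Bezout over the natural numbers needs \<open>a \<noteq> 0\<close>;
    otherwise coprimality makes \<open>b\<close> equal to 1.\<close>
  proof (cases "a = 0")
    case True
    then have "b = 1" using ab(3) by simp
    then show ?thesis using ab(2) x by simp
  next
    case False
    then obtain s t where "a * s = b * t + 1"
      using coprime_bezout_strong[of a b] ab(3) bezout_nat[of a b] by auto
    then show ?thesis using main ab by blast
  qed
qed

text \<open>The basis is a parameter, so that one \<open>E\<close> can carry several bases and the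
  traces formed with them can be compared.\<close>

locale field_basis = field R for R (structure) +
  fixes K E :: "'a set" and d :: nat and u :: "nat \<Rightarrow> 'a"
  assumes K: "subfield K R" and E: "subring E R" and KE: "K \<subseteq> E"
    and uE: "i < d \<Longrightarrow> u i \<in> E"
    and spanning: "x \<in> E \<Longrightarrow> \<exists>c\<in>{..<d} \<rightarrow> K. x = (\<Oplus>i\<in>{..<d}. c i \<otimes> u i)"
    and independent: "c \<in> {..<d} \<rightarrow> K \<Longrightarrow> (\<Oplus>i\<in>{..<d}. c i \<otimes> u i) = \<zero> \<Longrightarrow> i < d \<Longrightarrow> c i = \<zero>"
begin

lemma K': "subring K R" using subfieldE(1)[OF K] .

lemma E_carrier: "x \<in> E \<Longrightarrow> x \<in> carrier R" and K_carrier: "x \<in> K \<Longrightarrow> x \<in> carrier R"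
  and K_E: "x \<in> K \<Longrightarrow> x \<in> E"
  using subringE(1)[OF E] KE by auto

lemma u_carrier: "i < d \<Longrightarrow> u i \<in> carrier R" using uE E_carrier by auto

lemma E_mult: "x \<in> E \<Longrightarrow> y \<in> E \<Longrightarrow> x \<otimes> y \<in> E" and E_add: "x \<in> E \<Longrightarrow> y \<in> E \<Longrightarrow> x \<oplus> y \<in> E"
  and E_pow: "x \<in> E \<Longrightarrow> x [^] (n::nat) \<in> E"
  using subringE(6,7)[OF E] pow_in_submonoid[OF subring.axioms(2)[OF E]] by auto

lemma K_mult: "x \<in> K \<Longrightarrow> y \<in> K \<Longrightarrow> x \<otimes> y \<in> K" and K_add: "x \<in> K \<Longrightarrow> y \<in> K \<Longrightarrow> x \<oplus> y \<in> K"
  and K_pow: "x \<in> K \<Longrightarrow> x [^] (n::nat) \<in> K"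
  using subringE(6,7)[OF K'] pow_in_submonoid[OF subring.axioms(2)[OF K']] by auto

declare E_carrier [simp] K_carrier [simp] K_E [simp] u_carrier [simp] uE [simp]
  E_mult [simp] E_add [simp] E_pow [simp] K_mult [simp] K_add [simp] K_pow [simp]

definition coord :: "nat \<Rightarrow> 'a \<Rightarrow> 'a" where
  "coord i x = (SOME c. c \<in> {..<d} \<rightarrow> K \<and> x = (\<Oplus>i\<in>{..<d}. c i \<otimes> u i)) i"

lemma coord_closed: "x \<in> E \<Longrightarrow> i < d \<Longrightarrow> coord i x \<in> K"
  and coord_sum: "x \<in> E \<Longrightarrow> (\<Oplus>i\<in>{..<d}. coord i x \<otimes> u i) = x"
proof -
  assume x: "x \<in> E"
  let ?P = "\<lambda>c. c \<in> {..<d} \<rightarrow> K \<and> x = (\<Oplus>i\<in>{..<d}. c i \<otimes> u i)"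
  have "\<exists>c. ?P c" using spanning[OF x] by blast
  then have P: "?P (SOME c. ?P c)" by (rule someI_ex[of ?P])
  have eq: "(\<lambda>i. coord i x) = (SOME c. ?P c)" by (rule ext) (simp only: coord_def)
  show "(\<Oplus>i\<in>{..<d}. coord i x \<otimes> u i) = x"
    using conjunct2[OF P] unfolding eq[symmetric] by (rule sym)
  show "coord i x \<in> K" if "i < d"
    using conjunct1[OF P] that unfolding eq[symmetric] by auto
qed

declare coord_closed [simp]

lemma coord_carrier [simp]: "x \<in> E \<Longrightarrow> i < d \<Longrightarrow> coord i x \<in> carrier R"
  using coord_closed K_carrier by blast

lemma comb_in_E: "c \<in> {..<d} \<rightarrow> K \<Longrightarrow> (\<Oplus>i\<in>{..<d}. c i \<otimes> u i) \<in> E"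
  by (intro finsum_in_subring[OF E]) (auto simp: Pi_iff)

lemma coord_unique:
  assumes c: "c \<in> {..<d} \<rightarrow> K" and x: "x = (\<Oplus>i\<in>{..<d}. c i \<otimes> u i)" and i: "i < d"
  shows "coord i x = c i"
proof -
  have xE: "x \<in> E" using comb_in_E[OF c] x by simp
  have cc: "\<And>j. j < d \<Longrightarrow> c j \<in> carrier R" using c by (auto simp: Pi_iff)
  note xc = coord_carrier[OF xE]
  have "(\<Oplus>i\<in>{..<d}. (coord i x \<ominus> c i) \<otimes> u i) =
      (\<Oplus>i\<in>{..<d}. coord i x \<otimes> u i \<oplus> (\<ominus> \<one>) \<otimes> (c i \<otimes> u i))"
    using xc cc u_carrier by (intro finsum_cong') (auto simp: minus_eq l_distr l_minus)
  also have "\<dots> = x \<oplus> (\<Oplus>i\<in>{..<d}. (\<ominus> \<one>) \<otimes> (c i \<otimes> u i))"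
    using xc cc u_carrier by (subst finsum_addf) (auto simp: coord_sum[OF xE])
  also have "(\<Oplus>i\<in>{..<d}. (\<ominus> \<one>) \<otimes> (c i \<otimes> u i)) = (\<ominus> \<one>) \<otimes> x"
    using cc u_carrier unfolding x by (intro finsum_rdistr[symmetric]) auto
  also have "x \<oplus> (\<ominus> \<one>) \<otimes> x = \<zero>" using E_carrier[OF xE] by (simp add: l_minus r_neg)
  finally have "coord i x \<ominus> c i = \<zero>"
    using c coord_closed[OF xE] subringE(5)[OF K'] K_add i
    by (intro independent[of "\<lambda>i. coord i x \<ominus> c i"]) (auto simp: minus_eq Pi_def)
  then show ?thesis using xc cc i by simp
qed

lemma coord_add:
  assumes "x \<in> E" "y \<in> E" "i < d" shows "coord i (x \<oplus> y) = coord i x \<oplus> coord i y"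
proof (rule coord_unique)
  have "(\<Oplus>i\<in>{..<d}. (coord i x \<oplus> coord i y) \<otimes> u i) =
      (\<Oplus>i\<in>{..<d}. coord i x \<otimes> u i \<oplus> coord i y \<otimes> u i)"
    using assms by (intro finsum_cong') (auto simp: l_distr)
  also have "\<dots> = x \<oplus> y"
    using assms by (subst finsum_addf) (auto simp: coord_sum)
  finally show "x \<oplus> y = (\<Oplus>i\<in>{..<d}. (coord i x \<oplus> coord i y) \<otimes> u i)" by simp
qed (use assms coord_closed K_add in auto)

lemma coord_smult:
  assumes "k \<in> K" "x \<in> E" "i < d" shows "coord i (k \<otimes> x) = k \<otimes> coord i x"
proof (rule coord_unique)
  have "(\<Oplus>i\<in>{..<d}. (k \<otimes> coord i x) \<otimes> u i) = (\<Oplus>i\<in>{..<d}. k \<otimes> (coord i x \<otimes> u i))"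
    using assms by (intro finsum_cong') (auto simp: m_assoc)
  also have "\<dots> = k \<otimes> (\<Oplus>i\<in>{..<d}. coord i x \<otimes> u i)"
    using assms by (intro finsum_rdistr[symmetric]) auto
  finally show "k \<otimes> x = (\<Oplus>i\<in>{..<d}. (k \<otimes> coord i x) \<otimes> u i)" using assms by (simp add: coord_sum)
qed (use assms coord_closed K_mult in auto)

lemma coord_basis:
  assumes "j < d" "i < d" shows "coord i (u j) = (if i = j then \<one> else \<zero>)"
proof (rule coord_unique)
  have "(\<Oplus>i\<in>{..<d}. (if i = j then \<one> else \<zero>) \<otimes> u i) = (\<Oplus>i\<in>{..<d}. if j = i then u i else \<zero>)"
    by (intro finsum_cong') auto
  also have "\<dots> = u j" using assms by (intro finsum_singleton) auto
  finally show "u j = (\<Oplus>i\<in>{..<d}. (if i = j then \<one> else \<zero>) \<otimes> u i)" by simp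
qed (use assms subringE(2,3)[OF K'] in auto)

lemma coord_finsum:
  assumes "finite A" "\<And>x. x \<in> A \<Longrightarrow> f x \<in> E" "i < d"
  shows "coord i (\<Oplus>x\<in>A. f x) = (\<Oplus>x\<in>A. coord i (f x))"
  using assms(1,2) 
proof (induction A rule: finite_induct)
  case empty
  have "coord i (\<zero> \<otimes> \<zero>) = \<zero> \<otimes> coord i \<zero>"
    using subringE(2)[OF K'] assms by (intro coord_smult) auto
  then show ?case using assms subringE(2)[OF K'] by simp
next
  case (insert x A)
  have "(\<Oplus>x\<in>A. f x) \<in> E" using insert by (intro finsum_in_subring[OF E]) auto
  then show ?case
    using insert assms by (subst (1 2) finsum_insert) (auto simp: coord_add)
qed

section \<open>Norm and trace of multiplication maps\<close>

definition norm :: "'a \<Rightarrow> 'a" where "norm z = det d (\<lambda>i j. coord j (z \<otimes> u i))"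

definition trace :: "'a \<Rightarrow> 'a" where "trace z = (\<Oplus>i\<in>{..<d}. coord i (z \<otimes> u i))"

lemma norm_closed [simp]: "z \<in> E \<Longrightarrow> norm z \<in> K"
  unfolding norm_def by (intro det_in_subring[OF K']) auto

text \<open>Row \<open>i\<close> of the matrix holds the coordinates of
  \<open>z \<otimes> u i\<close>, so the matrices of \<open>z\<close> and \<open>w\<close> get
  multiplied in the opposite order; commutativity of \<open>R\<close> repairs this for the
  determinants.\<close>

lemma norm_mult:
  assumes z: "z \<in> E" and w: "w \<in> E" shows "norm (z \<otimes> w) = norm z \<otimes> norm w"
proof -
  have "norm (z \<otimes> w) = det d (\<lambda>i j. \<Oplus>k\<in>{..<d}. coord k (w \<otimes> u i) \<otimes> coord j (z \<otimes> u k))"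
    unfolding norm_def
  proof (rule det_cong)
    fix i j assume ij: "i < d" "j < d"
    have wu: "w \<otimes> u i \<in> E" using w ij by auto
    have "z \<otimes> w \<otimes> u i = z \<otimes> (\<Oplus>k\<in>{..<d}. coord k (w \<otimes> u i) \<otimes> u k)"
      using coord_sum[OF wu] z w ij by (simp add: m_assoc)
    also have "\<dots> = (\<Oplus>k\<in>{..<d}. z \<otimes> (coord k (w \<otimes> u i) \<otimes> u k))"
      using z ij w by (intro finsum_rdistr) auto
    also have "\<dots> = (\<Oplus>k\<in>{..<d}. coord k (w \<otimes> u i) \<otimes> (z \<otimes> u k))"
      using z ij w by (intro finsum_cong') (auto simp: m_lcomm)
    finally have "coord j (z \<otimes> w \<otimes> u i) = (\<Oplus>k\<in>{..<d}. coord j (coord k (w \<otimes> u i) \<otimes> (z \<otimes> u k)))"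
      using z ij w by (simp only:) (rule coord_finsum, auto)
    also have "\<dots> = (\<Oplus>k\<in>{..<d}. coord k (w \<otimes> u i) \<otimes> coord j (z \<otimes> u k))"
      using z ij w by (intro finsum_cong') (auto simp: coord_smult)
    finally show "coord j (z \<otimes> w \<otimes> u i) = (\<Oplus>k\<in>{..<d}. coord k (w \<otimes> u i) \<otimes> coord j (z \<otimes> u k))" .
  qed (use z w in \<open>auto intro!: finsum_closed\<close>)
  also have "\<dots> = norm w \<otimes> norm z"
    unfolding norm_def using z w by (intro det_mult) auto
  finally show ?thesis using norm_closed[OF z] norm_closed[OF w] by (simp add: m_comm)
qed

lemma norm_scalar:
  assumes k: "k \<in> K" shows "norm k = k [^] d"
proof -
  have "norm k = det d (\<lambda>i j. if i = j then k else \<zero>)"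
    unfolding norm_def using k 
    by (intro det_cong) (auto simp: coord_smult coord_basis)
  then show ?thesis using det_scalar k by simp
qed

lemma norm_pow:
  assumes z: "z \<in> E" shows "norm (z [^] (n::nat)) = norm z [^] n"
proof (induction n)
  case 0
  show ?case using norm_scalar[of \<one>] subringE(3)[OF K'] by simp
next
  case (Suc n)
  then show ?case using norm_mult z by simp
qed

text \<open>Comparing \<open>norm z [^] q\<close> with
  \<open>norm (z [^] q) = (z [^] q) [^] d\<close> shows that \<open>z [^] d\<close> divided by
  \<open>norm z\<close> is a \<open>q\<close>-th root of unity, hence in \<open>K\<close>. So
  \<open>z [^] d\<close> and \<open>z [^] q\<close> both lie in \<open>K\<close>, with coprime
  exponents.\<close>

lemma root_in_base:
  assumes q: "Factorial_Ring.prime q" "\<not> q dvd d" and z: "z \<in> E" "z [^] q \<in> K"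
    and roots: "\<And>y. y \<in> carrier R \<Longrightarrow> y [^] q = \<one> \<Longrightarrow> y \<in> K"
  shows "z \<in> K"
proof (cases "z = \<zero>")
  case True
  then show ?thesis using subringE(2)[OF K'] by simp
next
  case False
  note zc = E_carrier[OF z(1)]
  have N: "norm z \<in> carrier R" using norm_closed z by auto
  have e: "norm z [^] q = (z [^] d) [^] q"
    using norm_pow[OF z(1), of q] norm_scalar[OF z(2)] zc by (simp add: nat_pow_commute_exponents)
  have zd: "z [^] d \<noteq> \<zero>" "(z [^] d) [^] q \<noteq> \<zero>" using False zc by (simp_all add: pow_nonzero)
  have N0: "norm z \<noteq> \<zero>" using e zd nat_pow_zero[of q] prime_gt_0_nat[OF q(1)] by auto
  note iN = inv_closed_nonzero[OF N N0]
  have "(z [^] d \<otimes> inv (norm z)) [^] q = (z [^] d) [^] q \<otimes> (inv (norm z)) [^] q"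
    using iN(1) zc by (intro nat_pow_distrib) auto
  also have "\<dots> = norm z [^] q \<otimes> (inv (norm z)) [^] q" by (simp only: e)
  also have "\<dots> = (norm z \<otimes> inv (norm z)) [^] q"
    using iN(1) N by (intro nat_pow_distrib[symmetric]) auto
  also have "\<dots> = \<one>" by (simp only: iN(2) nat_pow_one)
  finally have "(z [^] d \<otimes> inv (norm z)) [^] q = \<one>" .
  moreover have "z [^] d \<otimes> inv (norm z) \<in> carrier R" using iN(1) zc by simp
  ultimately have "z [^] d \<otimes> inv (norm z) \<in> K" using roots by blast
  then have "z [^] d \<otimes> inv (norm z) \<otimes> norm z \<in> K" using z by simp
  then have "z [^] d \<in> K" using iN N zc by (simp add: m_assoc)
  moreover have "coprime q d" using q by (simp add: prime_imp_coprime)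
  ultimately show ?thesis using in_subfield_of_coprime_powers[OF K zc False z(2)] by blast
qed

lemma trace_add:
  assumes "x \<in> E" "y \<in> E" shows "trace (x \<oplus> y) = trace x \<oplus> trace y"
proof -
  have "trace (x \<oplus> y) = (\<Oplus>i\<in>{..<d}. coord i (x \<otimes> u i) \<oplus> coord i (y \<otimes> u i))"
    unfolding trace_def using assms 
    by (intro finsum_cong') (auto simp: l_distr coord_add)
  then show ?thesis unfolding trace_def using assms 
    by (subst (asm) finsum_addf) auto
qed

lemma trace_smult:
  assumes "k \<in> K" "x \<in> E" shows "trace (k \<otimes> x) = k \<otimes> trace x"
proof -
  have "trace (k \<otimes> x) = (\<Oplus>i\<in>{..<d}. k \<otimes> coord i (x \<otimes> u i))"
    unfolding trace_def using assms 
    by (intro finsum_cong') (auto simp: m_assoc coord_smult)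
  then show ?thesis unfolding trace_def using assms 
    by (subst finsum_rdistr) auto
qed

lemma trace_closed [simp]: "x \<in> E \<Longrightarrow> trace x \<in> K"
  unfolding trace_def by (intro finsum_in_subring[OF K']) auto

lemma trace_finsum:
  assumes "finite A" "\<And>x. x \<in> A \<Longrightarrow> f x \<in> E"
  shows "trace (\<Oplus>x\<in>A. f x) = (\<Oplus>x\<in>A. trace (f x))"
  using assms 
proof (induction A rule: finite_induct)
  case empty
  have "trace (\<zero> \<otimes> \<zero>) = \<zero> \<otimes> trace \<zero>"
    using subringE(2)[OF K'] by (intro trace_smult) auto
  then show ?case using subringE(2)[OF K'] by simp
next
  case (insert x A)
  have "(\<Oplus>x\<in>A. f x) \<in> E" using insert by (intro finsum_in_subring[OF E]) auto
  then show ?case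
    using insert by (subst (1 2) finsum_insert) (auto simp: trace_add)
qed

end

text \<open>This is the identity tr(XY) = tr(YX): expanding each basis in the other turns both
  traces into the same double sum.\<close>

lemma (in field) trace_basis_independent:
  assumes "field_basis R K E d u" "field_basis R K E e v" and z: "z \<in> E"
  shows "field_basis.trace R K d u z = field_basis.trace R K e v z"
proof -
  interpret U: field_basis R K E d u by fact
  interpret V: field_basis R K E e v by fact
  let ?f = U.coord and ?g = V.coord
  have cf: "\<And>i x. i < d \<Longrightarrow> x \<in> E \<Longrightarrow> ?f i x \<in> carrier R"
    and cg: "\<And>j x. j < e \<Longrightarrow> x \<in> E \<Longrightarrow> ?g j x \<in> carrier R"
    by auto
  have zu: "\<And>i. i < d \<Longrightarrow> z \<otimes> u i \<in> E" and zv: "\<And>j. j < e \<Longrightarrow> z \<otimes> v j \<in> E"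
    using z by auto
  have "U.trace z = (\<Oplus>i\<in>{..<d}. \<Oplus>j\<in>{..<e}. ?g j (z \<otimes> u i) \<otimes> ?f i (v j))"
    unfolding U.trace_def
  proof (intro finsum_cong' refl)
    fix i assume "i \<in> {..<d}"
    then have i: "i < d" by simp
    have "?f i (z \<otimes> u i) = ?f i (\<Oplus>j\<in>{..<e}. ?g j (z \<otimes> u i) \<otimes> v j)"
      by (simp add: V.coord_sum[OF zu[OF i]])
    also have "\<dots> = (\<Oplus>j\<in>{..<e}. ?f i (?g j (z \<otimes> u i) \<otimes> v j))"
      using zu[OF i] i by (intro U.coord_finsum) auto
    also have "\<dots> = (\<Oplus>j\<in>{..<e}. ?g j (z \<otimes> u i) \<otimes> ?f i (v j))"
      using zu[OF i] i by (intro finsum_cong') (auto simp: U.coord_smult)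
    finally show "?f i (z \<otimes> u i) = (\<Oplus>j\<in>{..<e}. ?g j (z \<otimes> u i) \<otimes> ?f i (v j))" .
  qed (use zu V.uE cf cg in \<open>auto intro!: finsum_closed\<close>)
  also have "\<dots> = (\<Oplus>j\<in>{..<e}. \<Oplus>i\<in>{..<d}. ?g j (z \<otimes> u i) \<otimes> ?f i (v j))"
    using zu by (intro finsum_swap) auto
  also have "\<dots> = V.trace z"
    unfolding V.trace_def
  proof (intro finsum_cong' refl)
    fix j assume "j \<in> {..<e}"
    then have j: "j < e" by simp
    have fv: "\<And>i. i < d \<Longrightarrow> ?f i (v j) \<in> K" using j by auto
    have "z \<otimes> v j = z \<otimes> (\<Oplus>i\<in>{..<d}. ?f i (v j) \<otimes> u i)"
      by (simp add: U.coord_sum[OF V.uE[OF j]])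
    also have "\<dots> = (\<Oplus>i\<in>{..<d}. z \<otimes> (?f i (v j) \<otimes> u i))"
      using z fv by (intro finsum_rdistr) auto
    also have "\<dots> = (\<Oplus>i\<in>{..<d}. ?f i (v j) \<otimes> (z \<otimes> u i))"
      using z fv by (intro finsum_cong') (auto simp: m_lcomm)
    finally have "?g j (z \<otimes> v j) = (\<Oplus>i\<in>{..<d}. ?g j (?f i (v j) \<otimes> (z \<otimes> u i)))"
      using zu j fv by (simp only:) (rule V.coord_finsum, auto)
    also have "\<dots> = (\<Oplus>i\<in>{..<d}. ?g j (z \<otimes> u i) \<otimes> ?f i (v j))"
    proof (intro finsum_cong' refl)
      fix i assume "i \<in> {..<d}"
      then have i: "i < d" by simp
      have "?g j (?f i (v j) \<otimes> (z \<otimes> u i)) = ?f i (v j) \<otimes> ?g j (z \<otimes> u i)"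
        using fv[OF i] zu[OF i] j by (rule V.coord_smult)
      also have "\<dots> = ?g j (z \<otimes> u i) \<otimes> ?f i (v j)"
        using cf[OF i V.uE[OF j]] cg[OF j zu[OF i]] by (rule m_comm)
      finally show "?g j (?f i (v j) \<otimes> (z \<otimes> u i)) = ?g j (z \<otimes> u i) \<otimes> ?f i (v j)" .
    qed (use zu cf[OF _ V.uE[OF j]] cg[OF j] in auto)
    finally show "(\<Oplus>i\<in>{..<d}. ?g j (z \<otimes> u i) \<otimes> ?f i (v j)) = ?g j (z \<otimes> v j)" by simp
  qed (use zv cg in auto)
  finally show ?thesis .
qed

section \<open>Adjoining a radical of prime degree\<close>

text \<open>\<open>exp_base\<close> lists the powers in descending order, so the coefficient of
  \<open>x [^] i\<close> sits at position \<open>n - 1 - i\<close>.\<close>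

lemma (in ring) combine_exp_base:
  assumes "x \<in> carrier R" "set Ks \<subseteq> carrier R" "length Ks = n"
  shows "combine Ks (exp_base x n) = (\<Oplus>i\<in>{..<n}. Ks ! (n - 1 - i) \<otimes> x [^] i)"
  using assms(2,3)
proof (induction n arbitrary: Ks)
  case 0
  then show ?case by (simp add: exp_base_def)
next
  case (Suc n)
  then obtain k Ks' where Ks: "Ks = k # Ks'" by (cases Ks) auto
  have e: "exp_base x (Suc n) = x [^] n # exp_base x n" by (simp add: exp_base_def)
  have nth: "\<And>i. i < length Ks' \<Longrightarrow> Ks' ! i \<in> carrier R" using Suc(2) Ks by auto
  have "(\<Oplus>i\<in>{..<n}. Ks ! (Suc n - 1 - i) \<otimes> x [^] i) = (\<Oplus>i\<in>{..<n}. Ks' ! (n - 1 - i) \<otimes> x [^] i)"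
  proof (intro add.finprod_cong' refl)
    show "(\<lambda>i. Ks' ! (n - 1 - i) \<otimes> x [^] i) \<in> {..<n} \<rightarrow> carrier R"
      using nth Suc(3) Ks assms(1) by auto
    fix i assume "i \<in> {..<n}"
    then have "Suc n - 1 - i = Suc (n - 1 - i)" by auto
    then show "Ks ! (Suc n - 1 - i) \<otimes> x [^] i = Ks' ! (n - 1 - i) \<otimes> x [^] i" using Ks by simp
  qed
  also have "\<dots> = combine Ks' (exp_base x n)" using Suc Ks by simp
  finally have IH: "(\<Oplus>i\<in>{..<n}. Ks ! (Suc n - 1 - i) \<otimes> x [^] i) = combine Ks' (exp_base x n)" .
  have c: "Ks ! (Suc n - 1 - i) \<otimes> x [^] i \<in> carrier R" if "i < Suc n" for i
  proof -
    have "Ks ! (Suc n - 1 - i) \<in> set Ks" using that Suc(3) by (intro nth_mem) auto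
    then show ?thesis using Suc(2) assms(1) by auto
  qed
  have "(\<Oplus>i\<in>{..<Suc n}. Ks ! (Suc n - 1 - i) \<otimes> x [^] i)
      = Ks ! (Suc n - 1 - n) \<otimes> x [^] n \<oplus> (\<Oplus>i\<in>{..<n}. Ks ! (Suc n - 1 - i) \<otimes> x [^] i)"
    unfolding lessThan_Suc using c c[of n] by (intro finsum_insert) auto
  then show ?case using IH Ks e by simp
qed

lemma (in field) field_basis_powers:
  assumes K: "subfield K R" and E: "subring E R" "K \<subseteq> E" and x: "x \<in> E"
    and ind: "independent K (exp_base x n)" and span: "Span K (exp_base x n) = E"
  shows "field_basis R K E n (\<lambda>i. x [^] i)"
proof (intro field_basis.intro field_basis_axioms.intro)
  have xc: "x \<in> carrier R" using x subringE(1)[OF E(1)] by auto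
  have len: "length (exp_base x n) = n" by (simp add: exp_base_def)
  note Kc = subfieldE(3)[OF K]
  show "x [^] i \<in> E" for i :: nat using x pow_in_submonoid[OF subring.axioms(2)[OF E(1)]] by simp
  show "\<exists>c\<in>{..<n} \<rightarrow> K. y = (\<Oplus>i\<in>{..<n}. c i \<otimes> x [^] i)" if "y \<in> E" for y
  proof -
    have y: "y \<in> E" by fact
    obtain Ks where Ks: "length Ks = n" "set Ks \<subseteq> K" "y = combine Ks (exp_base x n)"
    proof -
      have "y \<in> {combine Ks (exp_base x n) | Ks. length Ks = n \<and> set Ks \<subseteq> K}"
        using y Span_eq_combine_set_length_version[OF K exp_base_closed[OF xc], of n] len
        unfolding span by simp
      then show thesis using that by blast
    qed
    have "Ks ! (n - 1 - i) \<in> K" if "i < n" for i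
      using Ks(1,2) that nth_mem[of "n - 1 - i" Ks] by auto
    moreover have "y = (\<Oplus>i\<in>{..<n}. Ks ! (n - 1 - i) \<otimes> x [^] i)"
      using combine_exp_base[OF xc] Ks Kc by auto
    ultimately show ?thesis by (intro bexI[of _ "\<lambda>i. Ks ! (n - 1 - i)"]) auto
  qed
  show "c i = \<zero>" if c: "c \<in> {..<n} \<rightarrow> K" "(\<Oplus>i\<in>{..<n}. c i \<otimes> x [^] i) = \<zero>" "i < n" for c i
  proof -
    let ?Ks = "map (\<lambda>i. c (n - 1 - i)) [0..<n]"
    have cK: "\<And>i. i < n \<Longrightarrow> c i \<in> K" using c by auto
    have Ks: "set ?Ks \<subseteq> K" using cK by auto
    have "combine ?Ks (exp_base x n) = (\<Oplus>i\<in>{..<n}. ?Ks ! (n - 1 - i) \<otimes> x [^] i)"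
      using Ks Kc by (intro combine_exp_base[OF xc]) auto
    also have "\<dots> = (\<Oplus>i\<in>{..<n}. c i \<otimes> x [^] i)"
      using cK Kc xc by (intro finsum_cong') auto
    finally have "set (take n ?Ks) \<subseteq> {\<zero>}"
      using independent_imp_trivial_combine[OF K ind Ks] len c by simp
    moreover have "c i \<in> set ?Ks"
      using that by (auto simp: image_iff intro!: bexI[of _ "n - 1 - i"])
    ultimately show ?thesis by auto
  qed
qed (fact field_axioms K E)+

lemma (in field) algebraic_radical:
  assumes K: "subfield K R" and b: "b \<in> carrier R" "b [^] (p::nat) \<in> K" "p > 0"
  shows "(algebraic over K) b"
proof (rule algebraicI)
  note K' = subfieldE(1)[OF K]
  \<comment> \<open>The polynomial \<open>X^p - b^p\<close>, as the list of its coefficients from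
    the leading one downwards.\<close>
  let ?f = "\<one> # replicate (p - 1) \<zero> @ [\<ominus> (b [^] p)]"
  show "?f \<in> carrier (K [X])"
    using subringE(2,3,5)[OF K'] b subfieldE(6)[OF K]
    by (auto simp: univ_poly_def polynomial_def)
  show "eval ?f b = \<zero>"
    using b eval_replicate[of "[\<ominus> (b [^] p)]" b "p - 1"] by (simp add: r_neg)
qed simp

text \<open>
  The polynomial \<open>X\<^sup>p - b\<^sup>p\<close> is irreducible: the norm from \<open>K(b)\<close> forces \<open>p\<close> to divide the degree of \<open>b\<close>.
\<close>
lemma (in field) radical_basis:
  assumes K: "subfield K R" and p: "Factorial_Ring.prime p"
    and b: "b \<in> carrier R" "b \<notin> K" "b [^] p \<in> K"
    and roots: "\<And>y. y \<in> carrier R \<Longrightarrow> y [^] p = \<one> \<Longrightarrow> y \<in> K"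
  shows "subfield (simple_extension K b) R"
    and "independent K (exp_base b p)"
    and "Span K (exp_base b p) = simple_extension K b"
proof -
  let ?E = "simple_extension K b"
  note K' = subfieldE(1)[OF K]
  have alg: "(algebraic over K) b"
    using algebraic_radical[OF K b(1,3)] p prime_gt_0_nat by blast
  show E: "subfield ?E R" using simple_extension_is_subfield[OF K b(1)] alg by simp
  define d where "d = degree (Irr K b)"
  have ind: "independent K (exp_base b d)" and span: "Span K (exp_base b d) = ?E"
    using exp_base_independent[OF K b(1) alg] Span_exp_base[OF K b(1) alg] by (auto simp: d_def)
  have bE: "b \<in> ?E" using simple_extension_mem[OF K' b(1)] .
  have KE: "K \<subseteq> ?E" using simple_extension_incl[OF subfieldE(3)[OF K] b(1)] .
  interpret B: field_basis R K ?E d "\<lambda>i. b [^] i"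
    by (rule field_basis_powers[OF K subfieldE(1)[OF E] KE bE ind span])
  \<comment> \<open>Otherwise \<open>root_in_base\<close> with \<open>q = p\<close> would put
    \<open>b\<close> into \<open>K\<close>.\<close>
  have "p dvd d" using B.root_in_base[OF p _ bE b(3) roots] b(2) by blast
  moreover have "d \<noteq> 0"
  proof
    assume "d = 0"
    then have "?E = {\<zero>}" using span by (simp add: exp_base_def)
    then show False using KE subringE(3)[OF K'] by auto
  qed
  \<comment> \<open>More than \<open>p\<close> independent powers would include both
    \<open>1\<close> and \<open>b [^] p\<close>, which is a \<open>K\<close>-multiple of
    \<open>1\<close>.\<close>
  moreover have "\<not> d > p"
  proof
    assume "d > p"
    then obtain m where "d = Suc p + m" using less_iff_Suc_add by auto
    then have "independent K (exp_base b (Suc p))"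
      using ind exp_base_append[of b "Suc p" m] independent_split(1)[OF K] by metis
    moreover have "exp_base b (Suc p) = b [^] p # exp_base b p" by (simp add: exp_base_def)
    ultimately have "b [^] p \<notin> Span K (exp_base b p)" using independent_backwards(1) by auto
    moreover have "\<one> \<in> set (exp_base b p)"
      using p prime_gt_0_nat[of p] by (auto simp: exp_base_def image_iff intro!: bexI[of _ 0])
    then have "\<one> \<in> Span K (exp_base b p)"
      using Span_base_incl[OF K exp_base_closed[OF b(1)]] by blast
    then have "b [^] p \<otimes> \<one> \<in> Span K (exp_base b p)"
      using Span_smult_closed[OF K exp_base_closed[OF b(1)] b(3)] by blast
    ultimately show False using b(1) by simp
  qed
  ultimately have "d = p" using dvd_imp_le by fastforce
  then show "independent K (exp_base b p)" "Span K (exp_base b p) = ?E" using ind span by auto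
qed

text \<open>\<open>roots\<close> and \<open>sqrt_minus_one\<close> concern the whole field
  \<open>R\<close>, and nothing ties the locale to a fixed \<open>b\<close>: it is interpreted again
  for other radicals \<open>z\<close> in \<open>K(b)\<close>. \<open>p_nonzero\<close> makes the
  trace of \<open>1\<close> nonzero.\<close>

locale radical_step = field R for R (structure) +
  fixes K :: "'a set" and b :: 'a and p :: nat
  assumes K: "subfield K R"
    and prime: "Factorial_Ring.prime p" and p_nonzero: "add_pow R p \<one> \<noteq> \<zero>"
    and b: "b \<in> carrier R" "b \<notin> K" and b_pow: "b [^] p \<in> K"
    and roots: "Factorial_Ring.prime (q::nat) \<Longrightarrow> y \<in> carrier R \<Longrightarrow> y [^] q = \<one> \<Longrightarrow> y \<in> K"
    and sqrt_minus_one: "y \<in> carrier R \<Longrightarrow> y \<otimes> y = \<ominus> \<one> \<Longrightarrow> y \<in> K"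
begin

abbreviation E :: "'a set" where "E \<equiv> simple_extension K b"

lemma E_subfield: "subfield E R"
  using radical_basis[OF K prime b b_pow roots[OF prime]] by blast

lemma p_pos: "p > 0" using prime prime_gt_0_nat by blast

lemma p_gt_1: "p > 1" using prime prime_gt_1_nat by blast

lemma b_E: "b \<in> E" using simple_extension_mem[OF subfieldE(1)[OF K] b(1)] .

lemma K_subset_E: "K \<subseteq> E" using simple_extension_incl[OF subfieldE(3)[OF K] b(1)] .

text \<open>The powers of \<open>b\<close> give \<open>E\<close> the dimension \<open>p\<close>, so
  the \<open>p\<close> independent powers of \<open>z\<close> span it. This provides the second
  basis in which traces are computed.\<close>

lemma basis_of_radical:
  assumes z: "z \<in> E" "z \<notin> K" "z [^] p \<in> K"
  shows "field_basis R K E p (\<lambda>i. z [^] i)"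
proof -
  have zc: "z \<in> carrier R" using z(1) subfieldE(3)[OF E_subfield] by auto
  have "dimension p K E"
    using radical_basis(2,3)[OF K prime b b_pow roots[OF prime]]
      dimension_independent[of K "exp_base b p"] by (simp add: exp_base_def)
  moreover have ind: "independent K (exp_base z p)"
    using radical_basis(2)[OF K prime zc z(2,3) roots[OF prime]] .
  moreover have "set (exp_base z p) \<subseteq> E"
    using z(1) pow_in_submonoid[OF subring.axioms(2)[OF subfieldE(1)[OF E_subfield]]]
    by (auto simp: exp_base_def)
  ultimately have "Span K (exp_base z p) = E"
    using independent_length_eq_dimension[OF K, of p E "exp_base z p"]
    by (simp del: Span.simps add: exp_base_def[of z p, THEN arg_cong[of _ _ length]])
  then show ?thesis
    by (rule field_basis_powers[OF K subfieldE(1)[OF E_subfield] K_subset_E z(1) ind])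
qed

end

sublocale radical_step \<subseteq> field_basis R K "simple_extension K b" p "\<lambda>i. b [^] i"
  by (rule basis_of_radical[OF b_E b(2) b_pow])

context radical_step
begin

section \<open>Coordinates and traces in the basis of powers of \<open>b\<close>\<close>

lemma one_K: "\<one> \<in> K" using subringE(3)[OF K'] .

lemma zero_K: "\<zero> \<in> K" using subringE(2)[OF K'] .

lemma uminus_K: "x \<in> K \<Longrightarrow> \<ominus> x \<in> K" using subringE(5)[OF K'] .

lemma inv_K: "x \<in> K \<Longrightarrow> x \<noteq> \<zero> \<Longrightarrow> inv x \<in> K"
  using subfield_m_inv(1)[OF K] by blast

lemma b_nonzero: "b \<noteq> \<zero>" using b(2) zero_K by auto

lemma coord_pow:
  assumes "i < p" "n < p" shows "coord i (b [^] n) = (if i = n then \<one> else \<zero>)"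
  using coord_basis[OF assms(2,1)] .

text \<open>Such exponents wrap around exactly once, and the wrap costs a factor
  \<open>b [^] p\<close>.\<close>

lemma coord_pow_wrap:
  assumes "i < p" "p \<le> n" "n < 2 * p"
  shows "coord i (b [^] n) = (if n = p + i then b [^] p else \<zero>)"
proof -
  have "b [^] n = b [^] p \<otimes> b [^] (n - p)" using assms b by (simp add: nat_pow_mult)
  then have "coord i (b [^] n) = b [^] p \<otimes> coord i (b [^] (n - p))"
    using coord_smult[OF b_pow _ assms(1), of "b [^] (n - p)"] b_E by simp
  also have "coord i (b [^] (n - p)) = (if i = n - p then \<one> else \<zero>)"
    using assms by (intro coord_pow) auto
  finally show ?thesis using assms b by auto
qed

text \<open>Multiplication by \<open>b [^] n\<close> shifts the basis cyclically, up to factors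
  \<open>b [^] p\<close>, and a shift by \<open>n\<close> with \<open>0 < n < p\<close> fixes no
  index: the diagonal of the matrix is zero.\<close>

lemma trace_pow:
  assumes n: "0 < n" "n < p" shows "trace (b [^] n) = \<zero>"
  unfolding trace_def
proof (rule add.finprod_one_eqI)
  fix i assume "i \<in> {..<p}"
  then have i: "i < p" by simp
  have "b [^] n \<otimes> b [^] i = b [^] (n + i)" using b by (simp add: nat_pow_mult)
  then show "coord i (b [^] n \<otimes> b [^] i) = \<zero>"
    using coord_pow[of i "n + i"] coord_pow_wrap[of i "n + i"] n i by (cases "n + i < p") auto
qed

lemma trace_one: "trace \<one> = add_pow R p \<one>"
proof -
  have "trace \<one> = (\<Oplus>i\<in>{..<p}. \<one>)"
    unfolding trace_def using b coord_pow by (intro finsum_cong') auto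
  then show ?thesis by (simp add: add.finprod_const)
qed

text \<open>Among the basis vectors only \<open>1\<close> has nonzero trace, so the trace detects
  exactly the coordinate at 0.\<close>

lemma trace_eq_coord_zero:
  assumes z: "z \<in> E" shows "trace z = coord 0 z \<otimes> add_pow R p \<one>"
proof -
  have "trace z = trace (\<Oplus>i\<in>{..<p}. coord i z \<otimes> b [^] i)" by (simp only: coord_sum[OF z])
  also have "\<dots> = (\<Oplus>i\<in>{..<p}. trace (coord i z \<otimes> b [^] i))"
    using z b_E by (intro trace_finsum) auto
  also have "\<dots> = (\<Oplus>i\<in>{..<p}. coord i z \<otimes> trace (b [^] i))"
    using z b_E by (intro finsum_cong') (auto simp: trace_smult)
  also have "\<dots> = (\<Oplus>i\<in>{..<p}. if 0 = i then coord i z \<otimes> add_pow R p \<one> else \<zero>)"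
    using z trace_pow trace_one by (intro finsum_cong') auto
  also have "\<dots> = coord 0 z \<otimes> add_pow R p \<one>"
    using z p_pos by (intro finsum_singleton) auto
  finally show ?thesis .
qed

text \<open>In the basis of its own powers \<open>z\<close> has trace zero, by
  \<open>trace_pow\<close> with exponent 1. The trace does not depend on the basis, and
  \<open>p\<close> can be cancelled.\<close>

lemma coord_zero_of_radical:
  assumes z: "z \<in> E" "z \<notin> K" "z [^] p \<in> K" shows "coord 0 z = \<zero>"
proof -
  have zc: "z \<in> carrier R" using z by simp
  interpret Z: radical_step R K z p
    by (intro radical_step.intro radical_step_axioms.intro field_axioms)
      (fact K prime p_nonzero zc z roots sqrt_minus_one)+
  have "field_basis R K E p (\<lambda>i. z [^] i)" using basis_of_radical[OF z] .
  then have "Z.trace z = trace z"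
    using trace_basis_independent[OF _ field_basis_axioms z(1)] by blast
  then have "coord 0 z \<otimes> add_pow R p \<one> = \<zero>"
    using Z.trace_pow[of 1] p_gt_1 trace_eq_coord_zero[OF z(1)] zc by simp
  then show ?thesis using p_nonzero z p_pos by (simp add: integral_iff)
qed

text \<open>After multiplication the exponents run from \<open>p - j\<close> to
  \<open>2 * p - 1 - j\<close>, and only \<open>p\<close>, coming from \<open>j\<close>, is
  divisible by \<open>p\<close>. Thus every coordinate can be moved to position 0, where the trace
  sees it.\<close>

lemma coord_shift:
  assumes x: "x \<in> E" and j: "j < p"
  shows "coord 0 (x \<otimes> b [^] (p - j)) = coord j x \<otimes> b [^] p"
proof -
  have "x \<otimes> b [^] (p - j) = (\<Oplus>i\<in>{..<p}. coord i x \<otimes> b [^] i) \<otimes> b [^] (p - j)"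
    by (simp only: coord_sum[OF x])
  also have "\<dots> = (\<Oplus>i\<in>{..<p}. coord i x \<otimes> b [^] i \<otimes> b [^] (p - j))"
    using x b by (intro finsum_ldistr) auto
  also have "\<dots> = (\<Oplus>i\<in>{..<p}. coord i x \<otimes> b [^] (i + (p - j)))"
    using x b by (intro finsum_cong') (auto simp: m_assoc nat_pow_mult)
  finally have "coord 0 (x \<otimes> b [^] (p - j)) = coord 0 (\<Oplus>i\<in>{..<p}. coord i x \<otimes> b [^] (i + (p - j)))"
    by simp
  also have "\<dots> = (\<Oplus>i\<in>{..<p}. coord 0 (coord i x \<otimes> b [^] (i + (p - j))))"
    using x b_E p_pos by (intro coord_finsum) auto
  also have "\<dots> = (\<Oplus>i\<in>{..<p}. if j = i then coord i x \<otimes> b [^] p else \<zero>)"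
  proof (intro finsum_cong' refl)
    fix i assume "i \<in> {..<p}"
    then have i: "i < p" by simp
    have "coord 0 (coord i x \<otimes> b [^] (i + (p - j))) = coord i x \<otimes> coord 0 (b [^] (i + (p - j)))"
      using x b_E i p_pos by (intro coord_smult) auto
    moreover have "coord 0 (b [^] (i + (p - j))) = (if j = i then b [^] p else \<zero>)"
      using coord_pow[of 0 "i + (p - j)"] coord_pow_wrap[of 0 "i + (p - j)"] i j p_pos
      by (cases "i + (p - j) < p") auto
    ultimately show "coord 0 (coord i x \<otimes> b [^] (i + (p - j))) = (if j = i then coord i x \<otimes> b [^] p else \<zero>)"
      using x i by simp
  qed (use x b_pow in auto)
  also have "\<dots> = coord j x \<otimes> b [^] p" using j x b_pow by (intro finsum_singleton) auto
  finally show ?thesis by simp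
qed

text \<open>The group generated by \<open>b\<close> and the units of \<open>K\<close>; natural
  exponents suffice because \<open>b [^] p\<close> is in \<open>K\<close>.\<close>

definition radicals :: "'a set" where
  "radicals = {k \<otimes> b [^] j | k j. k \<in> K \<and> k \<noteq> \<zero> \<and> j \<in> (UNIV :: nat set)}"

lemma radicalsI: "k \<in> K \<Longrightarrow> k \<noteq> \<zero> \<Longrightarrow> k \<otimes> b [^] (j::nat) \<in> radicals"
  by (auto simp: radicals_def)

text \<open>The factor \<open>b [^] j\<close> is completed to \<open>b [^] (p * j)\<close>, which
  lies in \<open>K\<close> and has the inverse \<open>l\<close> there.\<close>

lemma radicals_cancel:
  assumes x: "x \<in> carrier R" and xb: "x \<otimes> b [^] (j::nat) \<in> radicals" shows "x \<in> radicals"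
proof -
  obtain k i where k: "k \<in> K" "k \<noteq> \<zero>" and e: "x \<otimes> b [^] j = k \<otimes> b [^] (i::nat)"
    using xb by (auto simp: radicals_def)
  define l where "l = inv (b [^] p) [^] j"
  have bp: "b [^] p \<noteq> \<zero>" "b [^] p \<in> carrier R" using b b_nonzero pow_nonzero by auto
  have l: "l \<in> K" "l \<noteq> \<zero>"
    using inv_K[OF b_pow bp(1)] inv_closed_nonzero[OF bp(2,1)] pow_nonzero by (auto simp: l_def)
  have "(b [^] p) [^] j \<otimes> l = (b [^] p \<otimes> inv (b [^] p)) [^] j"
    unfolding l_def using inv_closed_nonzero[OF bp(2,1)] bp by (intro nat_pow_distrib[symmetric]) auto
  then have one: "b [^] (p * j) \<otimes> l = \<one>"
    using inv_closed_nonzero[OF bp(2,1)] b by (simp add: nat_pow_pow)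
  have "j + (p - 1) * j = p * j" using p_pos by (cases p) auto
  then have "x \<otimes> b [^] (p * j) = x \<otimes> b [^] j \<otimes> b [^] ((p - 1) * j)"
    using x b by (simp add: m_assoc nat_pow_mult)
  also have "\<dots> = k \<otimes> b [^] (i + (p - 1) * j)"
    using k b unfolding e by (simp add: m_assoc nat_pow_mult)
  finally have "x \<otimes> (b [^] (p * j) \<otimes> l) = k \<otimes> b [^] (i + (p - 1) * j) \<otimes> l"
    using x b l by (simp add: m_assoc[symmetric])
  then have "x = (k \<otimes> l) \<otimes> b [^] (i + (p - 1) * j)"
    using x b l k one by (simp add: m_ac)
  moreover have "k \<otimes> l \<noteq> \<zero>" using k l by (simp add: integral_iff)
  ultimately show ?thesis using radicalsI[of "k \<otimes> l"] k l by simp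
qed

text \<open>If \<open>x\<close> is not in \<open>radicals\<close>, then no
  \<open>x \<otimes> b [^] (p - j)\<close> lies in \<open>K\<close>, while its \<open>p\<close>-th
  power does. So its coordinate at 0 vanishes, and by \<open>coord_shift\<close> so does coordinate
  \<open>j\<close> of \<open>x\<close>, for every \<open>j\<close>.\<close>

lemma pth_root_of_base:
  assumes x: "x \<in> E" "x \<noteq> \<zero>" "x [^] p \<in> K" shows "x \<in> radicals"
proof (rule ccontr)
  assume n: "x \<notin> radicals"
  have "coord j x = \<zero>" if j: "j < p" for j
  proof -
    let ?z = "x \<otimes> b [^] (p - j)"
    have z0: "?z \<noteq> \<zero>" using x b b_nonzero pow_nonzero by (simp add: integral_iff)
    have "?z \<notin> K"
    proof
      assume "?z \<in> K"
      then have "?z \<otimes> b [^] (0::nat) \<in> radicals" using z0 by (intro radicalsI)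
      moreover have "?z \<otimes> b [^] (0::nat) = ?z" using x b by simp
      ultimately show False using n radicals_cancel[of x "p - j"] x by simp
    qed
    moreover have "?z [^] p = x [^] p \<otimes> (b [^] p) [^] (p - j)"
      using x b nat_pow_commute_exponents[OF b(1)] by (simp add: nat_pow_distrib)
    then have "?z [^] p \<in> K" using x b_pow by simp
    ultimately have "coord 0 ?z = \<zero>" using x b_E by (intro coord_zero_of_radical) auto
    then have "coord j x \<otimes> b [^] p = \<zero>" using coord_shift[OF x(1) j] by simp
    then show ?thesis using x j b b_nonzero pow_nonzero by (simp add: integral_iff)
  qed
  then have "(\<Oplus>i\<in>{..<p}. coord i x \<otimes> b [^] i) = \<zero>"
    using b by (intro add.finprod_one_eqI) auto
  then show False using coord_sum x by simp
qed

lemma coord_b_mult: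
  assumes "i < p" "j < p"
  shows "coord j (b \<otimes> b [^] i) =
    (if Suc i < p then if j = Suc i then \<one> else \<zero> else if j = 0 then b [^] p else \<zero>)"
proof -
  have "b \<otimes> b [^] i = b [^] Suc i" using b by (simp add: m_comm)
  then show ?thesis
    using coord_pow[of j "Suc i"] coord_pow_wrap[of j "Suc i"] assms p_gt_1 by (cases "Suc i < p") auto
qed

text \<open>Only the cyclic permutation contributes to the determinant.\<close>
lemma norm_b: "norm b = b [^] p \<or> norm b = \<ominus> (b [^] p)"
proof -
  \<comment> \<open>The cycle \<open>i \<mapsto> i + 1\<close> modulo \<open>p\<close>, fixing
    everything from \<open>p\<close> on: multiplication by \<open>b\<close> sends
    \<open>b [^] i\<close> to a multiple of \<open>b [^] c i\<close>.\<close>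
  define c where "c = (\<lambda>i. if i < p then if Suc i < p then Suc i else 0 else i)"
  let ?M = "\<lambda>i j. coord j (b \<otimes> b [^] i)"
  let ?t = "\<lambda>s. perm_sign s \<otimes> (\<Otimes>i\<in>{..<p}. ?M i (s i))"
  have Mc: "\<And>i j. i < p \<Longrightarrow> j < p \<Longrightarrow> ?M i j \<in> carrier R" using b_E by auto
  have "inj_on c {..<p}" by (intro inj_onI) (auto simp: c_def split: if_splits)
  moreover have "c ` {..<p} \<subseteq> {..<p}" using p_pos by (auto simp: c_def)
  ultimately have "bij_betw c {..<p} {..<p}" using endo_inj_surj[of "{..<p}" c] by (simp add: bij_betw_def)
  then have c: "c permutes {..<p}" by (rule bij_imp_permutes) (simp add: c_def)
  have zero: "?t s = \<zero>" if s: "s \<in> {s. s permutes {..<p}} - {c}" for s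
  proof -
    have sp: "s permutes {..<p}" using s by simp
    obtain i where i: "s i \<noteq> c i" using s by (auto simp: fun_eq_iff)
    have ip: "i < p"
      using i permutes_not_in[OF sp, of i] permutes_not_in[OF c, of i] by (cases "i < p") auto
    have si: "\<And>i. i < p \<Longrightarrow> s i < p" using permutes_in_image[OF sp] by auto
    have "?M i (s i) = \<zero>"
      using i ip si[OF ip] coord_b_mult[of i "s i"] by (auto simp: c_def)
    then have "(\<Otimes>i\<in>insert i ({..<p} - {i}). ?M i (s i)) = \<zero>"
      using Mc si ip by (subst finprod_insert) (auto intro!: finprod_closed)
    then show ?thesis using ip by (simp add: insert_absorb)
  qed
  have "norm b = (\<Oplus>s\<in>{c}. ?t s)"
    unfolding norm_def det_def
  proof (rule add.finprod_mono_neutral_cong_right)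
    show "?t \<in> {s. s permutes {..<p}} \<rightarrow> carrier R" 
      by (intro funcsetI m_closed perm_sign_closed perm_term_closed) (use Mc in auto)
  qed (use c zero in \<open>auto intro!: finite_permutations\<close>)
  also have "\<dots> = ?t c"
  proof -
    have "?t c \<in> carrier R"
      by (intro m_closed perm_sign_closed perm_term_closed[OF c]) (use Mc in auto)
    then show ?thesis by simp
  qed
  also have "(\<Otimes>i\<in>{..<p}. ?M i (c i)) = (\<Otimes>i\<in>{..<p}. if p - 1 = i then b [^] p else \<one>)"
  proof (intro finprod_cong' refl)
    fix i assume "i \<in> {..<p}"
    then show "?M i (c i) = (if p - 1 = i then b [^] p else \<one>)"
      using coord_b_mult[of i "c i"] p_pos by (auto simp: c_def)
  qed (use b in auto)
  also have "\<dots> = b [^] p" using b p_pos by (intro finprod_singleton) auto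
  finally have "norm b = perm_sign c \<otimes> b [^] p" .
  then show ?thesis using b by (auto simp: perm_sign_def l_minus)
qed

text \<open>If \<open>y [^] p\<close> is -1 and \<open>p\<close> is odd, then minus \<open>y\<close>
  is a \<open>p\<close>-th root of unity; for \<open>p = 2\<close> the element \<open>y\<close> is a
  square root of -1, which is where \<open>sqrt_minus_one\<close> enters.\<close>

lemma pth_root_of_minus_one:
  assumes y: "y \<in> carrier R" "y [^] p = \<one> \<or> y [^] p = \<ominus> \<one>" shows "y \<in> K"
proof (cases "y [^] p = \<one>")
  case True
  then show ?thesis using roots prime y by blast
next
  case False
  then have m: "y [^] p = \<ominus> \<one>" using y by simp
  show ?thesis
  proof (cases "p = 2")
    case True
    then have "y \<otimes> y = \<ominus> \<one>" using m y by (simp add: numeral_2_eq_2)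
    then show ?thesis using sqrt_minus_one y by blast
  next
    case False
    then have "odd p" using prime prime_odd_nat[of p] p_gt_1 by linarith
    then obtain k where k: "p = 2 * k + 1" by (elim oddE)
    have "(\<ominus> \<one>) [^] (2::nat) = \<one>" by (simp add: numeral_2_eq_2 l_minus)
    then have "(\<ominus> \<one>) [^] p = \<ominus> \<one>"
      unfolding k by (simp add: nat_pow_mult[symmetric] nat_pow_pow[symmetric])
    then have "((\<ominus> \<one>) \<otimes> y) [^] p = (\<ominus> \<one>) \<otimes> (\<ominus> \<one>)"
      using y m by (simp only: nat_pow_distrib a_inv_closed one_closed)
    then have "((\<ominus> \<one>) \<otimes> y) [^] p = \<one>" by (simp add: l_minus)
    moreover have "(\<ominus> \<one>) \<otimes> y \<in> carrier R" using y by simp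
    ultimately have "(\<ominus> \<one>) \<otimes> y \<in> K" using roots prime by blast
    then have "\<ominus> ((\<ominus> \<one>) \<otimes> y) \<in> K" using uminus_K by blast
    then show ?thesis using y by (simp add: l_minus)
  qed
qed

lemma sign_pow: "s = \<one> \<or> s = \<ominus> \<one> \<Longrightarrow> s [^] (n::nat) = \<one> \<or> s [^] n = \<ominus> \<one>"
  by (induction n) (auto simp: l_minus)

text \<open>Put \<open>w = k \<otimes> b [^] j\<close>. Since the norm of \<open>b\<close> is
  \<open>b [^] p\<close> up to sign, taking norms gives \<open>norm x [^] p = w [^] p\<close> up to
  sign. So the quotient of \<open>norm x\<close> by \<open>w\<close> is a \<open>p\<close>-th root
  of 1 or -1 and lies in \<open>K\<close>; hence so do \<open>w\<close> and \<open>b [^] j\<close>,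
  and for \<open>j\<close> prime to \<open>p\<close> this forces \<open>b\<close> into
  \<open>K\<close>.\<close>

lemma no_pth_root:
  assumes x: "x \<in> E" "x [^] p = k \<otimes> b [^] (j::nat)" and k: "k \<in> K" "k \<noteq> \<zero>"
  shows "p dvd j"
proof (rule ccontr)
  assume nd: "\<not> p dvd j"
  let ?w = "k \<otimes> b [^] j"
  have bj: "b [^] j \<in> carrier R" "b [^] j \<noteq> \<zero>" using b b_nonzero pow_nonzero by auto
  have w: "?w \<in> carrier R" "?w \<noteq> \<zero>" using k bj by (auto simp: integral_iff)
  have N: "norm x \<in> K" "norm x \<in> carrier R" using x by auto
  obtain s where s: "s = \<one> \<or> s = \<ominus> \<one>" "norm b = s \<otimes> b [^] p"
    using norm_b b by (metis l_minus l_one one_closed nat_pow_closed)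
  have sc: "s \<in> carrier R" using s by auto
  have "norm x [^] p = norm ?w" using norm_pow[OF x(1)] x(2) by metis
  also have "\<dots> = norm k \<otimes> norm b [^] j" using k b_E norm_mult norm_pow by simp
  also have "\<dots> = k [^] p \<otimes> (s [^] j \<otimes> (b [^] p) [^] j)"
    using norm_scalar[OF k(1)] s(2) sc b by (simp add: nat_pow_distrib)
  also have "\<dots> = s [^] j \<otimes> (k [^] p \<otimes> (b [^] j) [^] p)"
    using sc k b nat_pow_commute_exponents[OF b(1), of p j] by (simp add: m_lcomm)
  also have "k [^] p \<otimes> (b [^] j) [^] p = ?w [^] p"
    using k bj by (intro nat_pow_distrib[symmetric]) auto
  finally have e: "norm x [^] p = s [^] j \<otimes> ?w [^] p" .
  note iw = inv_closed_nonzero[OF w]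
  let ?z = "norm x \<otimes> inv ?w"
  have zc: "?z \<in> carrier R" using iw N by simp
  have "?z [^] p = norm x [^] p \<otimes> (inv ?w) [^] p" using N iw by (intro nat_pow_distrib) auto
  also have "\<dots> = s [^] j \<otimes> (?w [^] p \<otimes> (inv ?w) [^] p)"
    unfolding e using sc w iw by (intro m_assoc) auto
  also have "?w [^] p \<otimes> (inv ?w) [^] p = (?w \<otimes> inv ?w) [^] p"
    using w iw by (intro nat_pow_distrib[symmetric]) auto
  also have "\<dots> = \<one>" by (simp only: iw(2) nat_pow_one)
  finally have "?z [^] p = s [^] j" using sc by simp
  then have zK: "?z \<in> K" using pth_root_of_minus_one[OF zc] sign_pow[OF s(1)] by metis
  have zw: "?z \<otimes> ?w = norm x" using N iw w by (simp only: m_assoc r_one)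
  have x0: "norm x \<noteq> \<zero>"
  proof
    assume "norm x = \<zero>"
    then have "s [^] j \<otimes> ?w [^] p = \<zero>" using e p_pos by (simp add: nat_pow_zero)
    then have "s [^] j = \<zero>" using w pow_nonzero sc by (auto simp: integral_iff)
    then show False
      using sign_pow[OF s(1), of j] by (auto dest: arg_cong[where f = "\<lambda>t. \<one> \<oplus> t"] simp: r_neg)
  qed
  then have z0: "?z \<noteq> \<zero>" using zw w by auto
  have "?w \<in> K"
    using subfield_m_inv_simprule[OF K, of ?z ?w] zK z0 w zw N by simp
  then have "b [^] j \<in> K"
    using subfield_m_inv_simprule[OF K, of k "b [^] j"] k bj by simp
  moreover have "coprime j p" using nd prime by (metis coprime_commute prime_imp_coprime)
  ultimately show False
    using in_subfield_of_coprime_powers[OF K b(1) b_nonzero _ b_pow, of j] b(2) by blast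
qed

text \<open>For \<open>q = p\<close>, \<open>no_pth_root\<close> makes \<open>j\<close> a multiple
  of \<open>p\<close>, so \<open>x [^] p\<close> is in \<open>K\<close>. For
  \<open>q \<noteq> p\<close>, a suitable power of \<open>b\<close> moves the \<open>q\<close>-th
  power into \<open>K\<close>, and \<open>root_in_base\<close> applies because \<open>q\<close> does
  not divide the degree \<open>p\<close>.\<close>

lemma prime_root_of_radical:
  assumes q: "Factorial_Ring.prime (q::nat)" and x: "x \<in> E" "x \<noteq> \<zero>" "x [^] q \<in> radicals"
  shows "x \<in> radicals"
proof -
  obtain k j where k: "k \<in> K" "k \<noteq> \<zero>" and e: "x [^] q = k \<otimes> b [^] (j::nat)"
    using x(3) by (auto simp: radicals_def)
  show ?thesis
  proof (cases "q = p")
    case True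
    then have "p dvd j" using no_pth_root[OF x(1) _ k] e by simp
    then obtain i where "j = p * i" by (elim dvdE)
    then have "x [^] p \<in> K" using e True k b b_pow by (simp add: nat_pow_pow[symmetric])
    then show ?thesis using pth_root_of_base x by blast
  next
    case False
    then have cop: "coprime q p" using primes_coprime q prime by blast
    then obtain u v where uv: "q * u = p * v + 1"
      using coprime_bezout_strong[of q p] bezout_nat[of q p] p_gt_1 q by (metis coprime_imp_gcd_eq_1 not_prime_0)
    \<comment> \<open>Modulo \<open>p\<close>, \<open>u\<close> inverts \<open>q\<close> and
      \<open>p - 1\<close> is -1, so \<open>q\<close> times this exponent plus \<open>j\<close> is
      divisible by \<open>p\<close>.\<close>
    let ?y = "x \<otimes> b [^] (u * j * (p - 1))"
    have ex: "q * (u * j * (p - 1)) + j = p * (v * j * (p - 1) + j)"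
    proof -
      have "q * (u * j * (p - 1)) = (p * v + 1) * j * (p - 1)" by (simp only: uv[symmetric] mult.assoc)
      then show ?thesis using p_pos by (cases p) (auto simp: algebra_simps)
    qed
    have "?y [^] q = x [^] q \<otimes> (b [^] (u * j * (p - 1))) [^] q"
      using x b by (intro nat_pow_distrib) auto
    also have "\<dots> = k \<otimes> b [^] (j + q * (u * j * (p - 1)))"
      unfolding e using k b by (simp add: m_assoc nat_pow_pow nat_pow_mult mult.commute)
    also have "\<dots> = k \<otimes> (b [^] p) [^] (v * j * (p - 1) + j)"
      using b ex by (simp only: nat_pow_pow add.commute)
    finally have "?y [^] q \<in> K" using k b_pow by simp
    moreover have "\<not> q dvd p" using False q prime primes_dvd_imp_eq by blast
    moreover have "?y \<in> E" using x(1) b_E by simp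
    ultimately have yK: "?y \<in> K"
      using root_in_base[OF q _ _ _ roots[OF q]] by blast
    have y0: "?y \<noteq> \<zero>" using x b b_nonzero pow_nonzero by (simp add: integral_iff)
    have "?y \<otimes> b [^] (0::nat) \<in> radicals" using yK y0 by (rule radicalsI)
    then have "?y \<in> radicals" using x b by simp
    then show ?thesis using radicals_cancel x by simp
  qed
qed

text \<open>One prime \<open>q\<close> is split off at a time: \<open>x [^] q\<close> has the
  smaller exponent \<open>m\<close>, and \<open>prime_root_of_radical\<close> leads back to
  \<open>x\<close>.\<close>

theorem radicals_of_torsion:
  assumes "n > 0" "x \<in> E" "x \<noteq> \<zero>" "x [^] (n::nat) \<in> K"
  shows "x \<in> radicals"
  using assms
proof (induction n arbitrary: x rule: less_induct)
  case (less n)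
  show ?case
  proof (cases "n = 1")
    case True
    then have "x \<otimes> b [^] (0::nat) \<in> radicals" using less.prems by (intro radicalsI) auto
    then show ?thesis using less.prems by simp
  next
    case False
    then obtain q where q: "Factorial_Ring.prime q" "q dvd n" using prime_factor_nat by blast
    then obtain m where m: "n = q * m" by (elim dvdE)
    have "m < n" "m > 0" using m less.prems(1) prime_gt_1_nat[OF q(1)] by auto
    moreover have "(x [^] q) [^] m \<in> K" using less.prems m by (simp add: nat_pow_pow)
    ultimately have "x [^] q \<in> radicals"
      using less.IH less.prems(2,3) pow_nonzero by simp
    then show ?thesis using prime_root_of_radical[OF q(1)] less.prems by blast
  qed
qed

end

section \<open>Kneser's theorem on the independence of radicals\<close>

text \<open>Primes are removed from the exponent until the power leaves \<open>K\<close>. The clause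
  \<open>k * p dvd n\<close> keeps \<open>p\<close> among the primes dividing \<open>n\<close>,
  which controls the characteristic, and \<open>k\<close> below \<open>n\<close>, which drives the
  induction in \<open>radicals_independent\<close>.\<close>

lemma (in ring) prime_radical_power:
  assumes "n > 0" "z \<in> carrier R" "z \<notin> K" "z [^] (n::nat) \<in> K"
  shows "\<exists>p k. Factorial_Ring.prime (p::nat) \<and> k * p dvd n \<and> z [^] (k::nat) \<notin> K \<and> (z [^] k) [^] p \<in> K"
  using assms
proof (induction n rule: less_induct)
  case (less n)
  then have "n \<noteq> 1" by auto
  then obtain q where q: "Factorial_Ring.prime q" "q dvd n" using prime_factor_nat by blast
  then obtain m where m: "n = q * m" by (elim dvdE)
  show ?case
  proof (cases "z [^] m \<in> K")
    case True
    have "m < n" "m > 0" using m less.prems(1) prime_gt_1_nat[OF q(1)] by auto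
    then obtain p k where "Factorial_Ring.prime (p::nat)" "k * p dvd m" "z [^] (k::nat) \<notin> K" "(z [^] k) [^] p \<in> K"
      using less.IH[OF _ _ less.prems(2,3) True] by blast
    moreover have "m dvd n" using m by simp
    ultimately show ?thesis using dvd_trans by blast
  next
    case False
    have "(z [^] m) [^] q \<in> K" using less.prems m by (simp add: nat_pow_pow mult.commute)
    moreover have "m * q dvd n" using m by (simp add: mult.commute)
    ultimately show ?thesis using False q by blast
  qed
qed

context radical_step
begin

lemma radicals_reduced:
  assumes "x \<in> radicals" obtains k j where "k \<in> K" "k \<noteq> \<zero>" "j < p" "x = k \<otimes> b [^] (j::nat)"
proof -
  obtain k j where k: "k \<in> K" "k \<noteq> \<zero>" "x = k \<otimes> b [^] (j::nat)"
    using assms by (auto simp: radicals_def)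
  let ?l = "k \<otimes> (b [^] p) [^] (j div p)"
  have "j = p * (j div p) + j mod p" by simp
  then have "b [^] j = (b [^] p) [^] (j div p) \<otimes> b [^] (j mod p)"
    using b by (metis nat_pow_mult nat_pow_pow)
  then have "x = ?l \<otimes> b [^] (j mod p)" using k b by (simp add: m_assoc)
  moreover have "?l \<in> K" using k b_pow by simp
  moreover have "?l \<noteq> \<zero>" using k b b_nonzero pow_nonzero by (simp add: integral_iff)
  ultimately show ?thesis using that[of ?l "j mod p"] p_pos by simp
qed

text \<open>Distinct exponents below \<open>p\<close> are distinct basis vectors; the coefficients
  only have to be moved from \<open>F\<close> to the exponents, with zero at those that do not
  occur.\<close>

lemma radicals_combination:
  assumes F: "finite F" and l: "\<And>x. x \<in> F \<Longrightarrow> l x \<in> K" and j: "inj_on j F" "\<And>x. x \<in> F \<Longrightarrow> j x < p"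
    and sum: "(\<Oplus>x\<in>F. l x \<otimes> b [^] (j x :: nat)) = \<zero>" and x: "x \<in> F"
  shows "l x = \<zero>"
proof -
  define g where "g = (\<lambda>i. if i \<in> j ` F then l (the_inv_into F j i) else \<zero>)"
  have gj: "\<And>x. x \<in> F \<Longrightarrow> g (j x) = l x" using the_inv_into_f_f[OF j(1)] by (simp add: g_def)
  have gK: "g i \<in> K" for i
    using l the_inv_into_into[OF j(1)] zero_K by (auto simp: g_def)
  have "(\<Oplus>i\<in>{..<p}. g i \<otimes> b [^] i) = (\<Oplus>i\<in>j ` F. g i \<otimes> b [^] i)"
    using j gK b by (intro add.finprod_mono_neutral_cong_right) (auto simp: g_def)
  also have "\<dots> = (\<Oplus>x\<in>F. g (j x) \<otimes> b [^] j x)"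
    using gK b by (intro finsum_reindex[OF _ j(1)]) auto
  also have "\<dots> = (\<Oplus>x\<in>F. l x \<otimes> b [^] j x)"
    using l b by (intro finsum_cong') (auto simp: gj)
  finally have "g (j x) = \<zero>"
    using sum gK j x by (intro independent[of g]) auto
  then show ?thesis using gj x by simp
qed

end

text \<open>
  Induction on the sum of the exponents \<open>e x\<close>: the field \<open>K\<close> is replaced by \<open>K(b)\<close> for a power \<open>b\<close>
  of some \<open>x \<in> A\<close> that is a radical of prime degree, and \<open>A\<close> by representatives of its classes
  modulo \<open>K(b)\<close>.
\<close>
theorem (in field) radicals_independent:
  assumes "subfield K R"
    and roots: "\<And>q y. Factorial_Ring.prime (q::nat) \<Longrightarrow> y \<in> carrier R \<Longrightarrow> y [^] q = \<one> \<Longrightarrow> y \<in> K"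
    and sqrt: "\<And>y. y \<in> carrier R \<Longrightarrow> y \<otimes> y = \<ominus> \<one> \<Longrightarrow> y \<in> K"
    and "finite A" "A \<subseteq> carrier R - {\<zero>}"
    and "\<And>x. x \<in> A \<Longrightarrow> e x > 0 \<and> x [^] (e x :: nat) \<in> K"
    and "\<And>x q. x \<in> A \<Longrightarrow> Factorial_Ring.prime q \<Longrightarrow> q dvd e x \<Longrightarrow> add_pow R q \<one> \<noteq> \<zero>"
    and "\<And>x y k. x \<in> A \<Longrightarrow> y \<in> A \<Longrightarrow> k \<in> K \<Longrightarrow> x = k \<otimes> y \<Longrightarrow> x = y"
    and "\<And>x. x \<in> A \<Longrightarrow> c x \<in> K" "(\<Oplus>x\<in>A. c x \<otimes> x) = \<zero>" "x \<in> A"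
  shows "c x = \<zero>"
  using assms
proof (induction "sum e A" arbitrary: K A e c x rule: less_induct)
  case less
  note K = less.prems(1) and roots = less.prems(2) and sqrt = less.prems(3) and fin = less.prems(4)
    and Ac = less.prems(5) and e = less.prems(6) and char = less.prems(7) and ineq = less.prems(8)
    and cK = less.prems(9) and sum = less.prems(10)
  have Ac': "\<And>x. x \<in> A \<Longrightarrow> x \<in> carrier R \<and> x \<noteq> \<zero>" using Ac by auto
  have KR: "\<And>k. k \<in> K \<Longrightarrow> k \<in> carrier R" using subfieldE(3)[OF K] by auto
  show ?case
  proof (cases "A \<subseteq> K")
    case True
    \<comment> \<open>Two elements of \<open>A\<close> inside \<open>K\<close> are proportional over
      \<open>K\<close>, hence equal.\<close>
    have single: "A = {x}"
    proof -
      have "y = x" if y: "y \<in> A" for y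
      proof (rule ineq[OF y less.prems(11)])
        show "y \<otimes> inv x \<in> K"
          using True y less.prems(11) Ac' subfield_m_inv(1)[OF K, of x]
          by (intro subringE(6)[OF subfieldE(1)[OF K]]) auto
        show "y = y \<otimes> inv x \<otimes> x"
          using Ac'[OF y] Ac'[OF less.prems(11)] inv_closed_nonzero[of x] by (simp add: m_assoc)
      qed
      then show ?thesis using less.prems(11) by blast
    qed
    have xc: "x \<in> carrier R" "x \<noteq> \<zero>" "c x \<in> carrier R"
      using Ac'[OF less.prems(11)] KR[OF cK[OF less.prems(11)]] by auto
    have "c x \<otimes> x = \<zero>" using sum xc unfolding single by simp
    then show ?thesis using xc by (simp add: integral_iff)
  next
    case False
    then obtain x0 where x0: "x0 \<in> A" "x0 \<notin> K" by auto
    obtain p k where p: "Factorial_Ring.prime (p::nat)" and kp: "k * p dvd e x0"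
      and b: "x0 [^] (k::nat) \<notin> K" "(x0 [^] k) [^] p \<in> K"
      using prime_radical_power[of "e x0" x0 K] e[OF x0(1)] x0(2) Ac'[OF x0(1)] by metis
    interpret S: radical_step R K "x0 [^] k" p
    proof (intro radical_step.intro radical_step_axioms.intro field_axioms)
      show "add_pow R p \<one> \<noteq> \<zero>" using char[OF x0(1) p] kp dvd_mult_right by blast
      show "x0 [^] k \<in> carrier R" using Ac' x0 by simp
    qed (fact K p b roots sqrt)+
    let ?E = "S.E"
    \<comment> \<open>Proportionality over \<open>K(b)\<close>, where \<open>b\<close> is
      \<open>x0 [^] k\<close>; below, \<open>r\<close> chooses one representative in each
      class.\<close>
    define rel where "rel = (\<lambda>x y. \<exists>t\<in>?E. t \<noteq> \<zero> \<and> x = t \<otimes> y)"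
    define r where "r = (\<lambda>x. SOME y. y \<in> A \<and> rel x y)"
    have rel_refl: "rel x x" if "x \<in> A" for x
      using that Ac' S.one_K unfolding rel_def by (intro bexI[of _ \<one>]) auto
    have rel_sym: "rel y x" if "rel x y" "x \<in> A" "y \<in> A" for x y
    proof -
      obtain t where t: "t \<in> ?E" "t \<noteq> \<zero>" "x = t \<otimes> y" using \<open>rel x y\<close> by (auto simp: rel_def)
      have i: "inv t \<in> ?E" "inv t \<noteq> \<zero>" "inv t \<otimes> t = \<one>"
        using subfield_m_inv[OF S.E_subfield, of t] t by auto
      then have "y = inv t \<otimes> x" using t Ac'[OF that(3)] by (simp add: m_assoc[symmetric])
      then show ?thesis using i by (auto simp: rel_def)
    qed
    have rel_trans: "rel x z" if "rel x y" "rel y z" "x \<in> A" "y \<in> A" "z \<in> A" for x y z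
    proof -
      obtain s t where st: "s \<in> ?E" "s \<noteq> \<zero>" "x = s \<otimes> y" "t \<in> ?E" "t \<noteq> \<zero>" "y = t \<otimes> z"
        using \<open>rel x y\<close> \<open>rel y z\<close> by (auto simp: rel_def)
      then have "x = (s \<otimes> t) \<otimes> z" using Ac'[OF that(5)] by (simp add: m_assoc)
      moreover have "s \<otimes> t \<noteq> \<zero>" using st by (simp add: integral_iff)
      ultimately show ?thesis using st S.E_mult unfolding rel_def by blast
    qed
    have r: "r x \<in> A" "rel x (r x)" if "x \<in> A" for x
    proof -
      have "\<exists>y. y \<in> A \<and> rel x y" using that rel_refl by blast
      then have "r x \<in> A \<and> rel x (r x)" unfolding r_def by (rule someI_ex)
      then show "r x \<in> A" "rel x (r x)" by auto
    qed
    have r_eq: "r x = r y" if "rel x y" "x \<in> A" "y \<in> A" for x y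
    proof -
      have "(\<lambda>z. z \<in> A \<and> rel x z) = (\<lambda>z. z \<in> A \<and> rel y z)"
        using rel_sym rel_trans that by (intro ext) blast
      then show ?thesis by (simp add: r_def)
    qed
    \<comment> \<open>The quotient \<open>t\<close> of \<open>x\<close> by its representative is in
      \<open>K(b)\<close> and has a power in \<open>K\<close>, so \<open>radicals_of_torsion\<close>
      gives it the form \<open>l b^j\<close>.\<close>
    have "\<exists>l j. l \<in> K \<and> l \<noteq> \<zero> \<and> j < p \<and> x = (l \<otimes> (x0 [^] k) [^] (j::nat)) \<otimes> r x"
      if x: "x \<in> A" for x
    proof -
      obtain t where t: "t \<in> ?E" "t \<noteq> \<zero>" "x = t \<otimes> r x" using r(2)[OF x] by (auto simp: rel_def)
      have xr: "x \<in> carrier R" "r x \<in> carrier R" "x \<noteq> \<zero>" "r x \<noteq> \<zero>" using Ac' x r(1)[OF x] by auto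
      let ?n = "e x * e (r x)"
      have "t [^] ?n \<otimes> (r x) [^] ?n = x [^] ?n"
        using t xr nat_pow_distrib[of t "r x" ?n] by simp
      moreover have "x [^] ?n \<in> K" "(r x) [^] ?n \<in> K"
      proof -
        have "(x [^] e x) [^] e (r x) \<in> K" "((r x) [^] e (r x)) [^] e x \<in> K"
          using e[OF x] e[OF r(1)[OF x]] by simp_all
        then show "x [^] ?n \<in> K" "(r x) [^] ?n \<in> K"
          using xr by (simp_all add: nat_pow_pow mult.commute)
      qed
      ultimately have "t [^] ?n \<in> K"
        using subfield_m_inv_simprule[OF K, of "(r x) [^] ?n" "t [^] ?n"] t xr pow_nonzero
        by (simp add: m_comm)
      then have "t \<in> S.radicals"
        using S.radicals_of_torsion[of ?n t] t e[OF x] e[OF r(1)[OF x]] by simp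
      then obtain l j where "l \<in> K" "l \<noteq> \<zero>" "j < p" "t = l \<otimes> (x0 [^] k) [^] (j::nat)"
        by (rule S.radicals_reduced)
      then show ?thesis using t(3) by metis
    qed
    then obtain l j where l: "\<And>x. x \<in> A \<Longrightarrow> l x \<in> K \<and> l x \<noteq> \<zero>"
      and j: "\<And>x. x \<in> A \<Longrightarrow> j x < p"
      and lj: "\<And>x. x \<in> A \<Longrightarrow> x = (l x \<otimes> (x0 [^] k) [^] (j x :: nat)) \<otimes> r x"
      by metis
    let ?Y = "r ` A"
    let ?F = "\<lambda>y. {x \<in> A. r x = y}"
    \<comment> \<open>Collecting each class at its representative \<open>y\<close> turns the given
      relation into one over \<open>K(b)\<close> between representatives only.\<close>
    define C where "C = (\<lambda>y. \<Oplus>x\<in>?F y. (c x \<otimes> l x) \<otimes> (x0 [^] k) [^] j x)"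
    have clK: "\<And>x. x \<in> A \<Longrightarrow> c x \<otimes> l x \<in> K" using cK l by simp
    have CE: "C y \<in> ?E" for y
      unfolding C_def using clK S.b_E by (intro finsum_in_subring[OF S.E]) auto
    have YA: "?Y \<subseteq> A" using r by auto
    have "(\<Oplus>y\<in>?Y. C y \<otimes> y) = (\<Oplus>y\<in>?Y. \<Oplus>x\<in>?F y. c x \<otimes> x)"
    proof (intro finsum_cong' refl)
      fix y assume y: "y \<in> ?Y"
      have yc: "y \<in> carrier R" using YA Ac' y by blast
      have "C y \<otimes> y = (\<Oplus>x\<in>?F y. (c x \<otimes> l x) \<otimes> (x0 [^] k) [^] j x \<otimes> y)"
        unfolding C_def using fin yc clK S.b by (intro finsum_ldistr) auto
      also have "\<dots> = (\<Oplus>x\<in>?F y. c x \<otimes> x)"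
      proof (intro finsum_cong' refl)
        fix x assume x: "x \<in> ?F y"
        then have xA: "x \<in> A" and rx: "r x = y" by auto
        have "c x \<otimes> x = c x \<otimes> ((l x \<otimes> (x0 [^] k) [^] j x) \<otimes> y)" using lj[OF xA] rx by simp
        then show "(c x \<otimes> l x) \<otimes> (x0 [^] k) [^] j x \<otimes> y = c x \<otimes> x"
          using cK[OF xA] l[OF xA] yc S.b by (simp add: m_assoc)
      qed (use cK Ac' in auto)
      finally show "C y \<otimes> y = (\<Oplus>x\<in>?F y. c x \<otimes> x)" .
    qed (use cK Ac' in \<open>auto intro!: finsum_closed\<close>)
    also have "\<dots> = (\<Oplus>x\<in>(\<Union>y\<in>?Y. ?F y). c x \<otimes> x)"
      using fin cK Ac' by (intro add.finprod_UN_disjoint[symmetric]) (auto simp: pairwise_def disjnt_def)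
    also have "(\<Union>y\<in>?Y. ?F y) = A" by auto
    finally have sumC: "(\<Oplus>y\<in>?Y. C y \<otimes> y) = \<zero>" using sum by simp
    \<comment> \<open>Over \<open>K(b)\<close> the exponent of \<open>x0\<close> may drop to
      \<open>k\<close>. Comparison over all of \<open>A\<close> makes the measure decrease even if
      \<open>x0\<close> is not a representative.\<close>
    define e' where "e' = e(x0 := k)"
    have k0: "k > 0" using b(1) S.one_K by (cases k) auto
    have kd: "k dvd e x0" using kp dvd_mult_left by blast
    have ke: "k < e x0"
    proof -
      have "k * p \<le> e x0" using kp e[OF x0(1)] by (intro dvd_imp_le) auto
      moreover have "k < k * p" using k0 S.p_gt_1 by simp
      ultimately show ?thesis by linarith
    qed
    have "sum e' ?Y \<le> sum e' A" using YA fin by (intro sum_mono2) auto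
    also have "sum e' A < sum e A"
      using x0 ke fin by (intro sum_strict_mono_ex1) (auto simp: e'_def)
    finally have smaller: "sum e' ?Y < sum e A" .
    have C0: "C y = \<zero>" if y: "y \<in> ?Y" for y
    proof (rule less.hyps[OF smaller S.E_subfield, of C])
      show "q \<in> ?E" if "Factorial_Ring.prime (n::nat)" "q \<in> carrier R" "q [^] n = \<one>" for n q
        using S.K_subset_E roots that by blast
      show "q \<in> ?E" if "q \<in> carrier R" "q \<otimes> q = \<ominus> \<one>" for q
        using S.K_subset_E sqrt that by blast
      show "finite ?Y" using fin by simp
      show "?Y \<subseteq> carrier R - {\<zero>}" using YA Ac by blast
      show "e' x > 0 \<and> x [^] e' x \<in> ?E" if "x \<in> ?Y" for x
        using that YA e S.K_subset_E k0 S.b_E by (cases "x = x0") (auto simp: e'_def)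
      show "add_pow R q \<one> \<noteq> \<zero>" if "x \<in> ?Y" "Factorial_Ring.prime q" "q dvd e' x" for x q
      proof -
        have "x \<in> A" "q dvd e x"
          using that YA dvd_trans[OF _ kd, of q] by (auto simp: e'_def split: if_splits)
        then show ?thesis using char that(2) by blast
      qed
      show "x = y" if xy: "x \<in> ?Y" "y \<in> ?Y" "t \<in> ?E" "x = t \<otimes> y" for x y t
      proof -
        obtain x' y' where x': "x' \<in> A" "x = r x'" and y': "y' \<in> A" "y = r y'" using xy by auto
        have A: "x \<in> A" "y \<in> A" using xy YA by auto
        then have "t \<noteq> \<zero>" using xy(4) Ac'[OF A(1)] Ac'[OF A(2)] by auto
        then have "rel x y" using xy by (auto simp: rel_def)
        then have "rel x' y" using rel_trans[of x' x y] r(2)[OF x'(1)] x' A by simp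
        moreover have "rel y y'" using rel_sym[of y' y] r(2)[OF y'(1)] y' A by simp
        ultimately have "rel x' y'" using rel_trans[of x' y y'] x' y' A by simp
        then show ?thesis using r_eq x' y' by simp
      qed
    qed (use CE sumC y in auto)
    \<comment> \<open>The vanishing of the collected coefficient is a \<open>K\<close>-relation
      between powers of \<open>b\<close>. Equal exponents within a class would mean proportionality
      over \<open>K\<close>, which \<open>ineq\<close> allows only for equal elements.\<close>
    have "c x \<otimes> l x = \<zero>"
    proof (rule S.radicals_combination[of "?F (r x)" "\<lambda>x. c x \<otimes> l x" j])
      show "finite (?F (r x))" using fin by simp
      show "(\<Oplus>x\<in>?F (r x). c x \<otimes> l x \<otimes> (x0 [^] k) [^] j x) = \<zero>"
        using C0[of "r x"] less.prems(11) by (simp add: C_def)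
      show "inj_on j (?F (r x))"
      proof (rule inj_onI)
        fix y z assume y: "y \<in> ?F (r x)" and z: "z \<in> ?F (r x)" and jyz: "j y = j z"
        have il: "inv (l z) \<in> K" "inv (l z) \<otimes> l z = \<one>"
          using subfield_m_inv[OF K, of "l z"] l z by auto
        let ?u = "(x0 [^] k) [^] j z \<otimes> r x"
        have u: "?u \<in> carrier R" using S.b Ac' r(1)[OF less.prems(11)] by simp
        have yz: "y = l y \<otimes> ?u" "z = l z \<otimes> ?u"
          using lj[of y] lj[of z] y z jyz l S.b Ac' r(1)[OF less.prems(11)] by (auto simp: m_assoc)
        have "(l y \<otimes> inv (l z)) \<otimes> z = l y \<otimes> (inv (l z) \<otimes> l z \<otimes> ?u)"
          using il l y z u yz(2) S.K_carrier by (metis (no_types, lifting) m_assoc m_closed mem_Collect_eq)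
        then have "y = (l y \<otimes> inv (l z)) \<otimes> z" using il u yz(1) by simp
        then show "y = z" using ineq[of y z "l y \<otimes> inv (l z)"] y z l il S.K_mult by blast
      qed
    qed (use clK j less.prems(11) in auto)
    then show ?thesis using l[OF less.prems(11)] cK[OF less.prems(11)] by (simp add: integral_iff)
  qed
qed

section \<open>The canonical homomorphism\<close>

text \<open>The product of \<open>coset_algebra\<close> is summed in \<open>K\<close> as a ring of
  its own; this carries such sums over to \<open>R\<close>.\<close>

lemma (in ring) finsum_subring_consistent:
  assumes H: "subring H R" and f: "\<And>x. x \<in> A \<Longrightarrow> f x \<in> H"
  shows "finsum (R\<lparr>carrier := H\<rparr>) f A = finsum R f A"
proof -
  interpret S: ring "R\<lparr>carrier := H\<rparr>" by (rule subring_is_ring[OF H])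
  show ?thesis using f
  proof (induction A rule: infinite_finite_induct)
    case (insert x A)
    then show ?case
      using subringE(1)[OF H] by (subst S.finsum_insert, simp_all, subst finsum_insert) auto
  qed (use S.finsum_infinite S.finsum_empty in simp_all)
qed

lemma finsum_ring_as_algebra: "finsum (ring_as_algebra L) f A = finsum L f A"
  by (simp add: finsum_def finprod_def ring_as_algebra_def)

locale subfield_extension = field R for R (structure) +
  fixes K :: "'a set"
  assumes K: "subfield K R"
begin

lemma K_carrier [simp]: "x \<in> K \<Longrightarrow> x \<in> carrier R" using subfieldE(3)[OF K] by auto

lemma K' : "subring K R" using subfieldE(1)[OF K] .

lemma K_closed [simp]: "\<zero> \<in> K" "\<one> \<in> K" "x \<in> K \<Longrightarrow> \<ominus> x \<in> K"
  "x \<in> K \<Longrightarrow> y \<in> K \<Longrightarrow> x \<otimes> y \<in> K" "x \<in> K \<Longrightarrow> y \<in> K \<Longrightarrow> x \<oplus> y \<in> K"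
  using subringE[OF K'] by auto

lemma K_pow [simp]: "x \<in> K \<Longrightarrow> x [^] (n::nat) \<in> K"
  using pow_in_submonoid[OF subring.axioms(2)[OF K']] by blast

lemma K_inv [simp]: "x \<in> K \<Longrightarrow> x \<noteq> \<zero> \<Longrightarrow> inv x \<in> K"
  using subfield_m_inv(1)[OF K] by blast

abbreviation k :: "('a, 'b) ring_scheme" where "k \<equiv> R\<lparr>carrier := K\<rparr>"
abbreviation T :: "'a set" where "T \<equiv> torsion_set R K"
abbreviation U :: "'a monoid" where "U \<equiv> torsion_group R K"
abbreviation D :: "'a set monoid" where "D \<equiv> class_group k U"

lemma Units_K: "Units k = K - {\<zero>}" by (rule subfield.subfield_Units[OF K])

lemma T_iff: "x \<in> T \<longleftrightarrow> x \<in> carrier R \<and> x \<noteq> \<zero> \<and> (\<exists>n\<ge>1. x [^] (n::nat) \<in> K)"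
  using pow_nonzero by (auto simp: torsion_set_def Units_K field_Units)

lemma T_carrier: "x \<in> T \<Longrightarrow> x \<in> carrier R" "x \<in> T \<Longrightarrow> x \<noteq> \<zero>"
  by (simp_all add: T_iff)

lemma T_of_K: "x \<in> K \<Longrightarrow> x \<noteq> \<zero> \<Longrightarrow> x \<in> T"
  by (auto simp: T_iff intro!: exI[of _ 1])

lemma T_mult:
  assumes "x \<in> T" "y \<in> T" shows "x \<otimes> y \<in> T"
proof -
  obtain m n :: nat where mn: "m \<ge> 1" "x [^] m \<in> K" "n \<ge> 1" "y [^] n \<in> K"
    using assms by (auto simp: T_iff)
  have "(x [^] m) [^] n \<otimes> (y [^] n) [^] m \<in> K" using mn by simp
  then have "(x \<otimes> y) [^] (m * n) \<in> K"
    using T_carrier assms by (simp add: nat_pow_pow nat_pow_distrib mult.commute)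
  moreover have "m * n \<ge> 1" using mn by simp
  ultimately show ?thesis
    unfolding T_iff using T_carrier assms by (intro conjI exI[of _ "m * n"]) (auto simp: integral_iff)
qed

lemma T_inv:
  assumes "x \<in> T" shows "inv x \<in> T"
proof -
  obtain n :: nat where n: "n \<ge> 1" "x [^] n \<in> K" using assms by (auto simp: T_iff)
  note ix = inv_closed_nonzero[OF T_carrier[OF assms]]
  have xc: "x \<in> carrier R" using T_carrier assms by simp
  have "x [^] n \<otimes> inv x [^] n = \<one>"
    using nat_pow_distrib[OF xc ix(1), of n] ix(2) by simp
  then have "inv x [^] n \<in> K"
    using subfield_m_inv_simprule[OF K, of "x [^] n" "inv x [^] n"] n xc ix pow_nonzero T_carrier[OF assms]
    by simp
  then show ?thesis using ix n by (auto simp: T_iff)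
qed

text \<open>Coset modulo the units of \<open>K\<close>, in one form for the quotient of the torsion
  group and that of all units.\<close>

definition cls :: "'a \<Rightarrow> 'a set" where "cls x = (\<lambda>h. h \<otimes> x) ` (K - {\<zero>})"

lemma cls_self: "x \<in> carrier R \<Longrightarrow> x \<in> cls x"
  unfolding cls_def by (intro image_eqI[of _ _ \<one>]) auto

lemma cls_mem: "y \<in> cls x \<longleftrightarrow> (\<exists>h\<in>K. h \<noteq> \<zero> \<and> y = h \<otimes> x)"
  by (auto simp: cls_def)

lemma cls_eq:
  assumes x: "x \<in> carrier R" and h: "h \<in> K" "h \<noteq> \<zero>" shows "cls (h \<otimes> x) = cls x"
proof -
  note ih = inv_closed_nonzero[of h]
  show ?thesis
  proof (intro equalityI subsetI)
    fix y assume "y \<in> cls (h \<otimes> x)"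
    then obtain g where g: "g \<in> K" "g \<noteq> \<zero>" "y = g \<otimes> (h \<otimes> x)" by (auto simp: cls_mem)
    then have "y = (g \<otimes> h) \<otimes> x" "g \<otimes> h \<noteq> \<zero>" using x h by (simp_all add: m_assoc integral_iff)
    then show "y \<in> cls x" using g h K_closed(4) by (auto simp only: cls_mem)
  next
    fix y assume "y \<in> cls x"
    then obtain g where g: "g \<in> K" "g \<noteq> \<zero>" "y = g \<otimes> x" by (auto simp: cls_mem)
    then have "y = (g \<otimes> inv h) \<otimes> (h \<otimes> x)" "g \<otimes> inv h \<noteq> \<zero>"
      using x h ih by (simp_all add: m_assoc integral_iff) (simp add: m_assoc[symmetric])
    then show "y \<in> cls (h \<otimes> x)" using g h K_closed(4) K_inv by (auto simp only: cls_mem)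
  qed
qed

lemma cls_eq_iff:
  assumes "x \<in> carrier R" "y \<in> carrier R"
  shows "cls x = cls y \<longleftrightarrow> (\<exists>h\<in>K. h \<noteq> \<zero> \<and> x = h \<otimes> y)"
  using cls_eq[OF assms(2)] cls_self[OF assms(1)] by (metis cls_mem)

lemma cls_mult:
  assumes "x \<in> carrier R" "y \<in> carrier R"
  shows "(\<Union>a\<in>cls x. \<Union>b\<in>cls y. {a \<otimes> b}) = cls (x \<otimes> y)"
proof (intro equalityI subsetI)
  fix z assume "z \<in> (\<Union>a\<in>cls x. \<Union>b\<in>cls y. {a \<otimes> b})"
  then obtain g h where gh: "g \<in> K" "g \<noteq> \<zero>" "h \<in> K" "h \<noteq> \<zero>" "z = (g \<otimes> x) \<otimes> (h \<otimes> y)"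
    by (auto simp: cls_mem)
  then have "z = (g \<otimes> h) \<otimes> (x \<otimes> y)" "g \<otimes> h \<noteq> \<zero>"
    using assms by (simp_all add: m_ac integral_iff)
  then show "z \<in> cls (x \<otimes> y)" using gh K_closed(4) by (auto simp only: cls_mem)
next
  fix z assume "z \<in> cls (x \<otimes> y)"
  then obtain g where g: "g \<in> K" "g \<noteq> \<zero>" "z = g \<otimes> (x \<otimes> y)" by (auto simp: cls_mem)
  then have "z = (g \<otimes> x) \<otimes> y" using assms by (simp add: m_assoc)
  moreover have "g \<otimes> x \<in> cls x" using g by (auto simp: cls_mem)
  ultimately show "z \<in> (\<Union>a\<in>cls x. \<Union>b\<in>cls y. {a \<otimes> b})" using cls_self[OF assms(2)] by blast
qed

lemma D_carrier: "carrier D = cls ` T"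
  by (auto simp: class_group_def FactGroup_def RCOSETS_def r_coset_def torsion_group_def units_of_def
      Units_K cls_def image_def)

lemma D_mult: "x \<in> carrier R \<Longrightarrow> y \<in> carrier R \<Longrightarrow> cls x \<otimes>\<^bsub>D\<^esub> cls y = cls (x \<otimes> y)"
  using cls_mult by (simp add: class_group_def FactGroup_def set_mult_def torsion_group_def units_of_def)

lemma D_one: "\<one>\<^bsub>D\<^esub> = cls \<one>"
  by (auto simp: class_group_def FactGroup_def Units_K cls_def)

lemma rep:
  assumes "d \<in> carrier D"
  shows "class_rep d \<in> T" "cls (class_rep d) = d"
proof -
  obtain x where x: "x \<in> T" "d = cls x" using assms by (auto simp: D_carrier)
  have "class_rep d \<in> d"
    unfolding class_rep_def x(2) using cls_self[OF T_carrier(1)[OF x(1)]] by (rule someI)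
  then obtain h where h: "h \<in> K" "h \<noteq> \<zero>" "class_rep d = h \<otimes> x" using x by (auto simp: cls_mem)
  then show "class_rep d \<in> T" using T_mult T_of_K x by simp
  show "cls (class_rep d) = d" using cls_eq h x T_carrier by simp
qed

lemma rep_carrier [simp]:
  assumes "d \<in> carrier D" shows "class_rep d \<in> carrier R" "class_rep d \<noteq> \<zero>"
  using T_carrier rep(1)[OF assms] by auto

lemma D_mult_closed [simp]: "d \<in> carrier D \<Longrightarrow> e \<in> carrier D \<Longrightarrow> d \<otimes>\<^bsub>D\<^esub> e \<in> carrier D"
  using T_mult T_carrier by (auto simp: D_carrier D_mult)

text \<open>The product of representatives and the representative of the product have the same
  class, and a nonzero representative can be cancelled; so exactly one \<open>a\<close> meets the
  definite description.\<close>

lemma structure_const: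
  assumes d: "d \<in> carrier D" and e: "e \<in> carrier D"
  shows "structure_const k U d e \<in> K"
    and "class_rep d \<otimes> class_rep e = structure_const k U d e \<otimes> class_rep (d \<otimes>\<^bsub>D\<^esub> e)"
proof -
  let ?P = "\<lambda>a. a \<in> Units k \<and> class_rep d \<otimes>\<^bsub>U\<^esub> class_rep e = a \<otimes>\<^bsub>U\<^esub> class_rep (d \<otimes>\<^bsub>D\<^esub> e)"
  have Um: "\<And>x y. x \<otimes>\<^bsub>U\<^esub> y = x \<otimes> y" by (simp add: torsion_group_def units_of_def)
  let ?r = "class_rep (d \<otimes>\<^bsub>D\<^esub> e)"
  have r: "?r \<in> carrier R" "?r \<noteq> \<zero>" using d e by simp_all
  have "cls (class_rep d \<otimes> class_rep e) = cls ?r"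
    using rep(2)[OF d] rep(2)[OF e] rep(2)[of "d \<otimes>\<^bsub>D\<^esub> e"] D_mult[of "class_rep d" "class_rep e"] d e
    by simp
  then obtain h where h: "h \<in> K" "h \<noteq> \<zero>" "class_rep d \<otimes> class_rep e = h \<otimes> ?r"
    using cls_eq_iff[of "class_rep d \<otimes> class_rep e" ?r] d e r by auto
  have "?P (structure_const k U d e)"
    unfolding structure_const_def
  proof (rule theI)
    show "?P h" using h by (simp add: Units_K Um)
    fix g assume "?P g"
    then have "g \<in> K" "g \<otimes> ?r = h \<otimes> ?r" using h by (simp_all add: Units_K Um)
    then show "g = h" using h r m_rcancel by simp
  qed
  then show "structure_const k U d e \<in> K"
    "class_rep d \<otimes> class_rep e = structure_const k U d e \<otimes> ?r"
    by (simp_all add: Units_K Um)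
qed

section \<open>Evaluation of the coset algebra in \<open>R\<close>\<close>

abbreviation A :: "('a, 'a set \<Rightarrow> 'a) module" where "A \<equiv> coset_algebra k U"
abbreviation \<Phi> :: "('a set \<Rightarrow> 'a) \<Rightarrow> 'a" where "\<Phi> \<equiv> canonical_hom k U (ring_as_algebra R)"

definition supp :: "('a set \<Rightarrow> 'a) \<Rightarrow> 'a set set" where "supp f = {d. f d \<noteq> \<zero>}"

lemma A_carrier: "f \<in> carrier A \<longleftrightarrow> (\<forall>d. f d \<in> K) \<and> supp f \<subseteq> carrier D \<and> finite (supp f)"
  by (simp add: coset_algebra_def supp_def)

lemma Phi_eq: "\<Phi> f = (\<Oplus>d\<in>supp f. f d \<otimes> class_rep d)"
  by (simp add: canonical_hom_def finsum_ring_as_algebra supp_def) (simp add: ring_as_algebra_def)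

text \<open>Cancellation may shrink supports, so sums and multiples are evaluated over a common
  larger set of classes.\<close>

lemma Phi_superset:
  assumes f: "\<And>d. f d \<in> K" and F: "finite F" "supp f \<subseteq> F" "F \<subseteq> carrier D"
  shows "\<Phi> f = (\<Oplus>d\<in>F. f d \<otimes> class_rep d)"
  unfolding Phi_eq
proof (rule add.finprod_mono_neutral_cong_left)
  show "\<And>i. i \<in> F - supp f \<Longrightarrow> f i \<otimes> class_rep i = \<zero>" using F by (auto simp: supp_def)
  show "(\<lambda>d. f d \<otimes> class_rep d) \<in> F \<rightarrow> carrier R" using f F by auto
qed (use F in auto)

lemma Phi_closed: "f \<in> carrier A \<Longrightarrow> \<Phi> f \<in> carrier R"
  unfolding Phi_eq by (intro finsum_closed) (auto simp: A_carrier)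

lemma Phi_add:
  assumes f: "f \<in> carrier A" and g: "g \<in> carrier A" shows "\<Phi> (f \<oplus>\<^bsub>A\<^esub> g) = \<Phi> f \<oplus> \<Phi> g"
proof -
  have fK: "\<And>d. f d \<in> K" "\<And>d. g d \<in> K" using f g by (auto simp: A_carrier)
  let ?F = "supp f \<union> supp g"
  have F: "finite ?F" "?F \<subseteq> carrier D" using f g by (auto simp: A_carrier)
  have fg: "f \<oplus>\<^bsub>A\<^esub> g = (\<lambda>d. f d \<oplus> g d)" by (simp add: coset_algebra_def)
  have "\<Phi> (f \<oplus>\<^bsub>A\<^esub> g) = (\<Oplus>d\<in>?F. (f d \<oplus> g d) \<otimes> class_rep d)"
    unfolding fg using F fK by (intro Phi_superset) (auto simp: supp_def)
  also have "\<dots> = (\<Oplus>d\<in>?F. f d \<otimes> class_rep d \<oplus> g d \<otimes> class_rep d)"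
    using F fK subsetD[OF F(2)] by (intro finsum_cong') (auto simp: l_distr simp del: Un_iff)
  also have "\<dots> = (\<Oplus>d\<in>?F. f d \<otimes> class_rep d) \<oplus> (\<Oplus>d\<in>?F. g d \<otimes> class_rep d)"
    using F fK subsetD[OF F(2)] by (intro finsum_addf) (auto simp del: Un_iff)
  also have "(\<Oplus>d\<in>?F. f d \<otimes> class_rep d) = \<Phi> f"
    using F fK by (intro Phi_superset[symmetric]) auto
  also have "(\<Oplus>d\<in>?F. g d \<otimes> class_rep d) = \<Phi> g"
    using F fK by (intro Phi_superset[symmetric]) auto
  finally show ?thesis .
qed

lemma Phi_smult:
  assumes f: "f \<in> carrier A" and a: "a \<in> K" shows "\<Phi> (a \<odot>\<^bsub>A\<^esub> f) = a \<otimes> \<Phi> f"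
proof -
  have fK: "\<And>d. f d \<in> K" and F: "finite (supp f)" "supp f \<subseteq> carrier D"
    using f by (auto simp: A_carrier)
  have af: "a \<odot>\<^bsub>A\<^esub> f = (\<lambda>d. a \<otimes> f d)" by (simp add: coset_algebra_def)
  have "\<Phi> (a \<odot>\<^bsub>A\<^esub> f) = (\<Oplus>d\<in>supp f. (a \<otimes> f d) \<otimes> class_rep d)"
    unfolding af using F fK a by (intro Phi_superset) (auto simp: supp_def)
  also have "\<dots> = (\<Oplus>d\<in>supp f. a \<otimes> (f d \<otimes> class_rep d))"
    using subsetD[OF F(2)] fK a by (intro finsum_cong') (auto simp: m_assoc)
  also have "\<dots> = a \<otimes> \<Phi> f"
    unfolding Phi_eq using subsetD[OF F(2)] F fK a by (intro finsum_rdistr[symmetric]) auto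
  finally show ?thesis .
qed

lemma Phi_one: "\<Phi> \<one>\<^bsub>A\<^esub> = \<one>"
proof -
  let ?r = "class_rep \<one>\<^bsub>D\<^esub>"
  have "\<one> \<in> T" using T_of_K by simp
  then have 1: "\<one>\<^bsub>D\<^esub> \<in> carrier D" by (simp add: D_one D_carrier)
  have "cls ?r = cls \<one>" using rep(2)[OF 1] by (simp add: D_one)
  then have "?r \<in> cls \<one>" using cls_self[OF rep_carrier(1)[OF 1]] by simp
  then have rK: "?r \<in> K" by (auto simp: cls_mem)
  have kc: "monoid k" using subring_is_ring[OF K'] by (rule ring.is_monoid)
  have ru: "?r \<in> Units k" using rK rep_carrier(2)[OF 1] by (simp add: Units_K)
  have inv: "inv\<^bsub>k\<^esub> ?r \<in> K" "inv\<^bsub>k\<^esub> ?r \<otimes> ?r = \<one>"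
    using monoid.Units_inv_closed[OF kc ru] monoid.Units_l_inv[OF kc ru] by simp_all
  have "\<one>\<^bsub>A\<^esub> = (\<lambda>c. if c = \<one>\<^bsub>D\<^esub> then inv\<^bsub>k\<^esub> (class_rep c) else \<zero>)"
    by (simp add: coset_algebra_def cong: if_cong)
  then have "\<Phi> \<one>\<^bsub>A\<^esub> = (\<Oplus>d\<in>{\<one>\<^bsub>D\<^esub>}. (if d = \<one>\<^bsub>D\<^esub> then inv\<^bsub>k\<^esub> (class_rep d) else \<zero>) \<otimes> class_rep d)"
    using inv 1 by (simp only:) (intro Phi_superset, auto simp: supp_def split: if_splits)
  also have "\<dots> = \<one>" using inv by simp
  finally show ?thesis .
qed

lemma mult_coefficient:
  assumes f: "f \<in> carrier A" and g: "g \<in> carrier A"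
  shows "(f \<otimes>\<^bsub>A\<^esub> g) c = (\<Oplus>x\<in>{x \<in> supp f \<times> supp g. (\<lambda>(d, e). d \<otimes>\<^bsub>D\<^esub> e) x = c}.
      (\<lambda>(d, e). f d \<otimes> g e \<otimes> structure_const k U d e) x)"
    and "x \<in> supp f \<times> supp g \<Longrightarrow> (\<lambda>(d, e). f d \<otimes> g e \<otimes> structure_const k U d e) x \<in> K"
proof -
  have fK: "\<And>d. f d \<in> K" and F: "finite (supp f)" "\<And>d. d \<in> supp f \<Longrightarrow> d \<in> carrier D"
    using f by (auto simp: A_carrier)
  have gK: "\<And>d. g d \<in> K" and G: "finite (supp g)" "\<And>d. d \<in> supp g \<Longrightarrow> d \<in> carrier D"
    using g by (auto simp: A_carrier)
  let ?P = "supp f \<times> supp g"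
  let ?t = "\<lambda>(d, e). f d \<otimes> g e \<otimes> structure_const k U d e"
  let ?m = "\<lambda>(d, e). d \<otimes>\<^bsub>D\<^esub> e"
  let ?Q = "{(d, e). f d \<noteq> \<zero> \<and> g e \<noteq> \<zero> \<and> d \<otimes>\<^bsub>D\<^esub> e = c}"
  have Q: "?Q = {x \<in> ?P. ?m x = c}" by (auto simp: supp_def)
  show tK: "?t x \<in> K" if "x \<in> ?P" for x
    using that fK gK structure_const(1) F G by auto
  have "(f \<otimes>\<^bsub>A\<^esub> g) c = finsum k ?t ?Q" by (simp add: coset_algebra_def)
  also have "\<dots> = (\<Oplus>x\<in>?Q. ?t x)"
    using tK unfolding Q by (intro finsum_subring_consistent[OF K']) blast
  finally show "(f \<otimes>\<^bsub>A\<^esub> g) c = (\<Oplus>x\<in>{x \<in> ?P. ?m x = c}. ?t x)" unfolding Q .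
qed

lemma mult_supp:
  assumes f: "f \<in> carrier A" and g: "g \<in> carrier A"
  shows "supp (f \<otimes>\<^bsub>A\<^esub> g) \<subseteq> (\<lambda>(d, e). d \<otimes>\<^bsub>D\<^esub> e) ` (supp f \<times> supp g)"
proof
  let ?P = "supp f \<times> supp g"
  let ?t = "\<lambda>(d, e). f d \<otimes> g e \<otimes> structure_const k U d e"
  let ?m = "\<lambda>(d, e). d \<otimes>\<^bsub>D\<^esub> e"
  fix c assume c: "c \<in> supp (f \<otimes>\<^bsub>A\<^esub> g)"
  show "c \<in> ?m ` ?P"
  proof (rule ccontr)
    assume "c \<notin> ?m ` ?P"
    then have e: "{x \<in> ?P. ?m x = c} = {}" by blast
    have "(f \<otimes>\<^bsub>A\<^esub> g) c = \<zero>" unfolding mult_coefficient(1)[OF f g] e by (rule finsum_empty)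
    then show False using c by (simp add: supp_def)
  qed
qed

lemma A_mult_closed:
  assumes f: "f \<in> carrier A" and g: "g \<in> carrier A" shows "f \<otimes>\<^bsub>A\<^esub> g \<in> carrier A"
  unfolding A_carrier
proof (intro conjI allI)
  show "(f \<otimes>\<^bsub>A\<^esub> g) c \<in> K" for c
    unfolding mult_coefficient(1)[OF f g]
    by (rule finsum_in_subring[OF K'], rule mult_coefficient(2)[OF f g]) simp
  have "(\<lambda>(d, e). d \<otimes>\<^bsub>D\<^esub> e) ` (supp f \<times> supp g) \<subseteq> carrier D"
    "finite ((\<lambda>(d, e). d \<otimes>\<^bsub>D\<^esub> e) ` (supp f \<times> supp g))"
    using f g by (auto simp: A_carrier subset_iff)
  then show "supp (f \<otimes>\<^bsub>A\<^esub> g) \<subseteq> carrier D" "finite (supp (f \<otimes>\<^bsub>A\<^esub> g))"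
    using mult_supp[OF f g] by (blast intro: finite_subset)+
qed

text \<open>A coefficient of the product collects the pairs \<open>(d, e)\<close> with a given
  product class. Summing over the classes restores the sum over all pairs, and there the structure
  constant turns the representative of the product back into the product of representatives.\<close>

lemma Phi_mult:
  assumes f: "f \<in> carrier A" and g: "g \<in> carrier A" shows "\<Phi> (f \<otimes>\<^bsub>A\<^esub> g) = \<Phi> f \<otimes> \<Phi> g"
proof -
  have fK: "\<And>d. f d \<in> K" and F: "finite (supp f)" "\<And>d. d \<in> supp f \<Longrightarrow> d \<in> carrier D"
    using f by (auto simp: A_carrier)
  have gK: "\<And>d. g d \<in> K" and G: "finite (supp g)" "\<And>d. d \<in> supp g \<Longrightarrow> d \<in> carrier D"
    using g by (auto simp: A_carrier)
  let ?P = "supp f \<times> supp g"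
  let ?t = "\<lambda>(d, e). f d \<otimes> g e \<otimes> structure_const k U d e"
  let ?m = "\<lambda>(d, e). d \<otimes>\<^bsub>D\<^esub> e"
  let ?C = "?m ` ?P"
  note tK = mult_coefficient(2)[OF f g]
  have rm: "class_rep (?m x) \<in> carrier R" if "x \<in> ?P" for x using that F G by auto
  have tm: "?t x \<otimes> class_rep (?m x) \<in> carrier R" if "x \<in> ?P" for x
    using m_closed[OF K_carrier[OF tK[OF that]] rm[OF that]] .
  have fgK: "(f \<otimes>\<^bsub>A\<^esub> g) c \<in> K" for c using A_mult_closed[OF f g] by (simp add: A_carrier)
  have "finite ?C" "?C \<subseteq> carrier D" using F G by auto
  then have "\<Phi> (f \<otimes>\<^bsub>A\<^esub> g) = (\<Oplus>c\<in>?C. (f \<otimes>\<^bsub>A\<^esub> g) c \<otimes> class_rep c)"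
    using fgK mult_supp[OF f g] by (intro Phi_superset)
  also have "\<dots> = (\<Oplus>c\<in>?C. \<Oplus>x\<in>{x \<in> ?P. ?m x = c}. ?t x \<otimes> class_rep (?m x))"
  proof (intro finsum_cong' refl)
    fix c assume c: "c \<in> ?C"
    have rc: "class_rep c \<in> carrier R" using c rm by blast
    have "(f \<otimes>\<^bsub>A\<^esub> g) c \<otimes> class_rep c = (\<Oplus>x\<in>{x \<in> ?P. ?m x = c}. ?t x \<otimes> class_rep c)"
      unfolding mult_coefficient(1)[OF f g]
    proof (rule finsum_ldistr[OF _ rc])
      show "finite {x \<in> ?P. ?m x = c}" using F G by simp
      show "?t \<in> {x \<in> ?P. ?m x = c} \<rightarrow> carrier R" using tK K_carrier by blast
    qed
    also have "\<dots> = (\<Oplus>x\<in>{x \<in> ?P. ?m x = c}. ?t x \<otimes> class_rep (?m x))"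
    proof (rule finsum_cong')
      show "(\<lambda>x. ?t x \<otimes> class_rep (?m x)) \<in> {x \<in> ?P. ?m x = c} \<rightarrow> carrier R" using tm by blast
      fix x assume "x \<in> {x \<in> ?P. ?m x = c}"
      then have "?m x = c" by blast
      then show "?t x \<otimes> class_rep c = ?t x \<otimes> class_rep (?m x)" by (simp only:)
    qed (rule refl)
    finally show "(f \<otimes>\<^bsub>A\<^esub> g) c \<otimes> class_rep c = (\<Oplus>x\<in>{x \<in> ?P. ?m x = c}. ?t x \<otimes> class_rep (?m x))" .
  next
    show "(\<lambda>c. \<Oplus>x\<in>{x \<in> ?P. ?m x = c}. ?t x \<otimes> class_rep (?m x)) \<in> ?C \<rightarrow> carrier R"
      by (intro funcsetI finsum_closed, rule tm) simp
  qed
  also have "\<dots> = (\<Oplus>x\<in>(\<Union>c\<in>?C. {x \<in> ?P. ?m x = c}). ?t x \<otimes> class_rep (?m x))"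
  proof (rule add.finprod_UN_disjoint[symmetric])
    show "?t x \<otimes> class_rep (?m x) \<in> carrier R" if "c \<in> ?C" "x \<in> {x \<in> ?P. ?m x = c}" for c x
      using that by (intro tm) simp
  qed (use F G in \<open>auto simp: pairwise_def disjnt_def\<close>)
  also have "(\<Union>c\<in>?C. {x \<in> ?P. ?m x = c}) = ?P" by blast
  also have "(\<Oplus>x\<in>?P. ?t x \<otimes> class_rep (?m x)) =
      (\<Oplus>x\<in>?P. (\<lambda>(d, e). (f d \<otimes> class_rep d) \<otimes> (g e \<otimes> class_rep e)) x)"
  proof (intro finsum_cong' refl)
    fix x assume "x \<in> ?P"
    then obtain d e where x: "x = (d, e)" "d \<in> carrier D" "e \<in> carrier D" using F G by blast
    have "f d \<otimes> g e \<otimes> structure_const k U d e \<otimes> class_rep (d \<otimes>\<^bsub>D\<^esub> e) = f d \<otimes> g e \<otimes> (class_rep d \<otimes> class_rep e)"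
      using structure_const[OF x(2,3)] x fK gK by (simp add: m_assoc)
    also have "\<dots> = (f d \<otimes> class_rep d) \<otimes> (g e \<otimes> class_rep e)"
      using x fK gK by (simp add: m_ac)
    finally show "?t x \<otimes> class_rep (?m x) = (\<lambda>(d, e). (f d \<otimes> class_rep d) \<otimes> (g e \<otimes> class_rep e)) x"
      using x by simp
  qed (use F G fK gK in auto)
  also have "\<dots> = (\<Oplus>d\<in>supp f. \<Oplus>e\<in>supp g. (f d \<otimes> class_rep d) \<otimes> (g e \<otimes> class_rep e))"
  proof -
    let ?h = "\<lambda>(d, e). (f d \<otimes> class_rep d) \<otimes> (g e \<otimes> class_rep e)"
    have P: "?P = (\<Union>d\<in>supp f. Pair d ` supp g)" by auto
    have "(\<Oplus>x\<in>?P. ?h x) = (\<Oplus>d\<in>supp f. \<Oplus>x\<in>Pair d ` supp g. ?h x)"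
      unfolding P using F G fK gK by (intro add.finprod_UN_disjoint) (auto simp: pairwise_def disjnt_def)
    also have "\<dots> = (\<Oplus>d\<in>supp f. \<Oplus>e\<in>supp g. ?h (d, e))"
    proof (intro finsum_cong' refl)
      fix d assume "d \<in> supp f"
      then show "(\<Oplus>x\<in>Pair d ` supp g. ?h x) = (\<Oplus>e\<in>supp g. ?h (d, e))"
        using F G fK gK by (intro finsum_reindex) (auto simp: inj_on_def)
    qed (use F G fK gK in \<open>auto intro!: finsum_closed\<close>)
    finally show ?thesis by simp
  qed
  also have "\<dots> = (\<Oplus>d\<in>supp f. (f d \<otimes> class_rep d) \<otimes> \<Phi> g)"
    unfolding Phi_eq[of g] using F G fK gK
    by (intro finsum_cong' finsum_rdistr[symmetric]) (auto intro!: finsum_closed)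
  also have "\<dots> = \<Phi> f \<otimes> \<Phi> g"
    unfolding Phi_eq[of f] using F fK Phi_closed[OF g] by (intro finsum_ldistr[symmetric]) auto
  finally show ?thesis .
qed

text \<open>\<open>\<Phi>\<close> always respects the \<open>K\<close>-algebra structure, so only
  bijectivity is at stake.\<close>

lemma absolutely_co_Galois_iff_bij:
  "absolutely_co_Galois R K \<longleftrightarrow> bij_betw \<Phi> (carrier A) (carrier R)"
proof -
  have "\<Phi> \<in> ring_hom A (ring_as_algebra R)"
    using Phi_closed Phi_add Phi_mult Phi_one by (auto simp: ring_hom_def ring_as_algebra_def)
  moreover have "\<Phi> (a \<odot>\<^bsub>A\<^esub> f) = a \<odot>\<^bsub>ring_as_algebra R\<^esub> \<Phi> f" if "a \<in> K" "f \<in> carrier A" for a f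
    using Phi_smult[OF that(2,1)] by (simp add: ring_as_algebra_def)
  moreover have "carrier (ring_as_algebra R) = carrier R" by (simp add: ring_as_algebra_def)
  ultimately show ?thesis
    by (simp add: absolutely_co_Galois_def algebra_iso_def ring_iso_def Let_def)
qed

end

section \<open>The Frobenius endomorphism\<close>

lemma (in cring) binomial_one_plus:
  assumes x: "x \<in> carrier R"
  shows "(\<one> \<oplus> x) [^] (n::nat) = (\<Oplus>i\<in>{..n}. add_pow R (n choose i) (x [^] i))"
proof (induction n)
  case 0
  show ?case by (simp add: add.nat_pow_Suc add_pow_def)
next
  case (Suc n)
  let ?t = "\<lambda>n i. add_pow R (n choose i) (x [^] (i::nat))"
  have t: "\<And>n i. ?t n i \<in> carrier R" using x by simp
  have "(\<one> \<oplus> x) [^] Suc n = (\<Oplus>i\<in>{..n}. ?t n i) \<oplus> (\<Oplus>i\<in>{..n}. ?t n i) \<otimes> x"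
    using x t by (simp add: Suc r_distr)
  also have "(\<Oplus>i\<in>{..n}. ?t n i) \<otimes> x = (\<Oplus>i\<in>{..n}. add_pow R (n choose i) (x [^] Suc i))"
    using x t by (subst finsum_ldistr) (auto simp: add_pow_ldistr)
  also have "(\<Oplus>i\<in>{..n}. ?t n i) = (\<Oplus>i\<in>{..Suc n}. ?t n i)"
  proof -
    have "?t n (Suc n) = \<zero>" by (simp add: binomial_eq_0)
    then show ?thesis using t by (subst finsum_Suc) auto
  qed
  also have "\<dots> = (\<Oplus>i\<in>{..n}. ?t n (Suc i)) \<oplus> \<one>"
    using t by (subst finsum_Suc2) (auto simp: add_pow_def)
  also have "(\<Oplus>i\<in>{..n}. ?t n (Suc i)) \<oplus> \<one> \<oplus> (\<Oplus>i\<in>{..n}. add_pow R (n choose i) (x [^] Suc i)) =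
      ((\<Oplus>i\<in>{..n}. ?t n (Suc i)) \<oplus> (\<Oplus>i\<in>{..n}. add_pow R (n choose i) (x [^] Suc i))) \<oplus> \<one>"
  proof -
    have "(\<Oplus>i\<in>{..n}. ?t n (Suc i)) \<in> carrier R" "(\<Oplus>i\<in>{..n}. add_pow R (n choose i) (x [^] Suc i)) \<in> carrier R"
      using x t by (auto intro!: finsum_closed)
    then show ?thesis by (simp only: a_assoc one_closed a_comm[of \<one>])
  qed
  also have "(\<Oplus>i\<in>{..n}. ?t n (Suc i)) \<oplus> (\<Oplus>i\<in>{..n}. add_pow R (n choose i) (x [^] Suc i)) =
      (\<Oplus>i\<in>{..n}. ?t (Suc n) (Suc i))"
    using x t by (subst finsum_addf[symmetric]) (auto simp: add.nat_pow_mult add.commute intro!: finsum_cong')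
  also have "\<dots> \<oplus> \<one> = (\<Oplus>i\<in>{..Suc n}. ?t (Suc n) i)"
    using t by (subst finsum_Suc2) (auto simp: add_pow_def)
  finally show ?case .
qed

text \<open>The inner binomial coefficients are multiples of \<open>l\<close>, which annihilates
  every element.\<close>

lemma (in cring) frobenius_one_plus:
  assumes l: "Factorial_Ring.prime (l::nat)" "add_pow R l \<one> = \<zero>" and x: "x \<in> carrier R"
  shows "(\<one> \<oplus> x) [^] l = \<one> \<oplus> x [^] l"
proof -
  have "(\<one> \<oplus> x) [^] l = (\<Oplus>i\<in>{..l}. add_pow R (l choose i) (x [^] i))" by (rule binomial_one_plus[OF x])
  also have "\<dots> = (\<Oplus>i\<in>{0, l}. add_pow R (l choose i) (x [^] i))"
  proof (rule add.finprod_mono_neutral_cong_right)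
    fix i assume "i \<in> {..l} - {0, l}"
    then obtain m where m: "l choose i = l * m" using dvd_choose_prime[of i l] l by (auto elim: dvdE)
    have "add_pow R l (x [^] i) = (add_pow R l \<one>) \<otimes> x [^] i" using x add_pow_ldistr[of \<one> "x [^] i" l] by simp
    then have "add_pow R l (x [^] i) = \<zero>" using l x by simp
    then show "add_pow R (l choose i) (x [^] i) = \<zero>"
      unfolding m using x add.nat_pow_pow[of "x [^] i" m l] by (simp add: add.nat_pow_one)
  qed (use x in auto)
  also have "\<dots> = add_pow R (l choose 0) (x [^] (0::nat)) \<oplus> add_pow R (l choose l) (x [^] l)"
    using x prime_gt_0_nat[OF l(1)] by simp
  also have "\<dots> = \<one> \<oplus> x [^] l" using x by (simp add: add_pow_def)
  finally show ?thesis .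
qed

section \<open>Independence of the representatives\<close>

context subfield_extension
begin

definition independent_reps :: bool where
  "independent_reps \<longleftrightarrow> (\<forall>F c. finite F \<and> F \<subseteq> carrier D \<and> (\<forall>d\<in>F. c d \<in> K) \<and>
     (\<Oplus>d\<in>F. c d \<otimes> class_rep d) = \<zero> \<longrightarrow> (\<forall>d\<in>F. c d = \<zero>))"

lemma independent_repsD:
  assumes "independent_reps" "finite F" "F \<subseteq> carrier D" "\<And>d. d \<in> F \<Longrightarrow> c d \<in> K"
    "(\<Oplus>d\<in>F. c d \<otimes> class_rep d) = \<zero>" "d \<in> F"
  shows "c d = \<zero>"
  using assms unfolding independent_reps_def by blast

text \<open>Independence says that the kernel is zero. The difference of \<open>f\<close> and
  \<open>g\<close> is formed as \<open>f\<close> plus -1 times \<open>g\<close>, so that additivity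
  and scaling of \<open>\<Phi>\<close> suffice.\<close>

lemma inj_Phi_iff: "inj_on \<Phi> (carrier A) \<longleftrightarrow> independent_reps"
proof
  assume inj: "inj_on \<Phi> (carrier A)"
  show independent_reps
    unfolding independent_reps_def
  proof (intro allI impI ballI)
    fix F c d assume F: "finite F \<and> F \<subseteq> carrier D \<and> (\<forall>d\<in>F. c d \<in> K) \<and> (\<Oplus>d\<in>F. c d \<otimes> class_rep d) = \<zero>"
      and d: "d \<in> F"
    let ?f = "\<lambda>d. if d \<in> F then c d else \<zero>"
    have fK: "\<And>d. ?f d \<in> K" using F by simp
    have s: "supp ?f \<subseteq> F" by (auto simp: supp_def)
    have fA: "?f \<in> carrier A" using F fK s finite_subset unfolding A_carrier by blast
    have "\<Phi> ?f = (\<Oplus>d\<in>F. ?f d \<otimes> class_rep d)" using F fK s by (intro Phi_superset) auto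
    also have "\<dots> = (\<Oplus>d\<in>F. c d \<otimes> class_rep d)" using F by (intro finsum_cong') auto
    finally have "\<Phi> ?f = \<zero>" using F by simp
    moreover have "\<Phi> (\<lambda>_. \<zero>) = \<zero>" by (simp add: Phi_eq supp_def)
    moreover have "(\<lambda>_. \<zero>) \<in> carrier A" by (simp add: A_carrier supp_def)
    ultimately have "?f = (\<lambda>_. \<zero>)"
      by (intro inj_onD[OF inj _ fA]) (simp_all only:)
    then show "c d = \<zero>" using d by (metis (mono_tags))
  qed
next
  assume ind: independent_reps
  show "inj_on \<Phi> (carrier A)"
  proof (rule inj_onI)
    fix f g assume f: "f \<in> carrier A" and g: "g \<in> carrier A" and e: "\<Phi> f = \<Phi> g"
    have K: "\<And>d. f d \<in> K" "\<And>d. g d \<in> K" using f g by (auto simp: A_carrier)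
    let ?F = "supp f \<union> supp g"
    have F: "finite ?F" "?F \<subseteq> carrier D" using f g by (auto simp: A_carrier)
    let ?g = "\<lambda>d. (\<ominus> \<one>) \<otimes> g d"
    have eg: "(\<ominus> \<one>) \<odot>\<^bsub>A\<^esub> g = ?g" by (simp add: coset_algebra_def)
    have h: "f \<oplus>\<^bsub>A\<^esub> ?g = (\<lambda>d. f d \<oplus> (\<ominus> \<one>) \<otimes> g d)" by (simp add: coset_algebra_def)
    have sg: "supp ?g = supp g" using K by (auto simp: supp_def l_minus)
    have gA: "?g \<in> carrier A" unfolding A_carrier sg using g K by (simp add: A_carrier)
    have "\<Phi> (f \<oplus>\<^bsub>A\<^esub> ?g) = \<Phi> f \<oplus> (\<ominus> \<one>) \<otimes> \<Phi> g"
      using Phi_add[OF f gA] Phi_smult[OF g, of "\<ominus> \<one>"] eg by simp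
    also have "\<dots> = \<zero>" using e Phi_closed[OF g] by (simp add: l_minus r_neg)
    also have "\<Phi> (f \<oplus>\<^bsub>A\<^esub> ?g) = (\<Oplus>d\<in>?F. (f d \<oplus> (\<ominus> \<one>) \<otimes> g d) \<otimes> class_rep d)"
      unfolding h using F K by (intro Phi_superset) (auto simp: supp_def)
    finally have sum: "(\<Oplus>d\<in>?F. (f d \<oplus> (\<ominus> \<one>) \<otimes> g d) \<otimes> class_rep d) = \<zero>" .
    show "f = g"
    proof
      fix d
      show "f d = g d"
      proof (cases "d \<in> ?F")
        case True
        have "f d \<oplus> (\<ominus> \<one>) \<otimes> g d = \<zero>"
          by (rule independent_repsD[OF ind F _ sum True]) (use K in simp)
        then have "f d \<ominus> g d = \<zero>" using K by (simp add: l_minus minus_eq)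
        then show ?thesis using K by simp
      qed (simp add: supp_def)
    qed
  qed
qed

text \<open>Each element is a unit of \<open>K\<close> times the representative of its class, and
  these classes are distinct; the units are absorbed into the coefficients. In this form
  independence can be tested on concrete elements.\<close>

lemma independent_elements:
  assumes ind: independent_reps and Y: "finite Y" "Y \<subseteq> T"
    and ineq: "\<And>x y h. x \<in> Y \<Longrightarrow> y \<in> Y \<Longrightarrow> h \<in> K \<Longrightarrow> x = h \<otimes> y \<Longrightarrow> x = y"
    and c: "\<And>x. x \<in> Y \<Longrightarrow> c x \<in> K" "(\<Oplus>x\<in>Y. c x \<otimes> x) = \<zero>" and x: "x \<in> Y"
  shows "c x = \<zero>"
proof -
  have YT: "y \<in> T" "y \<in> carrier R" "cls y \<in> carrier D" if "y \<in> Y" for y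
    using that Y T_carrier by (auto simp: D_carrier)
  have "\<forall>y\<in>Y. \<exists>h. h \<in> K \<and> h \<noteq> \<zero> \<and> y = h \<otimes> class_rep (cls y)"
  proof
    fix y assume y: "y \<in> Y"
    have "cls y = cls (class_rep (cls y))" using rep(2)[OF YT(3)[OF y]] by simp
    then show "\<exists>h. h \<in> K \<and> h \<noteq> \<zero> \<and> y = h \<otimes> class_rep (cls y)"
      using cls_eq_iff[OF YT(2)[OF y] rep_carrier(1)[OF YT(3)[OF y]]] by blast
  qed
  then obtain h where h: "\<And>y. y \<in> Y \<Longrightarrow> h y \<in> K \<and> h y \<noteq> \<zero> \<and> y = h y \<otimes> class_rep (cls y)"
    by metis
  have inj: "inj_on cls Y"
  proof (rule inj_onI)
    fix y z assume yz: "y \<in> Y" "z \<in> Y" "cls y = cls z"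
    then obtain g where "g \<in> K" "y = g \<otimes> z" using cls_eq_iff YT by blast
    then show "y = z" using ineq yz by blast
  qed
  define C where "C = (\<lambda>d. c (the_inv_into Y cls d) \<otimes> h (the_inv_into Y cls d))"
  have C: "C (cls y) = c y \<otimes> h y" if "y \<in> Y" for y
    using the_inv_into_f_f[OF inj that] by (simp add: C_def)
  have CK: "C d \<in> K" if "d \<in> cls ` Y" for d using that C h c(1) by auto
  have "(\<Oplus>d\<in>cls ` Y. C d \<otimes> class_rep d) = (\<Oplus>y\<in>Y. C (cls y) \<otimes> class_rep (cls y))"
    using CK YT by (intro finsum_reindex[OF _ inj]) auto
  also have "\<dots> = (\<Oplus>y\<in>Y. c y \<otimes> y)"
  proof (intro finsum_cong' refl)
    fix y assume y: "y \<in> Y"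
    have "C (cls y) \<otimes> class_rep (cls y) = c y \<otimes> (h y \<otimes> class_rep (cls y))"
      using C[OF y] h[OF y] c(1)[OF y] YT(3)[OF y] by (simp add: m_assoc)
    then show "C (cls y) \<otimes> class_rep (cls y) = c y \<otimes> y" using h[OF y] by simp
  qed (use c(1) YT in auto)
  finally have sum: "(\<Oplus>d\<in>cls ` Y. C d \<otimes> class_rep d) = \<zero>" using c(2) by simp
  have "C (cls x) = \<zero>"
    by (rule independent_repsD[OF ind _ _ CK sum]) (use Y YT x in auto)
  then show ?thesis using C[OF x] h[OF x] c(1)[OF x] by (simp add: integral_iff)
qed

text \<open>The image is closed under the ring operations because \<open>\<Phi>\<close> respects
  them, and it contains each torsion element as a \<open>K\<close>-multiple of a
  representative.\<close>

lemma Phi_image: "\<Phi> ` carrier A = generate_ring R (K \<union> T)"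
proof
  note G = generate_ring_is_subring[of "K \<union> T"]
  have sub: "K \<union> T \<subseteq> carrier R" using T_carrier by auto
  show "\<Phi> ` carrier A \<subseteq> generate_ring R (K \<union> T)"
  proof clarify
    fix f assume f: "f \<in> carrier A"
    show "\<Phi> f \<in> generate_ring R (K \<union> T)"
      unfolding Phi_eq
    proof (rule finsum_in_subring[OF G[OF sub]])
      fix d assume d: "d \<in> supp f"
      then have "f d \<in> K \<union> T" "class_rep d \<in> K \<union> T" using f rep(1) by (auto simp: A_carrier)
      then show "f d \<otimes> class_rep d \<in> generate_ring R (K \<union> T)"
        by (intro generate_ring.eng_mult generate_ring.incl)
    qed
  qed
  have T_image: "x \<in> \<Phi> ` carrier A" if x: "x \<in> T" for x
  proof -
    have d: "cls x \<in> carrier D" using x by (simp add: D_carrier)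
    have "cls x = cls (class_rep (cls x))" using rep(2)[OF d] by simp
    then obtain h where h: "h \<in> K" "x = h \<otimes> class_rep (cls x)"
      using cls_eq_iff[OF T_carrier(1)[OF x] rep_carrier(1)[OF d]] by blast
    let ?f = "\<lambda>d. if d = cls x then h else \<zero>"
    have s: "supp ?f \<subseteq> {cls x}" by (auto simp: supp_def)
    have fK: "\<And>d. ?f d \<in> K" using h by simp
    have "\<Phi> ?f = (\<Oplus>d\<in>{cls x}. ?f d \<otimes> class_rep d)"
      using s d fK by (intro Phi_superset) auto
    also have "\<dots> = h \<otimes> class_rep (cls x)" using h(1) d by simp
    finally have "x = \<Phi> ?f" by (simp only: h(2)[symmetric])
    moreover have "?f \<in> carrier A"
      using s fK d finite_subset[OF s] by (auto simp: A_carrier)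
    ultimately show ?thesis by blast
  qed
  have smult: "a \<odot>\<^bsub>A\<^esub> f \<in> carrier A" if a: "a \<in> K" and f: "f \<in> carrier A" for a f
  proof -
    have s: "supp (a \<odot>\<^bsub>A\<^esub> f) \<subseteq> supp f" using f a by (auto simp: coset_algebra_def supp_def)
    have "\<forall>d. (a \<odot>\<^bsub>A\<^esub> f) d \<in> K" using a f unfolding A_carrier by (simp add: coset_algebra_def)
    then show ?thesis using f s finite_subset[OF s] unfolding A_carrier by blast
  qed
  have add: "f \<oplus>\<^bsub>A\<^esub> g \<in> carrier A" if f: "f \<in> carrier A" and g: "g \<in> carrier A" for f g
  proof -
    have s: "supp (f \<oplus>\<^bsub>A\<^esub> g) \<subseteq> supp f \<union> supp g" by (auto simp: coset_algebra_def supp_def)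
    have "\<forall>d. (f \<oplus>\<^bsub>A\<^esub> g) d \<in> K" using g f unfolding A_carrier by (simp add: coset_algebra_def)
    then show ?thesis using f g s finite_subset[OF s] unfolding A_carrier by blast
  qed
  show "generate_ring R (K \<union> T) \<subseteq> \<Phi> ` carrier A"
  proof
    fix y assume "y \<in> generate_ring R (K \<union> T)"
    then show "y \<in> \<Phi> ` carrier A"
    proof (induction rule: generate_ring.induct)
      case one
      show ?case using T_image T_of_K by simp
    next
      case (incl y)
      show ?case
      proof (cases "y = \<zero>")
        case True
        have "\<Phi> (\<lambda>_. \<zero>) = \<zero>" "(\<lambda>_. \<zero>) \<in> carrier A" by (simp_all add: Phi_eq A_carrier supp_def)
        then show ?thesis using True by (metis image_eqI)
      next
        case False
        then show ?thesis using incl T_image T_of_K by blast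
      qed
    next
      case (a_inv y)
      then obtain f where f: "f \<in> carrier A" "y = \<Phi> f" by blast
      then have "\<Phi> ((\<ominus> \<one>) \<odot>\<^bsub>A\<^esub> f) = \<ominus> y" using Phi_smult Phi_closed by (simp add: l_minus)
      then show ?case using smult[OF _ f(1), of "\<ominus> \<one>"] by (metis K_closed(2,3) image_eqI)
    next
      case (eng_add y z)
      then obtain f g where "f \<in> carrier A" "y = \<Phi> f" "g \<in> carrier A" "z = \<Phi> g" by blast
      then show ?case using Phi_add add by (metis image_eqI)
    next
      case (eng_mult y z)
      then obtain f g where "f \<in> carrier A" "y = \<Phi> f" "g \<in> carrier A" "z = \<Phi> g" by blast
      then show ?case using Phi_mult A_mult_closed by (metis image_eqI)
    qed
  qed
qed

lemma absolutely_co_Galois_iff: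
  "absolutely_co_Galois R K \<longleftrightarrow> independent_reps \<and> generates_algebra R K T"
  by (simp add: absolutely_co_Galois_iff_bij bij_betw_def inj_Phi_iff Phi_image generates_algebra_def)

end

section \<open>The characterization\<close>

context subfield_extension
begin

section \<open>The group of torsion elements\<close>

lemma U_simps: "carrier U = T" "x \<otimes>\<^bsub>U\<^esub> y = x \<otimes> y" "\<one>\<^bsub>U\<^esub> = \<one>"
  by (simp_all add: torsion_group_def units_of_def)

lemma group_U: "group U"
proof (rule groupI)
  fix x assume x: "x \<in> carrier U"
  then have "inv x \<in> carrier U" "inv x \<otimes>\<^bsub>U\<^esub> x = \<one>\<^bsub>U\<^esub>"
    using T_inv inv_closed_nonzero T_carrier by (auto simp: U_simps)
  then show "\<exists>y\<in>carrier U. y \<otimes>\<^bsub>U\<^esub> x = \<one>\<^bsub>U\<^esub>" by blast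
qed (auto simp: U_simps T_mult T_of_K T_carrier m_assoc)

lemma inv_U: "x \<in> T \<Longrightarrow> y \<in> T \<Longrightarrow> y \<otimes> x = \<one> \<Longrightarrow> inv\<^bsub>U\<^esub> x = y"
  using group.inv_equality[OF group_U, of y x] by (simp add: U_simps)

lemma subgroup_Units_K: "subgroup (Units k) U"
proof (rule group.subgroupI[OF group_U])
  show "Units k \<subseteq> carrier U" using T_of_K by (auto simp: Units_K U_simps)
  have "\<one> \<in> Units k" by (simp add: Units_K)
  then show "Units k \<noteq> {}" by blast
  fix x assume x: "x \<in> Units k"
  then have xK: "x \<in> K" "x \<noteq> \<zero>" by (simp_all add: Units_K)
  have "inv\<^bsub>U\<^esub> x = inv x"
    using T_of_K[OF xK] T_inv[OF T_of_K[OF xK]] inv_closed_nonzero(3)[OF K_carrier[OF xK(1)] xK(2)]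
    by (rule inv_U)
  then show "inv\<^bsub>U\<^esub> x \<in> Units k" using xK inv_closed_nonzero[of x] by (simp add: Units_K)
  fix y assume "y \<in> Units k"
  then show "x \<otimes>\<^bsub>U\<^esub> y \<in> Units k" using x by (simp add: Units_K U_simps integral_iff)
qed

section \<open>Necessity of the conditions\<close>

text \<open>
  If \<open>x\<close> has finite order, multiplication by \<open>x\<close> permutes its powers, so their sum vanishes unless
  \<open>x = 1\<close>: a linear dependence with coefficients \<open>1\<close>.
\<close>
lemma essential_of_independent:
  assumes ind: independent_reps shows "essential_extension (Units k) U"
  unfolding essential_extension_def
proof (intro conjI allI impI)
  show "subgroup (Units k) U" by (rule subgroup_Units_K)
  fix F assume "subgroup F U \<and> F \<inter> Units k = {\<one>\<^bsub>U\<^esub>}"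
  then have F: "subgroup F U" and FK: "\<And>x. x \<in> F \<Longrightarrow> x \<in> K \<Longrightarrow> x \<noteq> \<zero> \<Longrightarrow> x = \<one>"
    by (auto simp: Units_K U_simps)
  have FT: "F \<subseteq> T" using subgroup.subset[OF F] by (simp add: U_simps)
  have F1: "\<one> \<in> F" using subgroup.one_closed[OF F] by (simp add: U_simps)
  have Fm: "x \<otimes> y \<in> F" if "x \<in> F" "y \<in> F" for x y
    using subgroup.m_closed[OF F that] by (simp add: U_simps)
  have Finv: "inv x \<in> F" if "x \<in> F" for x
  proof -
    have xT: "x \<in> T" using that FT by blast
    have "inv\<^bsub>U\<^esub> x = inv x"
      using xT T_inv[OF xT] inv_closed_nonzero(3)[OF T_carrier[OF xT]] by (rule inv_U)
    then show ?thesis using subgroup.m_inv_closed[OF F that] by simp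
  qed
  have "x = \<one>" if x: "x \<in> F" for x
  proof (rule ccontr)
    assume x1: "x \<noteq> \<one>"
    have xc: "x \<in> carrier R" "x \<noteq> \<zero>" using x FT T_carrier by auto
    have xF: "x [^] (i::nat) \<in> F" for i using F1 Fm x by (induction i) auto
    obtain n :: nat where n: "n \<ge> 1" "x [^] n \<in> K" using x FT T_iff by blast
    have xn: "x [^] n = \<one>" using FK[OF xF n(2)] xc pow_nonzero by simp
    \<comment> \<open>A set rather than a sequence: \<open>n\<close> need not be the exact order of
      \<open>x\<close>, so powers may repeat.\<close>
    define P where "P = (\<lambda>i. x [^] i) ` {..<n}"
    have P: "finite P" "P \<subseteq> F" "\<one> \<in> P" using xF n by (auto simp: P_def image_iff intro!: bexI[of _ 0])
    have Pc: "y \<in> carrier R" if "y \<in> P" for y using that P(2) FT T_carrier by auto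
    have "(\<lambda>y. x \<otimes> y) ` P \<subseteq> P"
    proof clarify
      fix y assume "y \<in> P"
      then obtain i where i: "i < n" "y = x [^] i" by (auto simp: P_def)
      then have e: "x \<otimes> y = x [^] Suc i" using xc by (simp add: m_comm)
      show "x \<otimes> y \<in> P"
      proof (cases "Suc i < n")
        case True
        then show ?thesis unfolding P_def e by blast
      next
        case False
        then have "Suc i = n" using i by simp
        then show ?thesis using e xn P(3) by simp
      qed
    qed
    moreover have inj: "inj_on (\<lambda>y. x \<otimes> y) P" using xc Pc by (intro inj_onI) (simp add: m_lcancel)
    ultimately have img: "(\<lambda>y. x \<otimes> y) ` P = P" using endo_inj_surj[OF P(1)] by blast
    define s where "s = (\<Oplus>y\<in>P. y)"
    have sc: "s \<in> carrier R" unfolding s_def using Pc by (intro finsum_closed) auto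
    have "x \<otimes> s = (\<Oplus>y\<in>P. x \<otimes> y)"
      unfolding s_def using P Pc xc by (intro finsum_rdistr) auto
    also have "\<dots> = (\<Oplus>y\<in>(\<lambda>y. x \<otimes> y) ` P. y)"
      using Pc xc by (intro finsum_reindex[OF _ inj, symmetric]) auto
    finally have "x \<otimes> s = s" unfolding img s_def .
    then have "(x \<ominus> \<one>) \<otimes> s = \<zero>" using xc sc by (simp add: minus_eq l_distr l_minus r_neg)
    then have "s = \<zero>" using xc sc x1 by (simp add: integral_iff)
    moreover have "(\<Oplus>y\<in>P. \<one> \<otimes> y) = s" unfolding s_def using Pc by (intro finsum_cong') auto
    ultimately have sum: "(\<Oplus>y\<in>P. \<one> \<otimes> y) = \<zero>" by simp
    have "\<one> = \<zero>"
    proof (rule independent_elements[OF ind P(1) _ _ _ sum P(3)])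
      show "P \<subseteq> T" using P FT by blast
      \<comment> \<open>The factor \<open>h\<close> is a quotient of two powers of \<open>x\<close>,
        so it lies in \<open>F\<close> and in \<open>K\<close> and must be 1.\<close>
      show "y = z" if yz: "y \<in> P" "z \<in> P" "h \<in> K" "y = h \<otimes> z" for y z h
      proof -
        have yzF: "y \<in> F" "z \<in> F" using yz(1,2) P(2) by auto
        then have "y \<in> T" "z \<in> T" using FT by auto
        then have z: "z \<in> carrier R" "z \<noteq> \<zero>" "y \<noteq> \<zero>" using T_carrier by blast+
        have h0: "h \<noteq> \<zero>" using yz(4) z by auto
        have "y \<otimes> inv z = h"
          unfolding yz(4) using yz(3) z inv_closed_nonzero[OF z(1,2)] by (simp add: m_assoc)
        moreover have "y \<otimes> inv z \<in> F" using yzF by (intro Fm Finv)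
        ultimately have "h = \<one>" using FK yz h0 by blast
        then show ?thesis using yz z by simp
      qed
    qed simp
    then show False by simp
  qed
  then show "F = {\<one>\<^bsub>U\<^esub>}" unfolding U_simps using F1 by blast
qed

text \<open>If \<open>y\<close> were outside \<open>K\<close>, then \<open>1\<close>,
  \<open>y\<close> and \<open>1 + y\<close> would lie in three different classes, although the first
  two add up to the third.\<close>

lemma dependent_triple:
  assumes ind: independent_reps and y: "y \<in> T" "\<one> \<oplus> y \<in> T" shows "y \<in> K"
proof (rule ccontr)
  assume n: "y \<notin> K"
  let ?z = "\<one> \<oplus> y"
  have c: "y \<in> carrier R" "?z \<in> carrier R" using y T_carrier by auto
  have zK: "?z \<notin> K"
  proof
    assume "?z \<in> K"
    then have "\<ominus> \<one> \<oplus> ?z \<in> K" by simp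
    then show False using n c by (simp add: a_assoc[symmetric] l_neg)
  qed
  have y0: "y \<noteq> \<zero>" using n by auto
  have cancel: "h = \<one> \<oplus> h' \<Longrightarrow> h \<in> K \<Longrightarrow> h' \<in> carrier R \<Longrightarrow> h' \<in> K" for h h'
    using K_closed(5)[OF K_closed(3)[OF K_closed(2)], of h] by (simp add: a_assoc[symmetric] l_neg)
  have not_mult: "y \<noteq> h \<otimes> \<one>" "?z \<noteq> h \<otimes> \<one>" "\<one> \<noteq> h \<otimes> y" "\<one> \<noteq> h \<otimes> ?z" "?z \<noteq> h \<otimes> y" "y \<noteq> h \<otimes> ?z"
    if h: "h \<in> K" for h
  proof -
    have inv_case: "\<one> = g \<otimes> w \<Longrightarrow> w \<in> K" if gw: "g \<in> K" "w \<in> carrier R" for g w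
    proof -
      assume e: "\<one> = g \<otimes> w"
      then have "g \<noteq> \<zero>" using gw by auto
      moreover have "g \<otimes> w \<in> K" unfolding e[symmetric] by simp
      ultimately show "w \<in> K" using subfield_m_inv_simprule[OF K, of g w] gw by blast
    qed
    show "y \<noteq> h \<otimes> \<one>" "?z \<noteq> h \<otimes> \<one>" using h n zK by auto
    show "\<one> \<noteq> h \<otimes> y" "\<one> \<noteq> h \<otimes> ?z" using inv_case[OF h] c n zK by blast+
    \<comment> \<open>From \<open>1 + y = g y\<close> follows \<open>1 = (g - 1) y\<close>, which
      puts \<open>y\<close> into \<open>K\<close>.\<close>
    have main: "?z \<noteq> g \<otimes> y" if "g \<in> K" for g
    proof
      assume e: "?z = g \<otimes> y"
      have "\<one> = ?z \<oplus> \<ominus> y" using c by (simp add: a_assoc r_neg)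
      also have "\<dots> = (g \<oplus> \<ominus> \<one>) \<otimes> y" unfolding e using that c by (simp add: l_distr l_minus)
      finally show False using inv_case[of "g \<oplus> \<ominus> \<one>" y] that c n by simp
    qed
    then show "?z \<noteq> h \<otimes> y" using h .
    show "y \<noteq> h \<otimes> ?z"
    proof
      assume e: "y = h \<otimes> ?z"
      then have h0: "h \<noteq> \<zero>" using y0 c by auto
      note ih = inv_closed_nonzero[OF K_carrier[OF h] h0]
      have "inv h \<otimes> y = inv h \<otimes> (h \<otimes> ?z)" using e by simp
      also have "\<dots> = ?z"
        by (simp only: m_assoc[OF ih(1) K_carrier[OF h] c(2), symmetric] ih(3) l_one c(2))
      finally have "inv h \<otimes> y = ?z" .
      then show False using main[of "inv h"] h h0 by simp
    qed
  qed
  have dist: "y \<noteq> \<one>" "?z \<noteq> \<one>" "?z \<noteq> y" using n zK not_mult(5)[of \<one>] c by auto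
  let ?c = "\<lambda>x. if x = ?z then \<ominus> \<one> else \<one>"
  have "(\<Oplus>x\<in>{\<one>, y, ?z}. ?c x \<otimes> x) = \<one> \<oplus> (y \<oplus> \<ominus> ?z)"
    using dist c by (simp add: l_minus)
  also have "\<dots> = \<zero>" using c by (simp add: a_assoc[symmetric] r_neg del: minus_add)
  finally have sum: "(\<Oplus>x\<in>{\<one>, y, ?z}. ?c x \<otimes> x) = \<zero>" .
  have "?c \<one> = \<zero>"
  proof (rule independent_elements[OF ind _ _ _ _ sum])
    show "{\<one>, y, ?z} \<subseteq> T" using y T_of_K by simp
    show "v = w" if "v \<in> {\<one>, y, ?z}" "w \<in> {\<one>, y, ?z}" "h \<in> K" "v = h \<otimes> w" for v w h
      using that(1,2,4) not_mult[OF that(3)] by (simp only: insert_iff empty_iff) metis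
  qed auto
  then show False using dist by auto
qed

text \<open>From \<open>y^2 = -1\<close> follow \<open>(1 + y)^2 = 2 y\<close> and
  \<open>(1 + y)^4 = -4\<close>, so \<open>y\<close> and \<open>1 + y\<close> are both torsion.
  Torsion elements are nonzero, whence the separate first case.\<close>

lemma sqrt_minus_one_of_independent:
  assumes ind: independent_reps and y: "y \<in> carrier R" "y \<otimes> y = \<ominus> \<one>" shows "y \<in> K"
proof (cases "y = \<zero> \<or> \<one> \<oplus> y = \<zero>")
  case True
  moreover have "y = \<ominus> \<one>" if "\<one> \<oplus> y = \<zero>" using that y by (metis a_comm minus_equality one_closed)
  ultimately show ?thesis by auto
next
  case False
  have "y [^] (2::nat) \<in> K" using y by (simp add: numeral_2_eq_2)
  then have yT: "y \<in> T" using y False by (auto simp: T_iff intro!: exI[of _ 2])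
  have sq: "(\<one> \<oplus> y) \<otimes> (\<one> \<oplus> y) = y \<oplus> y"
  proof -
    have "(\<one> \<oplus> y) \<otimes> (\<one> \<oplus> y) = \<one> \<oplus> y \<oplus> (y \<oplus> \<ominus> \<one>)" using y by (simp add: l_distr r_distr)
    also have "\<dots> = y \<oplus> y" using y by (simp add: a_ac r_neg1 r_neg2) (simp add: a_assoc[symmetric] a_comm r_neg)
    finally show ?thesis .
  qed
  have "(\<one> \<oplus> y) [^] (4::nat) = (y \<oplus> y) \<otimes> (y \<oplus> y)"
  proof -
    have "(4::nat) = 2 + 2" by simp
    then have "(\<one> \<oplus> y) [^] (4::nat) = (\<one> \<oplus> y) [^] (2::nat) \<otimes> (\<one> \<oplus> y) [^] (2::nat)"
      using y by (metis a_closed nat_pow_mult one_closed)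
    then show ?thesis using sq y by (simp add: numeral_2_eq_2)
  qed
  also have "\<dots> \<in> K" using y by (simp add: l_distr r_distr)
  finally have "\<one> \<oplus> y \<in> T" using False y by (auto simp: T_iff intro!: exI[of _ 4])
  then show ?thesis using dependent_triple[OF ind yT] by blast
qed

text \<open>By Frobenius \<open>(1 + y)^l = 1 + y^l\<close> is in \<open>K\<close>, so
  \<open>dependent_triple\<close> applies to \<open>y\<close>.\<close>

lemma char_root_of_independent:
  assumes ind: independent_reps and l: "Factorial_Ring.prime (l::nat)" "add_pow R l \<one> = \<zero>"
    and y: "y \<in> carrier R" "y [^] l \<in> K"
  shows "y \<in> K"
proof (cases "y = \<zero> \<or> \<one> \<oplus> y = \<zero>")
  case True
  moreover have "y = \<ominus> \<one>" if "\<one> \<oplus> y = \<zero>" using that y by (metis a_comm minus_equality one_closed)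
  ultimately show ?thesis by auto
next
  case False
  have l1: "l \<ge> 1" using prime_gt_0_nat[OF l(1)] by simp
  have "y \<in> T" using y False l1 by (auto simp: T_iff)
  moreover have "(\<one> \<oplus> y) [^] l \<in> K" using frobenius_one_plus[OF l y(1)] y by simp
  then have "\<one> \<oplus> y \<in> T" using y False l1 by (auto simp: T_iff)
  ultimately show ?thesis using dependent_triple[OF ind] by blast
qed

section \<open>Sufficiency of the conditions\<close>

lemma roots_of_unity_of_essential:
  assumes ess: "essential_extension (Units k) U"
    and q: "Factorial_Ring.prime (q::nat)" and y: "y \<in> carrier R" "y [^] q = \<one>"
  shows "y \<in> K"
proof (rule ccontr)
  assume n: "y \<notin> K"
  have q1: "q \<ge> 1" using prime_gt_0_nat[OF q] by simp
  have y0: "y \<noteq> \<zero>" using n by auto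
  have yT: "y [^] (i::nat) \<in> T" for i
  proof -
    have "(y [^] i) [^] q = \<one>" using y nat_pow_commute_exponents[OF y(1), of i q] by simp
    then show ?thesis using y y0 pow_nonzero q1 by (auto simp: T_iff intro!: exI[of _ q])
  qed
  let ?F = "range (\<lambda>i::nat. y [^] i)"
  have "subgroup ?F U"
  proof (rule group.subgroupI[OF group_U])
    show "?F \<subseteq> carrier U" using yT by (auto simp: U_simps)
    fix v assume "v \<in> ?F"
    then obtain i :: nat where i: "v = y [^] i" by blast
    have "i * (q - 1) + i = q * i" using q1 by (cases q) auto
    then have "y [^] (i * (q - 1)) \<otimes> y [^] i = (y [^] q) [^] i"
      using y(1) by (simp add: nat_pow_mult nat_pow_pow)
    then have "inv\<^bsub>U\<^esub> v = y [^] (i * (q - 1))" unfolding i using yT y by (intro inv_U) auto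
    then show "inv\<^bsub>U\<^esub> v \<in> ?F" by blast
    fix w assume "w \<in> ?F"
    then obtain j :: nat where "w = y [^] j" by blast
    then have "v \<otimes>\<^bsub>U\<^esub> w = y [^] (i + j)" using i y by (simp add: U_simps nat_pow_mult)
    then show "v \<otimes>\<^bsub>U\<^esub> w \<in> ?F" by blast
  qed simp
  \<comment> \<open>An exponent prime to \<open>q\<close> together with
    \<open>y [^] q = \<one>\<close> would put \<open>y\<close> itself into \<open>K\<close>; all
    other exponents are multiples of \<open>q\<close> and give 1.\<close>
  moreover have "?F \<inter> Units k = {\<one>\<^bsub>U\<^esub>}"
  proof -
    have "y [^] i = \<one>" if "y [^] i \<in> K" for i :: nat
    proof -
      have "\<not> coprime q i"
        using in_subfield_of_coprime_powers[OF K y(1) y0 _ that, of q] y(2) n by auto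
      then have "q dvd i" using q prime_imp_coprime by blast
      then obtain j where "i = q * j" by (elim dvdE)
      then have "y [^] i = (y [^] q) [^] j" using y(1) by (simp add: nat_pow_pow)
      then show ?thesis using y(2) by simp
    qed
    then have "z = \<one>" if "z \<in> ?F" "z \<in> K" for z using that by (metis rangeE)
    moreover have "\<one> \<in> ?F" by (rule range_eqI[of _ _ 0]) simp
    moreover have "\<one> \<in> Units k" "Units k \<subseteq> K" by (auto simp: Units_K)
    ultimately show ?thesis unfolding U_simps by blast
  qed
  ultimately have "?F = {\<one>\<^bsub>U\<^esub>}" using ess by (simp add: essential_extension_def)
  moreover have "y \<in> ?F" using y by (intro range_eqI[of _ _ 1]) simp
  ultimately have "y = \<one>" by (simp add: U_simps)
  then show False using n by simp
qed

lemma ring_char_K: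
  assumes "ring_char k > 0"
  shows "Factorial_Ring.prime (ring_char k)" "add_pow R (ring_char k) \<one> = \<zero>"
proof -
  let ?Q = "\<lambda>n::nat. n > 0 \<and> add_pow R n \<one> = \<zero>"
  have pow_eq: "add_pow k n \<one> = add_pow R n \<one>" for n :: nat by (simp add: add_pow_def nat_pow_def)
  have ex: "\<exists>n. ?Q n" using assms by (auto simp: ring_char_def pow_eq split: if_splits)
  then have l: "ring_char k = (LEAST n. ?Q n)" by (simp add: ring_char_def pow_eq)
  have Q: "?Q (ring_char k)" unfolding l using ex by (rule LeastI_ex)
  then show "add_pow R (ring_char k) \<one> = \<zero>" by simp
  have least: "ring_char k \<le> n" if "?Q n" for n unfolding l using that by (rule Least_le)
  have "ring_char k \<noteq> 1" using Q by auto
  then have gt: "ring_char k > 1" using Q by auto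
  show "Factorial_Ring.prime (ring_char k)"
  proof (rule ccontr)
    assume "\<not> Factorial_Ring.prime (ring_char k)"
    then obtain a where a: "a dvd ring_char k" "a \<noteq> 1" "a \<noteq> ring_char k"
      using gt unfolding prime_nat_iff by blast
    obtain b where b: "ring_char k = a * b" using a(1) by (elim dvdE)
    have "a \<noteq> 0" "b \<noteq> 0" using b gt by (metis mult_is_0 not_less_zero)+
    moreover have "b \<noteq> 1" using a(3) b by (metis mult.right_neutral)
    ultimately have ab: "ring_char k = a * b" "1 < a" "1 < b" using a(2) b by linarith+
    have c: "add_pow R n \<one> \<in> carrier R" for n :: nat by simp
    have "add_pow R a \<one> \<otimes> add_pow R b \<one> = add_pow R (ring_char k) \<one>"
      using add_pow_ldistr[of \<one> "add_pow R b \<one>" a] add.nat_pow_pow[of \<one> a b] ab(1)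
      by (simp add: mult.commute)
    then have "add_pow R a \<one> = \<zero> \<or> add_pow R b \<one> = \<zero>" using Q c by (simp add: integral_iff)
    then have "ring_char k \<le> a \<or> ring_char k \<le> b" using least[of a] least[of b] ab(2,3) by (elim disjE) auto
    moreover have "a < a * b" "b < a * b" using ab(2,3) by simp_all
    ultimately show False using ab(1) by linarith
  qed
qed

text \<open>Two different primes annihilating 1 would give \<open>1 = 0\<close> by Bezout.\<close>

lemma ring_char_K_eq:
  assumes q: "Factorial_Ring.prime (q::nat)" "add_pow R q \<one> = \<zero>"
  shows "ring_char k = q"
proof -
  let ?Q = "\<lambda>n::nat. n > 0 \<and> add_pow R n \<one> = \<zero>"
  have pow_eq: "add_pow k n \<one> = add_pow R n \<one>" for n :: nat by (simp add: add_pow_def nat_pow_def)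
  have "\<exists>n. ?Q n" using q prime_gt_0_nat[OF q(1)] by blast
  then have "ring_char k = Least ?Q" by (simp add: ring_char_def pow_eq)
  moreover have "?Q (Least ?Q)"
    by (rule LeastI[of ?Q q]) (use q prime_gt_0_nat[OF q(1)] in auto)
  ultimately have "ring_char k > 0" by simp
  note l = ring_char_K[OF this]
  show ?thesis
  proof (rule ccontr)
    assume "ring_char k \<noteq> q"
    then have "coprime (ring_char k) q" using primes_coprime l(1) q(1) by blast
    then obtain u v where uv: "ring_char k * u = q * v + 1"
      using coprime_bezout_strong[of "ring_char k" q] prime_gt_1_nat[OF q(1)] by auto
    have mult: "add_pow R (m * n) \<one> = \<zero>" if "add_pow R m \<one> = \<zero>" for m n :: nat
      using add.nat_pow_pow[of \<one> n m] that by (simp add: add.nat_pow_one)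
    have "add_pow R (q * v + 1) \<one> = add_pow R (q * v) \<one> \<oplus> \<one>"
      using add.nat_pow_mult[of \<one> "q * v" 1] by (simp add: add.nat_pow_eone)
    then show False using mult[OF l(2), of u] mult[OF q(2), of v] uv by simp
  qed
qed

text \<open>The exponents are chosen minimal, hence prime to the characteristic.\<close>
lemma independent_of_conditions:
  assumes ess: "essential_extension (Units k) U"
    and char: "\<And>l x. ring_char k = l \<Longrightarrow> l > 0 \<Longrightarrow> x \<in> carrier R \<Longrightarrow> x [^] l \<in> K \<Longrightarrow> x \<in> K"
    and sqrt: "\<And>y. y \<in> carrier R \<Longrightarrow> y \<otimes> y = \<ominus> \<one> \<Longrightarrow> y \<in> K"
  shows independent_reps
  unfolding independent_reps_def
proof (intro allI impI ballI)
  fix F c d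
  assume F': "finite F \<and> F \<subseteq> carrier D \<and> (\<forall>d\<in>F. c d \<in> K) \<and> (\<Oplus>d\<in>F. c d \<otimes> class_rep d) = \<zero>"
    and d: "d \<in> F"
  have F: "finite F" "\<And>d. d \<in> F \<Longrightarrow> d \<in> carrier D" "\<And>d. d \<in> F \<Longrightarrow> c d \<in> K"
    "(\<Oplus>d\<in>F. c d \<otimes> class_rep d) = \<zero>" using F' by auto
  define e where "e = (\<lambda>x. LEAST n. n \<ge> 1 \<and> x [^] (n::nat) \<in> K)"
  have e: "e x \<ge> 1 \<and> x [^] e x \<in> K" if "x \<in> T" for x
  proof -
    have "\<exists>n. n \<ge> 1 \<and> x [^] (n::nat) \<in> K" using that by (auto simp: T_iff)
    then show ?thesis unfolding e_def by (rule LeastI_ex[of "\<lambda>n. n \<ge> 1 \<and> x [^] n \<in> K"])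
  qed
  have cls_rep: "\<And>d. d \<in> F \<Longrightarrow> cls (class_rep d) = d" using rep(2) F by auto
  have inj: "inj_on class_rep F" by (rule inj_on_inverseI[of _ cls]) (rule cls_rep)
  have repT: "class_rep d \<in> T" if "d \<in> F" for d using rep(1) F(2) that by blast
  have "c (cls (class_rep d)) = \<zero>"
  proof (rule radicals_independent[OF K _ sqrt, of "class_rep ` F" e "\<lambda>x. c (cls x)"])
    show "y \<in> K" if "Factorial_Ring.prime (q::nat)" "y \<in> carrier R" "y [^] q = \<one>" for q y
      using roots_of_unity_of_essential[OF ess that] .
    show "finite (class_rep ` F)" using F by simp
    show "class_rep ` F \<subseteq> carrier R - {\<zero>}" using repT T_carrier by auto
    show "e x > 0 \<and> x [^] e x \<in> K" if "x \<in> class_rep ` F" for x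
      using e[of x] repT that by auto
    \<comment> \<open>If the characteristic \<open>q\<close> divided \<open>e x\<close>, with
      cofactor \<open>m\<close>, then extracting a \<open>q\<close>-th root would put
      \<open>x [^] m\<close> into \<open>K\<close>, against the minimality of
      \<open>e x\<close>.\<close>
    show "add_pow R q \<one> \<noteq> \<zero>" if x: "x \<in> class_rep ` F" and q: "Factorial_Ring.prime q" "q dvd e x" for x q
    proof
      assume q0: "add_pow R q \<one> = \<zero>"
      have xT: "x \<in> T" using repT x by auto
      obtain m where m: "e x = q * m" using q(2) by (elim dvdE)
      have m1: "m \<ge> 1" "m < e x" using e[OF xT] m prime_gt_1_nat[OF q(1)] by auto
      have "(x [^] m) [^] q \<in> K" using e[OF xT] T_carrier(1)[OF xT] m by (simp add: nat_pow_pow mult.commute)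
      then have "x [^] m \<in> K"
        using char[OF ring_char_K_eq[OF q(1) q0]] prime_gt_0_nat[OF q(1)] T_carrier(1)[OF xT] by blast
      then have "e x \<le> m" unfolding e_def using m1(1) by (intro Least_le) simp
      then show False using m1 by simp
    qed
    show "x = y" if xy: "x \<in> class_rep ` F" "y \<in> class_rep ` F" "h \<in> K" "x = h \<otimes> y" for x y h
    proof -
      obtain a b where ab: "a \<in> F" "x = class_rep a" "b \<in> F" "y = class_rep b" using xy by auto
      have c: "x \<noteq> \<zero>" "y \<in> carrier R" using T_carrier[OF repT] ab by simp_all
      then have "h \<noteq> \<zero>" using xy(4) by auto
      then have "cls x = cls y" unfolding xy(4) by (intro cls_eq c(2) xy(3))
      then show ?thesis using ab cls_rep by metis
    qed
    show "c (cls x) \<in> K" if "x \<in> class_rep ` F" for x using that F cls_rep by auto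
    have "(\<Oplus>x\<in>class_rep ` F. c (cls x) \<otimes> x) = (\<Oplus>d\<in>F. c (cls (class_rep d)) \<otimes> class_rep d)"
      using F cls_rep by (intro finsum_reindex[OF _ inj]) auto
    also have "\<dots> = (\<Oplus>d\<in>F. c d \<otimes> class_rep d)" using F cls_rep by (intro finsum_cong') auto
    finally show "(\<Oplus>x\<in>class_rep ` F. c (cls x) \<otimes> x) = \<zero>" using F by simp
  qed (use d in auto)
  then show "c d = \<zero>" using cls_rep d by simp
qed

abbreviation Q :: "'a set monoid" where "Q \<equiv> units_of R Mod Units k"

lemma Q_carrier: "carrier Q = cls ` (carrier R - {\<zero>})"
  by (auto simp: FactGroup_def RCOSETS_def r_coset_def units_of_def field_Units Units_K cls_def image_def)

lemma Q_one: "\<one>\<^bsub>Q\<^esub> = cls \<one>"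
  by (auto simp: Units_K cls_def)

lemma Q_pow: "x \<in> carrier R \<Longrightarrow> cls x [^]\<^bsub>Q\<^esub> (n::nat) = cls (x [^] n)"
proof (induction n)
  case 0
  then show ?case by (simp add: Q_one del: one_FactGroup)
next
  case (Suc n)
  have "a \<otimes>\<^bsub>Q\<^esub> b = (\<Union>x\<in>a. \<Union>y\<in>b. {x \<otimes> y})" for a b
    by (simp add: FactGroup_def set_mult_def units_of_def)
  then show ?case using Suc cls_mult by simp
qed

lemma cls_eq_one_iff: "x \<in> carrier R \<Longrightarrow> x \<noteq> \<zero> \<Longrightarrow> cls x = cls \<one> \<longleftrightarrow> x \<in> K"
  by (auto simp: cls_eq_iff)

text \<open>Trivial \<open>l\<close>-torsion makes the \<open>l\<close>-primary torsion trivial, by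
  extracting \<open>l\<close>-th roots one after another. Zero is included on the right to spare a
  side condition.\<close>

lemma primary_component_trivial_iff:
  "primary_component Q l = {\<one>\<^bsub>Q\<^esub>} \<longleftrightarrow> (\<forall>x\<in>carrier R. x [^] l \<in> K \<longrightarrow> x \<in> K)"
proof
  assume t: "primary_component Q l = {\<one>\<^bsub>Q\<^esub>}"
  show "\<forall>x\<in>carrier R. x [^] l \<in> K \<longrightarrow> x \<in> K"
  proof (intro ballI impI)
    fix x assume x: "x \<in> carrier R" "x [^] l \<in> K"
    show "x \<in> K"
    proof (cases "x = \<zero>")
      case False
      then have "cls x [^]\<^bsub>Q\<^esub> (l ^ 1) = \<one>\<^bsub>Q\<^esub>"
        using x pow_nonzero[OF x(1)] cls_eq_one_iff[of "x [^] l"] by (simp add: Q_pow Q_one del: one_FactGroup)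
      moreover have "cls x \<in> carrier Q" using x False by (simp add: Q_carrier)
      ultimately have "cls x \<in> primary_component Q l" unfolding primary_component_def by blast
      then have "cls x = cls \<one>" unfolding t Q_one by blast
      then show ?thesis using cls_eq_one_iff[OF x(1) False] by blast
    qed simp
  qed
next
  assume r: "\<forall>x\<in>carrier R. x [^] l \<in> K \<longrightarrow> x \<in> K"
  have root: "x \<in> carrier R \<Longrightarrow> x [^] (l ^ n) \<in> K \<Longrightarrow> x \<in> K" for x n
  proof (induction n arbitrary: x)
    case (Suc n)
    have "(x [^] l) [^] (l ^ n) \<in> K" using Suc.prems by (simp add: nat_pow_pow)
    then have "x [^] l \<in> K" using Suc.IH nat_pow_closed[OF Suc.prems(1)] by blast
    then show ?case using r Suc.prems(1) by blast
  qed simp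
  have "d = \<one>\<^bsub>Q\<^esub>" if d: "d \<in> primary_component Q l" for d
  proof -
    obtain x n where x: "x \<in> carrier R" "x \<noteq> \<zero>" "d = cls x" and dn: "d [^]\<^bsub>Q\<^esub> (l ^ n) = \<one>\<^bsub>Q\<^esub>"
      using d by (auto simp: primary_component_def Q_carrier)
    have "cls (x [^] (l ^ n)) = cls \<one>" using dn unfolding x(3) Q_pow[OF x(1)] Q_one .
    then have "x [^] (l ^ n) \<in> K"
      using pow_nonzero[OF x(1,2)] cls_eq_one_iff[of "x [^] (l ^ n)"] x(1) by simp
    then have "x \<in> K" using root x by blast
    then show ?thesis unfolding x(3) Q_one using cls_eq_one_iff[OF x(1,2)] by blast
  qed
  moreover have "\<one>\<^bsub>Q\<^esub> \<in> primary_component Q l"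
  proof -
    have "cls \<one> [^]\<^bsub>Q\<^esub> (l ^ 0) = \<one>\<^bsub>Q\<^esub>"
      by (subst Q_pow) (simp_all add: Q_one del: one_FactGroup)
    moreover have "cls \<one> \<in> carrier Q" by (simp add: Q_carrier)
    ultimately show ?thesis unfolding primary_component_def Q_one by blast
  qed
  ultimately show "primary_component Q l = {\<one>\<^bsub>Q\<^esub>}" by blast
qed

text \<open>In characteristic \<open>l\<close> the only \<open>l\<close>-th root of unity is \<open>1\<close>.\<close>
lemma char_roots_iff:
  assumes l: "Factorial_Ring.prime (l::nat)" "add_pow R l \<one> = \<zero>"
  shows "(\<forall>x\<in>carrier R. x [^] l \<in> K \<longrightarrow> x \<in> K) \<longleftrightarrow>
    (\<lambda>x. x [^] l) ` Units R \<inter> Units k = (\<lambda>x. x [^] l) ` Units k"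
proof
  assume r: "\<forall>x\<in>carrier R. x [^] l \<in> K \<longrightarrow> x \<in> K"
  show "(\<lambda>x. x [^] l) ` Units R \<inter> Units k = (\<lambda>x. x [^] l) ` Units k"
  proof (intro equalityI subsetI)
    fix y assume "y \<in> (\<lambda>x. x [^] l) ` Units R \<inter> Units k"
    then obtain x where x: "x \<in> carrier R" "x \<noteq> \<zero>" "y = x [^] l" "y \<in> K"
      by (auto simp: field_Units Units_K)
    then have "x \<in> K" using r by blast
    then show "y \<in> (\<lambda>x. x [^] l) ` Units k" using x(2,3) by (auto simp: Units_K)
  next
    fix y assume "y \<in> (\<lambda>x. x [^] l) ` Units k"
    then obtain x where x: "x \<in> K" "x \<noteq> \<zero>" "y = x [^] l" by (auto simp: Units_K)
    then have "y \<in> Units k" using pow_nonzero by (simp add: Units_K)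
    moreover have "x \<in> Units R" using x by (simp add: field_Units)
    ultimately show "y \<in> (\<lambda>x. x [^] l) ` Units R \<inter> Units k" using x by blast
  qed
next
  assume e: "(\<lambda>x. x [^] l) ` Units R \<inter> Units k = (\<lambda>x. x [^] l) ` Units k"
  show "\<forall>x\<in>carrier R. x [^] l \<in> K \<longrightarrow> x \<in> K"
  proof (intro ballI impI)
    fix x assume x: "x \<in> carrier R" "x [^] l \<in> K"
    show "x \<in> K"
    proof (cases "x = \<zero>")
      case False
      then have "x [^] l \<in> (\<lambda>x. x [^] l) ` Units R \<inter> Units k"
        using x pow_nonzero by (auto simp: field_Units Units_K)
      then obtain y where y: "y \<in> K" "y \<noteq> \<zero>" "x [^] l = y [^] l" unfolding e by (auto simp: Units_K)
      have yc: "y \<in> carrier R" using y by simp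
      note iy = inv_closed_nonzero[OF yc y(2)]
      \<comment> \<open>\<open>w\<close> is \<open>x / y - 1\<close>; Frobenius turns
        \<open>(1 + w)^l = 1\<close> into \<open>w^l = 0\<close>.\<close>
      define w where "w = \<ominus> \<one> \<oplus> x \<otimes> inv y"
      have w: "w \<in> carrier R" "\<one> \<oplus> w = x \<otimes> inv y"
        using x iy by (simp_all add: w_def a_assoc[symmetric] r_neg)
      have "(x \<otimes> inv y) [^] l = (y \<otimes> inv y) [^] l"
        using nat_pow_distrib[OF x(1) iy(1), of l] nat_pow_distrib[OF yc iy(1), of l] y(3) by simp
      then have "\<one> \<oplus> w [^] l = \<one>"
        using frobenius_one_plus[OF l w(1)] w(2) iy(2) by simp
      then have "w [^] l = \<zero>" using add.l_cancel_one[of \<one> "w [^] l"] w(1) by simp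
      then have "w = \<zero>" using pow_nonzero[OF w(1)] by blast
      then have "x \<otimes> inv y = \<one>" using w(2) by simp
      then have "x \<otimes> (inv y \<otimes> y) = y" using x yc iy(1) by (simp add: m_assoc[symmetric])
      then show ?thesis using iy(3) x y(1) by simp
    qed simp
  qed
qed

text \<open>Order 4 makes \<open>y \<otimes> y\<close> a square root of 1 other than 1, hence -1.
  The inequality excludes characteristic 2, where \<open>y \<otimes> y = \<ominus> \<one>\<close>
  only says that the order divides 2.\<close>

lemma order_four_iff:
  assumes y: "y \<in> carrier R" "y \<noteq> \<zero>"
  shows "group.ord (units_of R) y = 4 \<longleftrightarrow> y \<otimes> y = \<ominus> \<one> \<and> \<one> \<noteq> \<ominus> \<one>"
proof -
  interpret G: group "units_of R" by (rule units_group)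
  have yG: "y \<in> carrier (units_of R)" using y by (simp add: units_of_carrier field_Units)
  have pow: "y [^]\<^bsub>units_of R\<^esub> n = y [^] n" for n :: nat
    using y by (intro units_of_pow) (simp add: field_Units)
  have id: "y [^] n = \<one> \<longleftrightarrow> G.ord y dvd n" for n :: nat
    using G.pow_eq_id[OF yG, of n] by (simp add: pow units_of_one)
  have p2: "y [^] (2::nat) = y \<otimes> y" using y by (simp add: numeral_2_eq_2)
  have p4: "y [^] (4::nat) = (y \<otimes> y) \<otimes> (y \<otimes> y)"
    using y nat_pow_mult[of y 2 2] by (simp add: p2)
  show ?thesis
  proof
    assume o: "G.ord y = 4"
    have n2: "y \<otimes> y \<noteq> \<one>" using id[of 2] o p2 by auto
    have "(y \<otimes> y) \<otimes> (y \<otimes> y) = \<one>" using id[of 4] o p4 by simp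
    then have "y \<otimes> y = \<ominus> \<one>" using square_eq_one[of "y \<otimes> y"] n2 y by simp
    then show "y \<otimes> y = \<ominus> \<one> \<and> \<one> \<noteq> \<ominus> \<one>" using n2 by auto
  next
    assume h: "y \<otimes> y = \<ominus> \<one> \<and> \<one> \<noteq> \<ominus> \<one>"
    then have "\<not> G.ord y dvd 2" using id[of 2] p2 by metis
    moreover have "(\<ominus> \<one>) \<otimes> (\<ominus> \<one>) = \<one>" by (simp add: l_minus)
    then have d4: "G.ord y dvd 4" using id[of 4] p4 h by simp
    moreover have "d = 4" if "d dvd 4" "\<not> d dvd 2" for d :: nat
    proof -
      have "d \<le> 4" using that(1) by (intro dvd_imp_le) auto
      then consider "d = 0" | "d = 1" | "d = 2" | "d = 3" | "d = 4" by linarith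
      then show ?thesis using that by cases auto
    qed
    ultimately show "G.ord y = 4" by blast
  qed
qed

end

theorem theorem3p5:
  fixes L :: "('a, 'm) ring_scheme" and K :: "'a set"
  assumes "field L" and "subfield K L"
  shows "(absolutely_co_Galois L K \<longleftrightarrow>
            (generates_algebra L K (torsion_set L K) \<and>
             essential_extension (Units (L\<lparr>carrier := K\<rparr>)) (torsion_group L K) \<and>
             (\<forall>l. ring_char (L\<lparr>carrier := K\<rparr>) = l \<and> l > 0 \<longrightarrow>
                primary_component (units_of L Mod Units (L\<lparr>carrier := K\<rparr>)) l
                  = {\<one>\<^bsub>units_of L Mod Units (L\<lparr>carrier := K\<rparr>)\<^esub>})) \<and>
            (\<forall>i\<in>carrier (units_of L).
               group.ord (units_of L) i = 4 \<longrightarrow> i \<in> Units (L\<lparr>carrier := K\<rparr>))) \<and>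
         (\<forall>l. ring_char (L\<lparr>carrier := K\<rparr>) = l \<and> l > 0 \<longrightarrow>
            (primary_component (units_of L Mod Units (L\<lparr>carrier := K\<rparr>)) l
               = {\<one>\<^bsub>units_of L Mod Units (L\<lparr>carrier := K\<rparr>)\<^esub>} \<longleftrightarrow>
             (\<lambda>x. x [^]\<^bsub>L\<^esub> l) ` Units L \<inter> Units (L\<lparr>carrier := K\<rparr>)
               = (\<lambda>x. x [^]\<^bsub>L\<^esub> l) ` Units (L\<lparr>carrier := K\<rparr>)))"
proof -
  interpret S: subfield_extension L K
    using assms by (simp add: subfield_extension_def subfield_extension_axioms_def)
  have char: "Factorial_Ring.prime l \<and> add_pow L l \<one>\<^bsub>L\<^esub> = \<zero>\<^bsub>L\<^esub>" if "ring_char S.k = l \<and> l > 0" for l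
    using S.ring_char_K that by auto
  let ?C1 = "essential_extension (Units S.k) S.U"
  let ?C2 = "\<forall>l. ring_char S.k = l \<and> l > 0 \<longrightarrow> primary_component S.Q l = {\<one>\<^bsub>S.Q\<^esub>}"
  let ?C3 = "\<forall>i\<in>carrier (units_of L). group.ord (units_of L) i = 4 \<longrightarrow> i \<in> Units S.k"
  \<comment> \<open>Generation of \<open>L\<close> occurs on both sides, so independence has to be
    matched with the remaining conditions.\<close>
  have "S.independent_reps \<longleftrightarrow> ?C1 \<and> ?C2 \<and> ?C3"
  proof
    assume ind: "S.independent_reps"
    have ?C1 by (rule S.essential_of_independent[OF ind])
    moreover have ?C2
      unfolding S.primary_component_trivial_iff
    proof (intro allI impI ballI)
      fix l x assume l: "ring_char S.k = l \<and> l > 0" and x: "x \<in> carrier L" "x [^]\<^bsub>L\<^esub> l \<in> K"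
      from conjunct1[OF char[OF l]] conjunct2[OF char[OF l]] x show "x \<in> K"
        by (rule S.char_root_of_independent[OF ind])
    qed
    moreover have ?C3
    proof (intro ballI impI)
      fix i assume "i \<in> carrier (units_of L)" and o: "group.ord (units_of L) i = 4"
      then have i: "i \<in> carrier L" "i \<noteq> \<zero>\<^bsub>L\<^esub>" by (simp_all add: units_of_carrier S.field_Units)
      then have "i \<in> K"
        using S.order_four_iff[OF i] o S.sqrt_minus_one_of_independent[OF ind i(1)] by blast
      then show "i \<in> Units S.k" using i(2) by (simp add: S.Units_K)
    qed
    ultimately show "?C1 \<and> ?C2 \<and> ?C3" by blast
  next
    assume C: "?C1 \<and> ?C2 \<and> ?C3"
    then have C1: ?C1 and C2: ?C2 and C3: ?C3 by blast+
    show "S.independent_reps"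
    proof (rule S.independent_of_conditions[OF C1])
      show "x \<in> K" if "ring_char S.k = l" "l > 0" "x \<in> carrier L" "x [^]\<^bsub>L\<^esub> l \<in> K" for l x
      proof -
        have "primary_component S.Q l = {\<one>\<^bsub>S.Q\<^esub>}" using C2 that(1,2) by blast
        then show ?thesis using that(3,4) unfolding S.primary_component_trivial_iff by blast
      qed
      show "y \<in> K" if y: "y \<in> carrier L" "y \<otimes>\<^bsub>L\<^esub> y = \<ominus>\<^bsub>L\<^esub> \<one>\<^bsub>L\<^esub>" for y
      \<comment> \<open>In characteristic 2 the square roots of -1 are those of 1, which
        essentiality puts into \<open>K\<close>; otherwise they have order 4.\<close>
      proof (cases "\<one>\<^bsub>L\<^esub> = \<ominus>\<^bsub>L\<^esub> \<one>\<^bsub>L\<^esub>")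
        case True
        have "y [^]\<^bsub>L\<^esub> (2::nat) = \<one>\<^bsub>L\<^esub>"
          using y by (simp add: numeral_2_eq_2 True[symmetric])
        then show ?thesis using S.roots_of_unity_of_essential[OF C1 two_is_prime_nat y(1)] by blast
      next
        case False
        have y0: "y \<noteq> \<zero>\<^bsub>L\<^esub>"
        proof
          assume "y = \<zero>\<^bsub>L\<^esub>"
          then have "\<ominus>\<^bsub>L\<^esub> \<one>\<^bsub>L\<^esub> = \<zero>\<^bsub>L\<^esub>" using y(2) by simp
          then show False using S.add.inv_eq_1_iff[OF S.one_closed] by simp
        qed
        have "y \<in> carrier (units_of L)" using y y0 by (simp add: units_of_carrier S.field_Units)
        then have "y \<in> Units S.k" using C3 S.order_four_iff[OF y(1) y0] y(2) False by blast
        then show ?thesis by (simp add: S.Units_K)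
      qed
    qed
  qed
  then have "absolutely_co_Galois L K \<longleftrightarrow> (generates_algebra L K S.T \<and> ?C1 \<and> ?C2) \<and> ?C3"
    using S.absolutely_co_Galois_iff by blast
  moreover have "\<forall>l. ring_char S.k = l \<and> l > 0 \<longrightarrow>
      (primary_component S.Q l = {\<one>\<^bsub>S.Q\<^esub>} \<longleftrightarrow>
       (\<lambda>x. x [^]\<^bsub>L\<^esub> l) ` Units L \<inter> Units S.k = (\<lambda>x. x [^]\<^bsub>L\<^esub> l) ` Units S.k)"
    unfolding S.primary_component_trivial_iff
  proof (intro allI impI)
    fix l assume l: "ring_char S.k = l \<and> l > 0"
    from conjunct1[OF char[OF l]] conjunct2[OF char[OF l]]
    show "(\<forall>x\<in>carrier L. x [^]\<^bsub>L\<^esub> l \<in> K \<longrightarrow> x \<in> K) \<longleftrightarrow>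
        (\<lambda>x. x [^]\<^bsub>L\<^esub> l) ` Units L \<inter> Units S.k = (\<lambda>x. x [^]\<^bsub>L\<^esub> l) ` Units S.k"
      by (rule S.char_roots_iff)
  qed
  ultimately show ?thesis by blast
qed

end
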